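(* Let $\Gamma$ be a finitely generated group which is hyperbolic relative to a finite family $\{H_1,\dots,H_n\}$ of subgroups. Then $\Gamma$ is uniformly embeddable in a Hilbert space if and only if each subgroup $H_i$ is uniformly embeddable in a Hilbert space.
   Context: Uniformly embeddable: a metric space $(X,d)$ is uniformly embeddable (in a Hilbert space) if there exist a real Hilbert space $\mathcal{H}$, a map $F:X\to\mathcal{H}$ and non-decreasing functions $\rho_\pm:\mathbb{R}_+\to\mathbb{R}_+$ with $\lim_{t\to\infty}\rho_\pm(t)=\infty$ such that $\rho_-(d(x,x'))\leq\|F(x)-F(x')\|\leq\rho_+(d(x,x'))$ for all $x,x'\in X$. Metrics: $\Gamma$ carries the left-invariant word metric $d_S$ associated to a finite symmetric generating set $S$, and each subgroup $H_i$ carries the restriction of $d_S$. Uniform embeddability does not depend on the choice of $S$; for $H_i$ one obtains the same notion from any proper left-invariant metric on $H_i$. Relative hyperbolicity (in the sense of Osin): $\Gamma$ is hyperbolic relative to $\{H_1,\dots,H_n\}$ if there are a finite symmetric subset $X\subset\Gamma$ such that $X\cup H_1\cup\dots\cup H_n$ generates $\Gamma$, and a finite subset $\mathcal{R}$ of the free product $F=F(X)*H_1*\cdots*H_n$ ($F(X)$ being the free group on $X$), such that the kernel of the natural surjection $F\to\Gamma$ is the normal closure of $\mathcal{R}$ in $F$, and such that the relative isoperimetric inequality is linear: there is a constant $C>0$ such that every word $w$ of length $\ell$ in the alphabet $X\cup\bigsqcup_k(H_k\setminus\{e\})$ which represents the identity of $\Gamma$ is equal in $F$ to a product $\prod_{j=1}^{m}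 f_j r_j^{\pm1} f_j^{-1}$ with $f_j\in F$, $r_j\in\mathcal{R}$ and $m\leq C\ell$. *)

theory Defs
  imports "HOL-Analysis.Analysis" "HOL-Algebra.Module" "HOL-Algebra.Generated_Groups"
begin

section \<open>Real Hilbert spaces on an explicit carrier\<close>

text \<open>
  Uniform embeddability quantifies existentially over real Hilbert spaces. Type classes
  such as \<^class>\<open>real_inner\<close> cannot be quantified over inside a formula, so Hilbert spaces are
  taken here as modules over the ring of real numbers with an inner product \<open>ip\<close>. The two
  remaining ring fields of the module record (multiplication and unit) are irrelevant.
\<close>

definition real_ring :: "real ring" where
  "real_ring = \<lparr>carrier = UNIV, monoid.mult = (*), one = 1, ring.zero = 0, add = (+)\<rparr>"

lemma real_ring_simps [simp]:
  "carrier real_ring = UNIV" "add real_ring = (+)" "monoid.mult real_ring = (*)"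
  "\<one>\<^bsub>real_ring\<^esub> = 1" "\<zero>\<^bsub>real_ring\<^esub> = 0"
  by (simp_all add: real_ring_def)

lemma cring_real_ring: "cring real_ring"
proof (rule cringI)
  show "abelian_group real_ring"
    by (rule abelian_groupI) (auto intro: exI[of _ "- x" for x])
  show "comm_monoid real_ring" by unfold_locales auto
qed (auto simp: algebra_simps)

definition ip_norm :: "('v \<Rightarrow> 'v \<Rightarrow> real) \<Rightarrow> 'v \<Rightarrow> real" where
  "ip_norm ip v = sqrt (ip v v)"

locale real_hilbert_space = Module.module real_ring V
  for V :: "(real, 'v) module" (structure) +
  fixes ip :: "'v \<Rightarrow> 'v \<Rightarrow> real"
  assumes ip_commute: "\<lbrakk>u \<in> carrier V; v \<in> carrier V\<rbrakk> \<Longrightarrow> ip u v = ip v u"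
    and ip_add: "\<lbrakk>u \<in> carrier V; v \<in> carrier V; w \<in> carrier V\<rbrakk> \<Longrightarrow> ip (u \<oplus> v) w = ip u w + ip v w"
    and ip_smult: "\<lbrakk>u \<in> carrier V; v \<in> carrier V\<rbrakk> \<Longrightarrow> ip (c \<odot> u) v = c * ip u v"
    and ip_pos: "\<lbrakk>u \<in> carrier V; u \<noteq> \<zero>\<rbrakk> \<Longrightarrow> 0 < ip u u"
    and complete: "\<lbrakk>\<And>n::nat. a n \<in> carrier V;
        \<And>e. 0 < e \<Longrightarrow> \<exists>N. \<forall>m\<ge>N. \<forall>n\<ge>N. ip_norm ip (a m \<ominus> a n) < e\<rbrakk>
      \<Longrightarrow> \<exists>v\<in>carrier V. (\<lambda>n. ip_norm ip (a n \<ominus> v)) \<longlonglongrightarrow> 0"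

section \<open>Uniform embeddability\<close>

definition uniform_embedding ::
    "'a set \<Rightarrow> ('a \<Rightarrow> 'a \<Rightarrow> real) \<Rightarrow> (real, 'v) module \<Rightarrow> ('v \<Rightarrow> 'v \<Rightarrow> real) \<Rightarrow> ('a \<Rightarrow> 'v) \<Rightarrow> bool" where
  "uniform_embedding M d V ip F \<longleftrightarrow>
     F \<in> M \<rightarrow> carrier V \<and>
     (\<exists>\<rho>m \<rho>p :: real \<Rightarrow> real.
        mono_on {0..} \<rho>m \<and> mono_on {0..} \<rho>p \<and>
        \<rho>m \<in> {0..} \<rightarrow> {0..} \<and> \<rho>p \<in> {0..} \<rightarrow> {0..} \<and>
        filterlim \<rho>m at_top at_top \<and> filterlim \<rho>p at_top at_top \<and>
        (\<forall>x\<in>M. \<forall>y\<in>M.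
           \<rho>m (d x y) \<le> ip_norm ip (F x \<ominus>\<^bsub>V\<^esub> F y) \<and>
           ip_norm ip (F x \<ominus>\<^bsub>V\<^esub> F y) \<le> \<rho>p (d x y)))"

text \<open>
  The existential quantifier ranges over Hilbert spaces whose carrier is a set of functions
  from the ambient type of the metric space to the reals. This type is large enough to host
  (an isomorphic copy of) the part of any Hilbert space that matters for an embedding:
  an embedding into a Hilbert space on any type whatsoever yields one of this form, see
  the lemmas \<open>uniformly_embeddableI\<close> and \<open>uniformly_embeddable_type_classI\<close> below.
\<close>

definition uniformly_embeddable :: "'a set \<Rightarrow> ('a \<Rightarrow> 'a \<Rightarrow> real) \<Rightarrow> bool" where
  "uniformly_embeddable M d \<longleftrightarrow>
     (\<exists>(V :: (real, 'a \<Rightarrow> real) module) ip F.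
        real_hilbert_space V ip \<and> uniform_embedding M d V ip F)"

context real_hilbert_space
begin

lemma ip_add_right:
  "\<lbrakk>u \<in> carrier V; v \<in> carrier V; w \<in> carrier V\<rbrakk> \<Longrightarrow> ip w (u \<oplus> v) = ip w u + ip w v"
  using ip_add ip_commute by simp

lemma ip_smult_right: "\<lbrakk>u \<in> carrier V; v \<in> carrier V\<rbrakk> \<Longrightarrow> ip v (c \<odot> u) = c * ip v u"
  using ip_smult ip_commute smult_closed[of c u] by simp

lemma ip_zero: "v \<in> carrier V \<Longrightarrow> ip \<zero> v = 0" "v \<in> carrier V \<Longrightarrow> ip v \<zero> = 0"
  using ip_add[of \<zero> \<zero> v] ip_commute[of \<zero> v] by simp_all

lemma ip_minus_left: "\<lbrakk>u \<in> carrier V; v \<in> carrier V\<rbrakk> \<Longrightarrow> ip (\<ominus> u) v = - ip u v"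
  using ip_add[of u "\<ominus> u" v] by (simp add: M.r_neg ip_zero)

lemma ip_diff: 
  assumes "u \<in> carrier V" "v \<in> carrier V" "w \<in> carrier V"
  shows "ip (u \<ominus> v) w = ip u w - ip v w" "ip w (u \<ominus> v) = ip w u - ip w v"
proof -
  show 1: "ip (u \<ominus> v) w = ip u w - ip v w"
    using assms by (simp add: a_minus_def ip_add ip_minus_left)
  show "ip w (u \<ominus> v) = ip w u - ip w v"
    using 1 assms ip_commute M.minus_closed by metis
qed

lemma ip_nonneg: "u \<in> carrier V \<Longrightarrow> 0 \<le> ip u u"
  using ip_pos[of u] ip_zero[of \<zero>] by (cases "u = \<zero>") auto

lemma Cauchy_Schwarz:
  assumes u: "u \<in> carrier V" and v: "v \<in> carrier V"
  shows "\<bar>ip u v\<bar> \<le> ip_norm ip u * ip_norm ip v"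
proof (cases "v = \<zero>")
  case True
  then show ?thesis using u by (simp add: ip_zero ip_norm_def)
next
  case False
  then have pos: "0 < ip v v" using ip_pos v by simp
  define c where "c = ip u v / ip v v"
  have cv: "c \<odot> v \<in> carrier V" using v by simp
  have "0 \<le> ip (u \<ominus> c \<odot> v) (u \<ominus> c \<odot> v)" using ip_nonneg u cv by simp
  also have "\<dots> = ip u u - 2 * c * ip u v + c * c * ip v v"
    using u v cv ip_commute[OF v u] by (simp add: ip_diff ip_smult ip_smult_right algebra_simps)
  also have "\<dots> = ip u u - (ip u v)^2 / ip v v"
    using pos by (simp add: c_def field_simps power2_eq_square)
  finally have "(ip u v)^2 \<le> ip u u * ip v v" using pos by (simp add: field_simps)
  then have "sqrt ((ip u v)^2) \<le> sqrt (ip u u * ip v v)" by (rule real_sqrt_le_mono)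
  then show ?thesis by (simp add: ip_norm_def real_sqrt_mult)
qed

end

lemma uniformly_embeddableI:
  fixes V :: "(real, 'v) module" (structure) and M :: "'a set"
  assumes H: "real_hilbert_space V ip" and E: "uniform_embedding M d V ip F"
  shows "uniformly_embeddable M d"
proof -
  interpret real_hilbert_space V ip by (rule H)
  have FV: "F x \<in> carrier V" if "x \<in> M" for x
    using E that by (auto simp: uniform_embedding_def)
  txt \<open>\<open>W\<close> is the double orthogonal complement of the image of \<open>F\<close>.\<close>
  define W where "W = {v \<in> carrier V. \<forall>u\<in>carrier V. (\<forall>x\<in>M. ip u (F x) = 0) \<longrightarrow> ip u v = 0}"
  define \<Phi> where "\<Phi> v = (\<lambda>x. if x \<in> M then ip v (F x) else 0)" for v
  have WV: "v \<in> carrier V" if "v \<in> W" for v using that by (simp add: W_def)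
  have Wadd: "u \<oplus> v \<in> W" if "u \<in> W" "v \<in> W" for u v
    using that by (auto simp: W_def ip_add_right)
  have Wsm: "c \<odot> u \<in> W" if "u \<in> W" for u c
    using that by (auto simp: W_def ip_smult_right)
  have W0: "\<zero> \<in> W" by (auto simp: W_def ip_zero)
  have Wminus: "\<ominus> u \<in> W" if "u \<in> W" for u
    using that ip_minus_left ip_commute M.a_inv_closed by (auto simp: W_def)
  have Wdiff: "u \<ominus> v \<in> W" if "u \<in> W" "v \<in> W" for u v
    using that by (simp add: a_minus_def Wadd Wminus)
  have FW: "F x \<in> W" if "x \<in> M" for x using that FV by (auto simp: W_def)
  have \<Phi>0: "v = \<zero>" if "v \<in> W" "\<Phi> v = (\<lambda>x. 0)" for v
  proof (rule ccontr)
    assume "v \<noteq> \<zero>"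
    have "\<forall>x\<in>M. ip v (F x) = 0"
      using that(2) unfolding \<Phi>_def fun_eq_iff by (metis (full_types))
    then have "ip v v = 0" using that(1) by (auto simp: W_def)
    then show False using ip_pos[of v] \<open>v \<noteq> \<zero>\<close> WV[OF that(1)] by simp
  qed
  have \<Phi>add: "\<Phi> (u \<oplus> v) = (\<lambda>x. \<Phi> u x + \<Phi> v x)" if "u \<in> W" "v \<in> W" for u v
    using that by (auto simp: \<Phi>_def ip_add WV FV)
  have \<Phi>sm: "\<Phi> (c \<odot> u) = (\<lambda>x. c * \<Phi> u x)" if "u \<in> W" for u c
    using that by (auto simp: \<Phi>_def ip_smult WV FV)
  have \<Phi>diff: "\<Phi> (u \<ominus> v) = (\<lambda>x. \<Phi> u x - \<Phi> v x)" if "u \<in> W" "v \<in> W" for u v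
    using that by (auto simp: \<Phi>_def ip_diff WV FV)
  have \<Phi>zero: "\<Phi> \<zero> = (\<lambda>x. 0)" by (auto simp: \<Phi>_def ip_zero FV)
  have inj: "inj_on \<Phi> W"
  proof (rule inj_onI)
    fix u v assume uv: "u \<in> W" "v \<in> W" "\<Phi> u = \<Phi> v"
    then have "u \<ominus> v = \<zero>" using \<Phi>0[OF Wdiff] \<Phi>diff by simp
    then show "u = v"
      using uv WV by (metis M.add.inv_solve_right M.l_zero M.zero_closed a_minus_def)
  qed
  define \<Psi> where "\<Psi> = inv_into W \<Phi>"
  have \<Psi>\<Phi>[simp]: "\<Psi> (\<Phi> v) = v" if "v \<in> W" for v
    using inj that by (simp add: \<Psi>_def)
  define U :: "(real, 'a \<Rightarrow> real) module" where
    "U = \<lparr>carrier = \<Phi> ` W, monoid.mult = (\<lambda>f g. f), one = (\<lambda>x. 0), ring.zero = (\<lambda>x. 0),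
          add = (\<lambda>f g x. f x + g x), smult = (\<lambda>c f x. c * f x)\<rparr>"
  define ip' where "ip' f g = ip (\<Psi> f) (\<Psi> g)" for f g
  have Usimps: "carrier U = \<Phi> ` W" "\<zero>\<^bsub>U\<^esub> = (\<lambda>x. 0)" "add U = (\<lambda>f g x. f x + g x)"
    "smult U = (\<lambda>c f x. c * f x)" by (simp_all add: U_def)
  have ag: "abelian_group U"
  proof (rule abelian_groupI)
    fix f assume "f \<in> carrier U"
    then obtain v where v: "v \<in> W" "f = \<Phi> v" by (auto simp: Usimps)
    have "\<Phi> (\<ominus> v) \<oplus>\<^bsub>U\<^esub> f = \<Phi> (\<ominus> v \<oplus> v)" using v by (simp add: Usimps \<Phi>add Wminus)
    then show "\<exists>g\<in>carrier U. g \<oplus>\<^bsub>U\<^esub> f = \<zero>\<^bsub>U\<^esub>"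
      using v Wminus by (auto simp: M.l_neg WV \<Phi>zero Usimps intro!: bexI[of _ "\<Phi> (\<ominus> v)"])
  next
    fix f g assume "f \<in> carrier U" "g \<in> carrier U"
    then obtain u v where "u \<in> W" "v \<in> W" "f = \<Phi> u" "g = \<Phi> v" by (auto simp: Usimps)
    then show "f \<oplus>\<^bsub>U\<^esub> g \<in> carrier U"
      using Wadd[of u v] \<Phi>add[of u v] by (auto simp: Usimps image_iff intro!: bexI[of _ "u \<oplus> v"])
  next
    show "\<zero>\<^bsub>U\<^esub> \<in> carrier U" using W0 \<Phi>zero by (force simp: Usimps)
  qed (auto simp: Usimps)
  have mod: "Module.module real_ring U"
  proof (rule moduleI[OF cring_real_ring ag])
    fix c f assume "f \<in> carrier U"
    then obtain u where "u \<in> W" "f = \<Phi> u" by (auto simp: Usimps)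
    then show "c \<odot>\<^bsub>U\<^esub> f \<in> carrier U"
      using Wsm[of u c] \<Phi>sm[of u c] by (auto simp: Usimps image_iff intro!: bexI[of _ "c \<odot> u"])
  qed (auto simp: Usimps algebra_simps)
  interpret U: Module.module real_ring U by (rule mod)
  have Udiff: "\<Phi> u \<ominus>\<^bsub>U\<^esub> \<Phi> v = \<Phi> (u \<ominus> v)" if "u \<in> W" "v \<in> W" for u v
  proof -
    have c: "\<Phi> u \<in> carrier U" "\<Phi> v \<in> carrier U" "\<Phi> (u \<ominus> v) \<in> carrier U"
      using that Wdiff by (auto simp: Usimps)
    have "\<Phi> u = \<Phi> (u \<ominus> v) \<oplus>\<^bsub>U\<^esub> \<Phi> v" using that by (simp add: Usimps \<Phi>diff)
    then show ?thesis
      by (metis U.M.add.inv_solve_right a_minus_def c)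
  qed
  have norm': "ip_norm ip' (\<Phi> u \<ominus>\<^bsub>U\<^esub> \<Phi> v) = ip_norm ip (u \<ominus> v)" if "u \<in> W" "v \<in> W" for u v
    using that by (simp add: ip_norm_def ip'_def Udiff Wdiff)
  have "real_hilbert_space U ip'"
  proof
    fix f g assume "f \<in> carrier U" "g \<in> carrier U"
    then show "ip' f g = ip' g f" by (auto simp: Usimps ip'_def WV ip_commute)
  next
    fix f g h assume "f \<in> carrier U" "g \<in> carrier U" "h \<in> carrier U"
    then obtain u v w where uvw: "u \<in> W" "v \<in> W" "w \<in> W" "f = \<Phi> u" "g = \<Phi> v" "h = \<Phi> w"
      by (auto simp: Usimps)
    have "f \<oplus>\<^bsub>U\<^esub> g = \<Phi> (u \<oplus> v)" using uvw by (simp add: Usimps \<Phi>add)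
    then show "ip' (f \<oplus>\<^bsub>U\<^esub> g) h = ip' f h + ip' g h"
      using uvw by (simp add: ip'_def Wadd WV ip_add)
  next
    fix f g c assume "f \<in> carrier U" "g \<in> carrier U"
    then obtain u v where uv: "u \<in> W" "v \<in> W" "f = \<Phi> u" "g = \<Phi> v"
      by (auto simp: Usimps)
    have "c \<odot>\<^bsub>U\<^esub> f = \<Phi> (c \<odot> u)" using uv by (simp add: Usimps \<Phi>sm)
    then show "ip' (c \<odot>\<^bsub>U\<^esub> f) g = c * ip' f g"
      using uv by (simp add: ip'_def Wsm WV ip_smult)
  next
    fix f assume "f \<in> carrier U" and n: "f \<noteq> \<zero>\<^bsub>U\<^esub>"
    then obtain u where u: "u \<in> W" "f = \<Phi> u" by (auto simp: Usimps)
    with n have "u \<noteq> \<zero>" by (auto simp: Usimps \<Phi>zero)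
    with u show "0 < ip' f f" by (simp add: ip'_def WV ip_pos)
  next
    fix a :: "nat \<Rightarrow> 'a \<Rightarrow> real"
    assume s: "\<And>n. a n \<in> carrier U"
      and C: "\<And>e. 0 < e \<Longrightarrow> \<exists>N. \<forall>m\<ge>N. \<forall>n\<ge>N. ip_norm ip' (a m \<ominus>\<^bsub>U\<^esub> a n) < e"
    have "\<exists>t. \<forall>n. t n \<in> W \<and> a n = \<Phi> (t n)"
      using s by (intro choice) (auto simp: Usimps)
    then obtain t where t: "\<And>n. t n \<in> W" "\<And>n. a n = \<Phi> (t n)" by blast
    have "\<exists>v\<in>carrier V. (\<lambda>n. ip_norm ip (t n \<ominus> v)) \<longlonglongrightarrow> 0"
      using C t by (intro complete) (auto simp: WV norm')
    then obtain v where v: "v \<in> carrier V" "(\<lambda>n. ip_norm ip (t n \<ominus> v)) \<longlonglongrightarrow> 0" by blast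
    have "ip u v = 0" if u: "u \<in> carrier V" "\<forall>x\<in>M. ip u (F x) = 0" for u
    proof -
      have z: "ip u (t n) = 0" for n using t(1)[of n] u by (auto simp: W_def)
      have "\<bar>ip u v\<bar> \<le> ip_norm ip u * ip_norm ip (t n \<ominus> v)" for n
        using Cauchy_Schwarz[of u "t n \<ominus> v"] u v(1) t(1) WV z by (simp add: ip_diff)
      moreover have "(\<lambda>n. ip_norm ip u * ip_norm ip (t n \<ominus> v)) \<longlonglongrightarrow> ip_norm ip u * 0"
        by (intro tendsto_mult tendsto_const v(2))
      ultimately have "\<bar>ip u v\<bar> \<le> ip_norm ip u * 0"
        by (intro LIMSEQ_le_const) auto
      then show ?thesis by simp
    qed
    then have "v \<in> W" using v by (auto simp: W_def)
    then show "\<exists>f\<in>carrier U. (\<lambda>n. ip_norm ip' (a n \<ominus>\<^bsub>U\<^esub> f)) \<longlonglongrightarrow> 0"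
      using v t by (auto simp: Usimps norm' intro!: bexI[of _ v])
  qed
  moreover have "uniform_embedding M d U ip' (\<lambda>x. \<Phi> (F x))"
    using E FW unfolding uniform_embedding_def by (auto simp: Usimps norm')
  ultimately show ?thesis unfolding uniformly_embeddable_def by blast
qed

lemma uniformly_embeddable_type_classI:
  fixes F :: "'a \<Rightarrow> 'h :: {real_inner, complete_space}"
  assumes "mono_on {0..} \<rho>m" "mono_on {0..} \<rho>p"
    and "\<rho>m \<in> {0..} \<rightarrow> {0..}" "\<rho>p \<in> {0..} \<rightarrow> {0..}"
    and "filterlim \<rho>m at_top at_top" "filterlim \<rho>p at_top at_top"
    and "\<And>x y. \<lbrakk>x \<in> M; y \<in> M\<rbrakk> \<Longrightarrow> \<rho>m (d x y) \<le> norm (F x - F y)"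
    and "\<And>x y. \<lbrakk>x \<in> M; y \<in> M\<rbrakk> \<Longrightarrow> norm (F x - F y) \<le> \<rho>p (d x y)"
  shows "uniformly_embeddable M d"
proof -
  define V :: "(real, 'h) module" where
    "V = \<lparr>carrier = UNIV, monoid.mult = (\<lambda>u v. u), one = 0, ring.zero = 0,
          add = (+), smult = scaleR\<rparr>"
  have Vs: "carrier V = UNIV" "\<zero>\<^bsub>V\<^esub> = 0" "add V = (+)" "smult V = scaleR"
    by (simp_all add: V_def)
  have ag: "abelian_group V"
    by (rule abelian_groupI) (auto simp: Vs algebra_simps intro: exI[of _ "- x" for x])
  have mod: "Module.module real_ring V"
    by (rule moduleI[OF cring_real_ring ag]) (auto simp: Vs algebra_simps)
  interpret V: Module.module real_ring V by (rule mod)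
  have diff: "u \<ominus>\<^bsub>V\<^esub> v = u - v" for u v
    using V.M.add.inv_solve_right[of "u - v" u v] by (simp add: a_minus_def Vs)
  have nrm: "ip_norm (\<bullet>) v = norm v" for v :: 'h
    by (simp add: ip_norm_def norm_eq_sqrt_inner)
  have "real_hilbert_space V (\<bullet>)"
  proof
    fix a :: "nat \<Rightarrow> 'h"
    assume "\<And>e. 0 < e \<Longrightarrow> \<exists>N. \<forall>m\<ge>N. \<forall>n\<ge>N. ip_norm (\<bullet>) (a m \<ominus>\<^bsub>V\<^esub> a n) < e"
    then have "Cauchy a" by (simp add: diff nrm Cauchy_def dist_norm)
    then obtain v where "a \<longlonglongrightarrow> v" using Cauchy_convergent_iff convergent_def by blast
    then show "\<exists>v\<in>carrier V. (\<lambda>n. ip_norm (\<bullet>) (a n \<ominus>\<^bsub>V\<^esub> v)) \<longlonglongrightarrow> 0"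
      by (auto simp: Vs diff nrm LIM_zero_iff tendsto_norm_zero_iff intro!: exI[of _ v])
  qed (auto simp: Vs inner_add_left intro: inner_commute)
  moreover have "uniform_embedding M d V (\<bullet>) F"
    using assms unfolding uniform_embedding_def diff nrm Vs
    by (intro conjI exI[of _ \<rho>m] exI[of _ \<rho>p]) auto
  ultimately show ?thesis by (rule uniformly_embeddableI)
qed

section \<open>Word metrics\<close>

definition word_length :: "('g, 'b) monoid_scheme \<Rightarrow> 'g set \<Rightarrow> 'g \<Rightarrow> nat" where
  "word_length G S g =
     (LEAST n. \<exists>ws. set ws \<subseteq> S \<and> length ws = n \<and> foldr (monoid.mult G) ws \<one>\<^bsub>G\<^esub> = g)"

definition word_metric :: "('g, 'b) monoid_scheme \<Rightarrow> 'g set \<Rightarrow> 'g \<Rightarrow> 'g \<Rightarrow> real" where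
  "word_metric G S g h = real (word_length G S (inv\<^bsub>G\<^esub> g \<otimes>\<^bsub>G\<^esub> h))"

definition symmetric_subset :: "('g, 'b) monoid_scheme \<Rightarrow> 'g set \<Rightarrow> bool" where
  "symmetric_subset G S \<longleftrightarrow> S \<subseteq> carrier G \<and> (\<forall>s\<in>S. inv\<^bsub>G\<^esub> s \<in> S)"

section \<open>The free product of a free group and a family of groups\<close>

text \<open>
  \<open>free_product B I K\<close> is the free product of the free group with basis \<open>B\<close> and the groups
  \<open>K i\<close> for \<open>i \<in> I\<close>: words in the letters \<open>x\<close>, \<open>x\<inverse>\<close> (\<open>Gen True x\<close>, \<open>Gen False x\<close>) and
  \<open>Factor i a\<close> with \<open>a \<in> K i\<close>, modulo the congruence generated by cancellation in the
  free group and by the multiplication in each \<open>K i\<close>. The factors are disjoint by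
  construction. The basis \<open>B\<close> is an abstract set: even if \<open>B\<close> is a
  symmetric subset of a group, the letters \<open>Gen False x\<close> and \<open>Gen True (inv x)\<close> are
  unrelated.
\<close>

datatype ('x, 'i, 'a) letter = Gen bool 'x | Factor 'i 'a

definition fp_letters ::
    "'x set \<Rightarrow> 'i set \<Rightarrow> ('i \<Rightarrow> ('a, 'b) monoid_scheme) \<Rightarrow> ('x, 'i, 'a) letter set" where
  "fp_letters B I K = {Gen s x | s x. x \<in> B} \<union> {Factor i a | i a. i \<in> I \<and> a \<in> carrier (K i)}"

inductive fp_cong ::
    "'x set \<Rightarrow> 'i set \<Rightarrow> ('i \<Rightarrow> ('a, 'b) monoid_scheme)
      \<Rightarrow> ('x, 'i, 'a) letter list \<Rightarrow> ('x, 'i, 'a) letter list \<Rightarrow> bool"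
  for B I K where
  refl: "w \<in> lists (fp_letters B I K) \<Longrightarrow> fp_cong B I K w w"
| sym: "fp_cong B I K u v \<Longrightarrow> fp_cong B I K v u"
| trans: "fp_cong B I K u v \<Longrightarrow> fp_cong B I K v w \<Longrightarrow> fp_cong B I K u w"
| append: "fp_cong B I K u u' \<Longrightarrow> fp_cong B I K v v' \<Longrightarrow> fp_cong B I K (u @ v) (u' @ v')"
| cancel: "x \<in> B \<Longrightarrow> fp_cong B I K [Gen s x, Gen (\<not> s) x] []"
| one: "i \<in> I \<Longrightarrow> fp_cong B I K [Factor i \<one>\<^bsub>K i\<^esub>] []"
| mult: "i \<in> I \<Longrightarrow> a \<in> carrier (K i) \<Longrightarrow> b \<in> carrier (K i)
    \<Longrightarrow> fp_cong B I K [Factor i a, Factor i b] [Factor i (a \<otimes>\<^bsub>K i\<^esub> b)]"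

definition fp_class ::
    "'x set \<Rightarrow> 'i set \<Rightarrow> ('i \<Rightarrow> ('a, 'b) monoid_scheme)
      \<Rightarrow> ('x, 'i, 'a) letter list \<Rightarrow> ('x, 'i, 'a) letter list set" where
  "fp_class B I K w = {v. fp_cong B I K w v}"

definition free_product ::
    "'x set \<Rightarrow> 'i set \<Rightarrow> ('i \<Rightarrow> ('a, 'b) monoid_scheme) \<Rightarrow> ('x, 'i, 'a) letter list set monoid" where
  "free_product B I K =
     \<lparr>carrier = fp_class B I K ` lists (fp_letters B I K),
      monoid.mult = (\<lambda>A D. \<Union>u\<in>A. \<Union>v\<in>D. fp_class B I K (u @ v)),
      one = fp_class B I K []\<rparr>"

lemma fp_cong_lists:
  assumes "fp_cong B I K u v" and "\<And>i. i \<in> I \<Longrightarrow> group (K i)"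
  shows "u \<in> lists (fp_letters B I K) \<and> v \<in> lists (fp_letters B I K)"
  using assms(1)
  by induction (auto simp: fp_letters_def dest!: assms(2) intro: group.is_monoid monoid.m_closed)

lemma fp_class_eq_iff:
  assumes "u \<in> lists (fp_letters B I K)" "v \<in> lists (fp_letters B I K)"
  shows "fp_class B I K u = fp_class B I K v \<longleftrightarrow> fp_cong B I K u v"
proof
  assume "fp_class B I K u = fp_class B I K v"
  then show "fp_cong B I K u v"
    using fp_cong.refl[OF assms(2)] by (auto simp: fp_class_def)
next
  assume "fp_cong B I K u v"
  then show "fp_class B I K u = fp_class B I K v"
    by (auto simp: fp_class_def intro: fp_cong.sym fp_cong.trans)
qed

lemma free_product_mult:
  assumes "\<And>i. i \<in> I \<Longrightarrow> group (K i)"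
    and u: "u \<in> lists (fp_letters B I K)" and v: "v \<in> lists (fp_letters B I K)"
  shows "fp_class B I K u \<otimes>\<^bsub>free_product B I K\<^esub> fp_class B I K v = fp_class B I K (u @ v)"
proof -
  have "fp_class B I K (u' @ v') = fp_class B I K (u @ v)"
    if "u' \<in> fp_class B I K u" "v' \<in> fp_class B I K v" for u' v'
  proof -
    have c: "fp_cong B I K u u'" "fp_cong B I K v v'" using that by (auto simp: fp_class_def)
    have "u' @ v' \<in> lists (fp_letters B I K)" "u @ v \<in> lists (fp_letters B I K)"
      using fp_cong_lists[OF c(1) assms(1)] fp_cong_lists[OF c(2) assms(1)] by auto
    then show ?thesis
      using fp_cong.append[OF c] by (simp add: fp_class_eq_iff fp_cong.sym)
  qed
  then have "fp_class B I K u \<otimes>\<^bsub>free_product B I K\<^esub> fp_class B I K v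
      = (\<Union>u'\<in>fp_class B I K u. \<Union>v'\<in>fp_class B I K v. fp_class B I K (u @ v))"
    by (simp add: free_product_def)
  moreover have "u \<in> fp_class B I K u" "v \<in> fp_class B I K v"
    using u v by (auto simp: fp_class_def intro: fp_cong.refl)
  ultimately show ?thesis by auto
qed

lemma group_free_product:
  assumes K: "\<And>i. i \<in> I \<Longrightarrow> group (K i)"
  shows "group (free_product B I K)"
proof (rule groupI)
  let ?L = "lists (fp_letters B I K)"
  have car: "carrier (free_product B I K) = fp_class B I K ` ?L"
    and one: "\<one>\<^bsub>free_product B I K\<^esub> = fp_class B I K []"
    by (simp_all add: free_product_def)
  have mult: "fp_class B I K u \<otimes>\<^bsub>free_product B I K\<^esub> fp_class B I K v = fp_class B I K (u @ v)"
    if "u \<in> ?L" "v \<in> ?L" for u v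
    using that free_product_mult[of I K] K by blast
  show "\<one>\<^bsub>free_product B I K\<^esub> \<in> carrier (free_product B I K)" by (simp add: car one)
  fix A assume "A \<in> carrier (free_product B I K)"
  then obtain w where w: "w \<in> ?L" "A = fp_class B I K w" by (auto simp: car)
  show "\<one>\<^bsub>free_product B I K\<^esub> \<otimes>\<^bsub>free_product B I K\<^esub> A = A"
    using w mult[of "[]" w] by (simp add: one)
  have "\<exists>v\<in>?L. fp_cong B I K (v @ w) []" using w(1)
  proof (induction w)
    case Nil
    show ?case by (auto intro!: bexI[of _ "[]"] fp_cong.refl)
  next
    case (Cons l w)
    then obtain v where v: "v \<in> ?L" "fp_cong B I K (v @ w) []" by auto
    have "\<exists>l'\<in>fp_letters B I K. fp_cong B I K [l', l] []"
    proof (cases l)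
      case (Gen s x)
      then have "x \<in> B" using Cons.hyps by (auto simp: fp_letters_def)
      then show ?thesis using fp_cong.cancel[of x B I K "\<not> s"] Gen
        by (intro bexI[of _ "Gen (\<not> s) x"]) (auto simp: fp_letters_def)
    next
      case (Factor i a)
      then have i: "i \<in> I" "a \<in> carrier (K i)" using Cons.hyps by (auto simp: fp_letters_def)
      interpret Ki: group "K i" by (rule K[OF i(1)])
      have "fp_cong B I K [Factor i (inv\<^bsub>K i\<^esub> a), Factor i a] []"
        using fp_cong.mult[of i I "inv\<^bsub>K i\<^esub> a" K a B] fp_cong.one[of i I B K] i
        by (auto intro: fp_cong.trans)
      then show ?thesis using Factor i
        by (intro bexI[of _ "Factor i (inv\<^bsub>K i\<^esub> a)"]) (auto simp: fp_letters_def)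
    qed
    then obtain l' where l': "l' \<in> fp_letters B I K" "fp_cong B I K [l', l] []" by blast
    have "fp_cong B I K (v @ ([l', l] @ w)) (v @ ([] @ w))"
      using v(1) Cons.hyps Cons.prems l' by (intro fp_cong.append fp_cong.refl) auto
    then have "fp_cong B I K ((v @ [l']) @ l # w) []" using v(2) by (auto intro: fp_cong.trans)
    then show ?case using v(1) l'(1) by (intro bexI[of _ "v @ [l']"]) auto
  qed
  then obtain v where v: "v \<in> ?L" "fp_cong B I K (v @ w) []" by blast
  have "fp_class B I K (v @ w) = fp_class B I K []"
    using v w by (subst fp_class_eq_iff) auto
  then show "\<exists>D\<in>carrier (free_product B I K). D \<otimes>\<^bsub>free_product B I K\<^esub> A = \<one>\<^bsub>free_product B I K\<^esub>"
    using v(1) w mult[of v w] by (auto simp: car one intro!: bexI[of _ "fp_class B I K v"])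
next
  let ?L = "lists (fp_letters B I K)"
  have mult: "fp_class B I K u \<otimes>\<^bsub>free_product B I K\<^esub> fp_class B I K v = fp_class B I K (u @ v)"
    if "u \<in> ?L" "v \<in> ?L" for u v
    using that free_product_mult[of I K] K by blast
  have car: "carrier (free_product B I K) = fp_class B I K ` ?L"
    by (simp add: free_product_def)
  fix A D assume "A \<in> carrier (free_product B I K)" "D \<in> carrier (free_product B I K)"
  then obtain u v where uv: "u \<in> ?L" "v \<in> ?L" "A = fp_class B I K u" "D = fp_class B I K v"
    by (auto simp: car)
  then show "A \<otimes>\<^bsub>free_product B I K\<^esub> D \<in> carrier (free_product B I K)"
    using mult[of u v] by (auto simp: car)
  fix C assume "C \<in> carrier (free_product B I K)"
  then obtain w where w: "w \<in> ?L" "C = fp_class B I K w" by (auto simp: car)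
  show "A \<otimes>\<^bsub>free_product B I K\<^esub> D \<otimes>\<^bsub>free_product B I K\<^esub> C
      = A \<otimes>\<^bsub>free_product B I K\<^esub> (D \<otimes>\<^bsub>free_product B I K\<^esub> C)"
    using uv w mult[of u v] mult[of v w] mult[of "u @ v" w] mult[of u "v @ w"] by auto
qed

section \<open>Relative hyperbolicity\<close>

definition normal_closure :: "('g, 'b) monoid_scheme \<Rightarrow> 'g set \<Rightarrow> 'g set" where
  "normal_closure G R =
     generate G {f \<otimes>\<^bsub>G\<^esub> r \<otimes>\<^bsub>G\<^esub> inv\<^bsub>G\<^esub> f | f r. f \<in> carrier G \<and> r \<in> R}"

fun letter_value :: "('g, 'b) monoid_scheme \<Rightarrow> ('g, 'i, 'g) letter \<Rightarrow> 'g" where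
  "letter_value G (Gen s x) = (if s then x else inv\<^bsub>G\<^esub> x)"
| "letter_value G (Factor i h) = h"

definition word_value :: "('g, 'b) monoid_scheme \<Rightarrow> ('g, 'i, 'g) letter list \<Rightarrow> 'g" where
  "word_value G w = foldr (monoid.mult G) (map (letter_value G) w) \<one>\<^bsub>G\<^esub>"

text \<open>
  The natural surjection from the free product of the free group on \<open>B\<close> and subgroups
  \<open>H i\<close> of \<open>G\<close> onto \<open>G\<close>. Congruent words have the same value, so the image of a class under
  \<^const>\<open>word_value\<close> is a singleton.
\<close>

definition natural_map :: "('g, 'b) monoid_scheme \<Rightarrow> ('g, 'i, 'g) letter list set \<Rightarrow> 'g" where
  "natural_map G A = the_elem (word_value G ` A)"

abbreviation rel_free_product ::
    "('g, 'b) monoid_scheme \<Rightarrow> 'g set \<Rightarrow> 'i set \<Rightarrow> ('i \<Rightarrow> 'g set) \<Rightarrow> ('g, 'i, 'g) letter list set monoid"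
  where "rel_free_product G B I H \<equiv> free_product B I (\<lambda>i. G\<lparr>carrier := H i\<rparr>)"

abbreviation rel_class ::
    "('g, 'b) monoid_scheme \<Rightarrow> 'g set \<Rightarrow> 'i set \<Rightarrow> ('i \<Rightarrow> 'g set)
      \<Rightarrow> ('g, 'i, 'g) letter list \<Rightarrow> ('g, 'i, 'g) letter list set"
  where "rel_class G B I H \<equiv> fp_class B I (\<lambda>i. G\<lparr>carrier := H i\<rparr>)"

definition rel_alphabet ::
    "('g, 'b) monoid_scheme \<Rightarrow> 'g set \<Rightarrow> 'i set \<Rightarrow> ('i \<Rightarrow> 'g set) \<Rightarrow> ('g, 'i, 'g) letter set" where
  "rel_alphabet G B I H =
     {Gen True x | x. x \<in> B} \<union> {Factor i h | i h. i \<in> I \<and> h \<in> H i - {\<one>\<^bsub>G\<^esub>}}"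

definition conj_product :: "('g, 'b) monoid_scheme \<Rightarrow> ('g \<times> 'g) list \<Rightarrow> 'g" where
  "conj_product G ps =
     foldr (monoid.mult G) (map (\<lambda>(f, r). f \<otimes>\<^bsub>G\<^esub> r \<otimes>\<^bsub>G\<^esub> inv\<^bsub>G\<^esub> f) ps) \<one>\<^bsub>G\<^esub>"

definition linear_rel_isoperimetric ::
    "('g, 'b) monoid_scheme \<Rightarrow> 'g set \<Rightarrow> 'i set \<Rightarrow> ('i \<Rightarrow> 'g set)
      \<Rightarrow> ('g, 'i, 'g) letter list set set \<Rightarrow> bool" where
  "linear_rel_isoperimetric G B I H R \<longleftrightarrow>
     (\<exists>C::real. 0 < C \<and>
        (\<forall>w \<in> lists (rel_alphabet G B I H). word_value G w = \<one>\<^bsub>G\<^esub> \<longrightarrow>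
           (\<exists>ps. set ps \<subseteq> carrier (rel_free_product G B I H)
                        \<times> (R \<union> m_inv (rel_free_product G B I H) ` R) \<and>
                 real (length ps) \<le> C * real (length w) \<and>
                 rel_class G B I H w = conj_product (rel_free_product G B I H) ps)))"

definition relatively_hyperbolic ::
    "('g, 'b) monoid_scheme \<Rightarrow> 'i set \<Rightarrow> ('i \<Rightarrow> 'g set) \<Rightarrow> bool" where
  "relatively_hyperbolic G I H \<longleftrightarrow>
     (\<exists>B R.
        finite B \<and> symmetric_subset G B \<and>
        generate G (B \<union> (\<Union>i\<in>I. H i)) = carrier G \<and>
        finite R \<and> R \<subseteq> carrier (rel_free_product G B I H) \<and>
        kernel (rel_free_product G B I H) G (natural_map G)
          = normal_closure (rel_free_product G B I H) R \<and>
        linear_rel_isoperimetric G B I H R)"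

lemma word_value_append:
  assumes "group G" "letter_value G ` set u \<subseteq> carrier G" "letter_value G ` set v \<subseteq> carrier G"
  shows "word_value G u \<in> carrier G \<and> word_value G (u @ v) = word_value G u \<otimes>\<^bsub>G\<^esub> word_value G v"
proof -
  interpret group G by fact
  have c: "word_value G w \<in> carrier G" if "letter_value G ` set w \<subseteq> carrier G"
    for w :: "('a, 'c, 'a) letter list"
    using that by (induction w) (auto simp: word_value_def)
  show ?thesis using assms(2)
  proof (induction u)
    case Nil
    then show ?case using c[OF assms(3)] by (simp add: word_value_def)
  next
    case (Cons a u)
    then show ?case using c[OF assms(3)] by (simp add: word_value_def m_assoc)
  qed
qed

lemma letter_value_carrier:
  assumes G: "group G" and B: "B \<subseteq> carrier G" and H: "\<And>i. i \<in> I \<Longrightarrow> subgroup (H i) G"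
    and w: "w \<in> lists (fp_letters B I (\<lambda>i. G\<lparr>carrier := H i\<rparr>))"
  shows "letter_value G ` set w \<subseteq> carrier G"
proof -
  interpret group G by fact
  have "letter_value G l \<in> carrier G" if "l \<in> fp_letters B I (\<lambda>i. G\<lparr>carrier := H i\<rparr>)" for l
  proof (cases l)
    case (Gen s x)
    then have "x \<in> B" using that by (simp add: fp_letters_def)
    then show ?thesis using B Gen by auto
  next
    case (Factor i h)
    then have "i \<in> I" "h \<in> H i" using that by (auto simp: fp_letters_def)
    then show ?thesis using H Factor subgroup.mem_carrier by fastforce
  qed
  then show ?thesis using w by (auto simp: in_lists_conv_set)
qed

lemma word_value_cong:
  assumes G: "group G" and B: "B \<subseteq> carrier G" and H: "\<And>i. i \<in> I \<Longrightarrow> subgroup (H i) G"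
    and uv: "fp_cong B I (\<lambda>i. G\<lparr>carrier := H i\<rparr>) u v"
  shows "word_value G u = word_value G v"
proof -
  interpret group G by fact
  let ?L = "fp_letters B I (\<lambda>i. G\<lparr>carrier := H i\<rparr>)"
  have gr: "group (G\<lparr>carrier := H i\<rparr>)" if "i \<in> I" for i
    by (rule subgroup.subgroup_is_group[OF H[OF that] G])
  have HG: "h \<in> carrier G" if "i \<in> I" "h \<in> H i" for i h
    by (rule subgroup.mem_carrier[OF H[OF that(1)] that(2)])
  have L: "letter_value G ` set w \<subseteq> carrier G" if "w \<in> lists ?L" for w
    using letter_value_carrier[OF G B H that] by blast
  show ?thesis using uv
  proof induction
    case (append u u' v v')
    have ls: "u \<in> lists ?L" "u' \<in> lists ?L" "v \<in> lists ?L" "v' \<in> lists ?L"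
      using fp_cong_lists[OF append.hyps(1) gr] fp_cong_lists[OF append.hyps(2) gr] by auto
    have "word_value G (u @ v) = word_value G u \<otimes>\<^bsub>G\<^esub> word_value G v"
      using word_value_append[OF G L[OF ls(1)] L[OF ls(3)]] by simp
    moreover have "word_value G (u' @ v') = word_value G u' \<otimes>\<^bsub>G\<^esub> word_value G v'"
      using word_value_append[OF G L[OF ls(2)] L[OF ls(4)]] by simp
    ultimately show ?case using append.IH by simp
  next
    case (cancel x s)
    then have "x \<in> carrier G" using B by blast
    then show ?case by (cases s) (simp_all add: word_value_def)
  next
    case (mult i a b)
    then have "a \<in> carrier G" "b \<in> carrier G" using HG[of i] by simp_all
    then show ?case by (simp add: word_value_def m_assoc)
  next
    case (one i)
    then show ?case by (simp add: word_value_def)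
  qed simp_all
qed

lemma natural_map_class:
  assumes "group G" "B \<subseteq> carrier G" "\<And>i. i \<in> I \<Longrightarrow> subgroup (H i) G"
    and w: "w \<in> lists (fp_letters B I (\<lambda>i. G\<lparr>carrier := H i\<rparr>))"
  shows "natural_map G (rel_class G B I H w) = word_value G w"
proof -
  have "word_value G v = word_value G w" if "v \<in> rel_class G B I H w" for v
  proof -
    have "fp_cong B I (\<lambda>i. G\<lparr>carrier := H i\<rparr>) w v" using that by (simp add: fp_class_def)
    from word_value_cong[OF assms(1-3) this] show ?thesis by simp
  qed
  moreover have "w \<in> rel_class G B I H w"
    using fp_cong.refl[OF w] by (simp add: fp_class_def)
  ultimately have "word_value G ` rel_class G B I H w = {word_value G w}"
    by blast
  then show ?thesis by (simp add: natural_map_def)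
qed

lemma natural_map_hom:
  assumes G: "group G" and B: "B \<subseteq> carrier G" and H: "\<And>i. i \<in> I \<Longrightarrow> subgroup (H i) G"
  shows "natural_map G \<in> hom (rel_free_product G B I H) G"
proof -
  interpret group G by fact
  let ?L = "fp_letters B I (\<lambda>i. G\<lparr>carrier := H i\<rparr>)"
  have gr: "group (G\<lparr>carrier := H i\<rparr>)" if "i \<in> I" for i
    by (rule subgroup.subgroup_is_group[OF H[OF that] G])
  have HG: "h \<in> carrier G" if "i \<in> I" "h \<in> H i" for i h
    by (rule subgroup.mem_carrier[OF H[OF that(1)] that(2)])
  have L: "letter_value G ` set w \<subseteq> carrier G" if "w \<in> lists ?L" for w
    using letter_value_carrier[OF G B H that] by blast
  have nm: "natural_map G (rel_class G B I H w) = word_value G w" if "w \<in> lists ?L" for w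
    using natural_map_class[OF G B H that] by simp
  have car: "carrier (rel_free_product G B I H) = rel_class G B I H ` lists ?L"
    by (simp add: free_product_def)
  show ?thesis
  proof (rule homI)
    fix A assume "A \<in> carrier (rel_free_product G B I H)"
    then obtain u where u: "u \<in> lists ?L" "A = rel_class G B I H u" by (auto simp: car)
    show "natural_map G A \<in> carrier G"
      using word_value_append[OF G L[OF u(1)] L[OF u(1)]] u nm[of u] by simp
    fix D assume "D \<in> carrier (rel_free_product G B I H)"
    then obtain v where v: "v \<in> lists ?L" "D = rel_class G B I H v" by (auto simp: car)
    have "A \<otimes>\<^bsub>rel_free_product G B I H\<^esub> D = rel_class G B I H (u @ v)"
      unfolding u(2) v(2) by (rule free_product_mult[OF gr u(1) v(1)])
    then show "natural_map G (A \<otimes>\<^bsub>rel_free_product G B I H\<^esub> D)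
        = natural_map G A \<otimes>\<^bsub>G\<^esub> natural_map G D"
      using word_value_append[OF G L[OF u(1)] L[OF v(1)]] u v nm[of u] nm[of v] nm[of "u @ v"]
      by simp
  qed
qed

end

theory Submission
  imports Defs "HOL-Real_Asymp.Real_Asymp"
begin

text \<open>
  A countable metric space is uniformly embeddable iff for all \<open>R\<close> and \<open>\<epsilon>\<close> it carries a positive
  semidefinite kernel with diagonal \<open>1\<close> that is \<open>\<epsilon>\<close>-close to \<open>1\<close> at distance at most \<open>R\<close> and vanishes at
  infinity. Such kernels can be glued along almost invariant vectors with values in \<open>\<ell>\<^sup>2\<close> of an index
  set whose members stand for uniformly embeddable pieces.

  The geometric input is the coned-off Cayley graph, with the translates of the relators as
  \<open>2\<close>-cells. Every edge lies in boundedly many cells, and the isoperimetric inequality says that a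
  closed walk of length \<open>l\<close> is a sum of \<open>O(l)\<close> cells. If a closed walk crosses a cut at an edge \<open>e\<close>, then
  by conservation of flow it crosses the cut once more at an edge linked to \<open>e\<close> by the cells of the
  filling, and this is used twice.

  Cutting along the spheres around the identity, the distance of two geodesics at each level bounds
  the number of cells needed there from below; summing over the levels contradicts the linear bound
  if geodesics with nearby endpoints diverge. Hence they are linked by boundedly many cells, far away
  from their endpoints only boundedly many points of each level lie on them, and averaging over such
  slices gives almost invariant vectors supported in relative balls.

  Cutting around a cone point, distinct peripheral cosets through points of a relative ball are far
  apart outside a neighbourhood of the ball. Hence a relative ball of radius \<open>n + 1\<close> is glued from a
  neighbourhood of the ball of radius \<open>n\<close> and pieces of peripheral cosets.
\<close>

section \<open>Positive semidefinite kernels\<close>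

text \<open>An embedding only controls distances, whereas normalised kernels can be multiplied,
  pulled back and added with weights; hence the criterion is proved in both directions and all
  gluing is done with kernels. A glued kernel decays only if its pieces decay at a common rate, so
  every family of pieces is reduced by translations and nearest points to finitely many models: the
  subgroups and a relative ball.

  The coned-off graph is not locally finite, so a bound on distances does not bound a number of
  points. What is bounded is the number of edges within a given number of cell steps of an edge.
  This is why geodesics are compared through chains of cells, and why the length \<open>k0\<close>
  of these chains must not depend on the distance of the endpoints: slices then grow linearly with
  their width, and subexponential growth is what the averaging needs.

  The isoperimetric inequality enters only through integral \<open>1\<close>-chains. There a
  conjugate of a relator has the chain of a translated relator, so the bookkeeping in the free
  product becomes abelian.\<close>

definition psd_on :: "'a set \<Rightarrow> ('a \<Rightarrow> 'a \<Rightarrow> real) \<Rightarrow> bool" where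
  "psd_on M k \<longleftrightarrow> (\<forall>x\<in>M. \<forall>y\<in>M. k x y = k y x) \<and>
     (\<forall>A c. finite A \<longrightarrow> A \<subseteq> M \<longrightarrow> 0 \<le> (\<Sum>x\<in>A. \<Sum>y\<in>A. c x * c y * k x y))"

lemma psd_onI:
  assumes "\<And>x y. x \<in> M \<Longrightarrow> y \<in> M \<Longrightarrow> k x y = k y x"
    and "\<And>A c. finite A \<Longrightarrow> A \<subseteq> M \<Longrightarrow> 0 \<le> (\<Sum>x\<in>A. \<Sum>y\<in>A. c x * c y * k x y)"
  shows "psd_on M k"
  using assms by (auto simp: psd_on_def)

lemma psd_on_sym: "psd_on M k \<Longrightarrow> x \<in> M \<Longrightarrow> y \<in> M \<Longrightarrow> k x y = k y x"
  by (simp add: psd_on_def)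

lemma psd_on_form: "psd_on M k \<Longrightarrow> finite A \<Longrightarrow> A \<subseteq> M \<Longrightarrow> 0 \<le> (\<Sum>x\<in>A. \<Sum>y\<in>A. c x * c y * k x y)"
  unfolding psd_on_def by blast

lemma psd_on_cong:
  assumes "psd_on M k" "\<And>x y. x \<in> M \<Longrightarrow> y \<in> M \<Longrightarrow> k x y = k' x y"
  shows "psd_on M k'"
proof (rule psd_onI)
  fix x y assume "x \<in> M" "y \<in> M"
  then show "k' x y = k' y x" using assms psd_on_sym by metis
next
  fix A and c :: "'a \<Rightarrow> real" assume A: "finite A" "A \<subseteq> M"
  have "(\<Sum>x\<in>A. \<Sum>y\<in>A. c x * c y * k' x y) = (\<Sum>x\<in>A. \<Sum>y\<in>A. c x * c y * k x y)"
    using A assms(2) by (intro sum.cong HOL.refl) (auto simp: subset_iff)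
  then show "0 \<le> (\<Sum>x\<in>A. \<Sum>y\<in>A. c x * c y * k' x y)"
    using psd_on_form[OF assms(1) A] by simp
qed

lemma psd_on_pullback:
  assumes k: "psd_on M k" and f: "f \<in> N \<rightarrow> M"
  shows "psd_on N (\<lambda>x y. k (f x) (f y))"
proof (rule psd_onI)
  fix x y assume "x \<in> N" "y \<in> N"
  then show "k (f x) (f y) = k (f y) (f x)" using f by (intro psd_on_sym[OF k]) auto
next
  fix A and c :: "'b \<Rightarrow> real" assume A: "finite A" "A \<subseteq> N"
  \<comment> \<open>\<open>f\<close> need not be injective, so the coefficients are summed over its
    fibres.\<close>
  define C where "C u = (\<Sum>x\<in>{x\<in>A. f x = u}. c x)" for u
  have push: "(\<Sum>y\<in>A. c y * h (f y)) = (\<Sum>v\<in>f ` A. C v * h v)" for h :: "'a \<Rightarrow> real"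
  proof -
    have "(\<Sum>y\<in>A. c y * h (f y)) = (\<Sum>v\<in>f ` A. \<Sum>y\<in>{y\<in>A. f y = v}. c y * h (f y))"
      by (rule sum.image_gen[OF A(1)])
    also have "\<dots> = (\<Sum>v\<in>f ` A. C v * h v)"
      unfolding C_def sum_distrib_right by (intro sum.cong HOL.refl) auto
    finally show ?thesis .
  qed
  have "(\<Sum>x\<in>A. \<Sum>y\<in>A. c x * c y * k (f x) (f y)) = (\<Sum>x\<in>A. c x * (\<Sum>y\<in>A. c y * k (f x) (f y)))"
    by (simp add: sum_distrib_left mult.assoc)
  also have "\<dots> = (\<Sum>x\<in>A. c x * (\<Sum>v\<in>f ` A. C v * k (f x) v))"
    by (simp add: push)
  also have "\<dots> = (\<Sum>u\<in>f ` A. C u * (\<Sum>v\<in>f ` A. C v * k u v))"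
    by (rule push)
  also have "\<dots> = (\<Sum>u\<in>f ` A. \<Sum>v\<in>f ` A. C u * C v * k u v)"
    by (simp add: sum_distrib_left mult.assoc)
  finally show "0 \<le> (\<Sum>x\<in>A. \<Sum>y\<in>A. c x * c y * k (f x) (f y))"
    using psd_on_form[OF k, of "f ` A" C] A f by auto
qed

lemma psd_on_subset: "psd_on M k \<Longrightarrow> N \<subseteq> M \<Longrightarrow> psd_on N k"
  unfolding psd_on_def by blast

lemma psd_on_scale:
  assumes "psd_on M k" "0 \<le> a"
  shows "psd_on M (\<lambda>x y. a * k x y)"
proof (rule psd_onI)
  fix A and c :: "'a \<Rightarrow> real" assume A: "finite A" "A \<subseteq> M"
  have "(\<Sum>x\<in>A. \<Sum>y\<in>A. c x * c y * (a * k x y)) = a * (\<Sum>x\<in>A. \<Sum>y\<in>A. c x * c y * k x y)"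
    by (simp add: sum_distrib_left mult_ac)
  then show "0 \<le> (\<Sum>x\<in>A. \<Sum>y\<in>A. c x * c y * (a * k x y))"
    using psd_on_form[OF assms(1) A] assms(2) by simp
qed (simp add: psd_on_sym[OF assms(1)])

lemma psd_on_sum:
  fixes M :: "'a set"
  assumes "\<And>i. i \<in> I \<Longrightarrow> psd_on M (k i)"
  shows "psd_on M (\<lambda>x y. \<Sum>i\<in>I. k i x y)"
proof (rule psd_onI)
  fix x y assume "x \<in> M" "y \<in> M"
  then show "(\<Sum>i\<in>I. k i x y) = (\<Sum>i\<in>I. k i y x)"
    by (intro sum.cong) (simp_all add: psd_on_sym[OF assms])
next
  fix A and c :: "'a \<Rightarrow> real" assume A: "finite A" "A \<subseteq> M"
  have "(\<Sum>x\<in>A. \<Sum>y\<in>A. c x * c y * (\<Sum>i\<in>I. k i x y))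
      = (\<Sum>x\<in>A. \<Sum>y\<in>A. \<Sum>i\<in>I. c x * c y * k i x y)"
    by (simp add: sum_distrib_left)
  also have "\<dots> = (\<Sum>x\<in>A. \<Sum>i\<in>I. \<Sum>y\<in>A. c x * c y * k i x y)"
    by (rule sum.cong[OF HOL.refl sum.swap])
  also have "\<dots> = (\<Sum>i\<in>I. \<Sum>x\<in>A. \<Sum>y\<in>A. c x * c y * k i x y)"
    by (rule sum.swap)
  finally show "0 \<le> (\<Sum>x\<in>A. \<Sum>y\<in>A. c x * c y * (\<Sum>i\<in>I. k i x y))"
    using psd_on_form[OF assms A] by (simp add: sum_nonneg)
qed

lemma psd_on_limit:
  assumes "\<And>n. psd_on M (k n)" "\<And>x y. x \<in> M \<Longrightarrow> y \<in> M \<Longrightarrow> (\<lambda>n. k n x y) \<longlonglongrightarrow> l x y"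
  shows "psd_on M l"
proof (rule psd_onI)
  fix x y assume xy: "x \<in> M" "y \<in> M"
  have "(\<lambda>n. k n x y) = (\<lambda>n. k n y x)" using psd_on_sym[OF assms(1) xy] by auto
  then show "l x y = l y x"
    using assms(2)[OF xy] assms(2)[OF xy(2,1)] LIMSEQ_unique by metis
next
  fix A and c :: "'a \<Rightarrow> real" assume A: "finite A" "A \<subseteq> M"
  have "(\<lambda>n. \<Sum>x\<in>A. \<Sum>y\<in>A. c x * c y * k n x y) \<longlonglongrightarrow> (\<Sum>x\<in>A. \<Sum>y\<in>A. c x * c y * l x y)"
    using A assms(2) by (intro tendsto_sum tendsto_mult tendsto_const) auto
  then show "0 \<le> (\<Sum>x\<in>A. \<Sum>y\<in>A. c x * c y * l x y)"
    by (rule LIMSEQ_le_const) (use psd_on_form[OF assms(1) A] in auto)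
qed

lemma psd_on_rank_one: "psd_on M (\<lambda>x y. g x * g y)"
proof (rule psd_onI)
  fix A and c :: "'a \<Rightarrow> real"
  have "(\<Sum>x\<in>A. \<Sum>y\<in>A. c x * c y * (g x * g y)) = (\<Sum>x\<in>A. c x * g x) * (\<Sum>y\<in>A. c y * g y)"
    by (simp add: sum_product mult_ac)
  then show "0 \<le> (\<Sum>x\<in>A. \<Sum>y\<in>A. c x * c y * (g x * g y))" by simp
qed simp

text \<open>This is the form at \<open>c\<close> plus \<open>t\<close> times the point mass at
  \<open>p\<close>, where \<open>p\<close> may already lie in \<open>A\<close>. Suitable values of
  \<open>t\<close> give the null vectors, the Schur complement, the bound by \<open>1\<close> and
  the recentring of a kernel.\<close>

lemma psd_on_form_insert:
  assumes k: "psd_on M k" and A: "finite A" "A \<subseteq> M" and p: "p \<in> M"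
  shows "0 \<le> (\<Sum>x\<in>A. \<Sum>y\<in>A. c x * c y * k x y) + 2 * t * (\<Sum>x\<in>A. c x * k x p) + t\<^sup>2 * k p p"
proof -
  define a where "a x = (if x \<in> A then c x else 0)" for x
  define b where "b x = (if x = p then t else 0)" for x
  let ?A = "insert p A"
  have fin: "finite ?A" "?A \<subseteq> M" using A p by auto
  have sa: "(\<Sum>x\<in>?A. a x * h x) = (\<Sum>x\<in>A. c x * h x)" for h
    using A(1) by (intro sum.mono_neutral_cong_right) (auto simp: a_def)
  have sb: "(\<Sum>x\<in>?A. b x * h x) = t * h p" for h
  proof -
    have "(\<Sum>x\<in>?A. b x * h x) = (\<Sum>x\<in>?A. if x = p then t * h x else 0)"
      by (intro sum.cong) (auto simp: b_def)
    then show ?thesis using fin by simp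
  qed
  have "0 \<le> (\<Sum>x\<in>?A. \<Sum>y\<in>?A. (a x + b x) * (a y + b y) * k x y)"
    by (rule psd_on_form[OF k fin])
  also have "\<dots> = (\<Sum>x\<in>?A. a x * (\<Sum>y\<in>?A. a y * k x y)) + (\<Sum>x\<in>?A. a x * (\<Sum>y\<in>?A. b y * k x y))
      + (\<Sum>x\<in>?A. b x * (\<Sum>y\<in>?A. a y * k x y)) + (\<Sum>x\<in>?A. b x * (\<Sum>y\<in>?A. b y * k x y))"
    unfolding sum_distrib_left sum.distrib[symmetric]
    by (intro sum.cong) (simp_all add: algebra_simps)
  also have "\<dots> = (\<Sum>x\<in>A. c x * (\<Sum>y\<in>A. c y * k x y)) + (\<Sum>x\<in>A. c x * (t * k x p))
      + t * (\<Sum>y\<in>A. c y * k p y) + t * (t * k p p)"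
    by (simp only: sa sb)
  also have "(\<Sum>y\<in>A. c y * k p y) = (\<Sum>y\<in>A. c y * k y p)"
    using A p psd_on_sym[OF k] by (intro sum.cong HOL.refl) (auto simp: subset_iff)
  finally show ?thesis
    by (simp add: sum_distrib_left power2_eq_square mult_ac)
qed

section \<open>Schur complements and the Cholesky factorization\<close>

lemma psd_on_diag: "psd_on M k \<Longrightarrow> p \<in> M \<Longrightarrow> 0 \<le> k p p"
  using psd_on_form[of M k "{p}" "\<lambda>_. 1"] by simp

text \<open>When the coefficient of \<open>t\<^sup>2\<close> vanishes, a polynomial in
  \<open>t\<close> that stays nonnegative has no linear term either.\<close>

lemma psd_on_null:
  assumes "psd_on M k" "p \<in> M" "x \<in> M" "k p p = 0"
  shows "k x p = 0"
proof (rule ccontr)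
  assume "k x p \<noteq> 0"
  \<comment> \<open>With this \<open>t\<close> the form at \<open>x\<close> and \<open>p\<close>
    takes the value \<open>- 1\<close>.\<close>
  then have "2 * (- (k x x + 1) / (2 * k x p)) * k x p = - (k x x + 1)" by simp
  moreover have "0 \<le> k x x + 2 * (- (k x x + 1) / (2 * k x p)) * k x p"
    using psd_on_form_insert[OF assms(1), of "{x}" p "\<lambda>_. 1" "- (k x x + 1) / (2 * k x p)"] assms
    by simp
  ultimately show False by linarith
qed

text \<open>Minimising the form over the coefficient at \<open>p\<close> leaves this form on the
  others; the minimum is attained at \<open>t = - s / k p p\<close>. For \<open>k p p = 0\<close>
  the quotients are \<open>0\<close> and the form is unchanged.\<close>

lemma psd_on_Schur_complement:
  assumes k: "psd_on M k" and p: "p \<in> M"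
  shows "psd_on M (\<lambda>x y. k x y - k x p * k p y / k p p)"
proof (rule psd_onI)
  fix x y assume "x \<in> M" "y \<in> M"
  then show "k x y - k x p * k p y / k p p = k y x - k y p * k p x / k p p"
    using psd_on_sym[OF k] p by simp
next
  fix A and c :: "'a \<Rightarrow> real" assume A: "finite A" "A \<subseteq> M"
  define s where "s = (\<Sum>x\<in>A. c x * k x p)"
  have s': "(\<Sum>y\<in>A. c y * k p y) = s"
    unfolding s_def using A p psd_on_sym[OF k] by (intro sum.cong HOL.refl) (auto simp: subset_iff)
  have "(\<Sum>x\<in>A. \<Sum>y\<in>A. c x * c y * (k x y - k x p * k p y / k p p))
      = (\<Sum>x\<in>A. \<Sum>y\<in>A. c x * c y * k x y - (c x * k x p / k p p) * (c y * k p y))"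
    by (intro sum.cong) (simp_all add: algebra_simps)
  also have "\<dots> = (\<Sum>x\<in>A. \<Sum>y\<in>A. c x * c y * k x y) - (\<Sum>x\<in>A. c x * k x p / k p p) * (\<Sum>y\<in>A. c y * k p y)"
    by (simp add: sum_subtractf sum_product)
  also have "(\<Sum>x\<in>A. c x * k x p / k p p) = s / k p p"
    by (simp add: s_def sum_divide_distrib)
  finally have eq: "(\<Sum>x\<in>A. \<Sum>y\<in>A. c x * c y * (k x y - k x p * k p y / k p p))
      = (\<Sum>x\<in>A. \<Sum>y\<in>A. c x * c y * k x y) - s * s / k p p" by (simp add: s')
  have "2 * (- s / k p p) * s + (- s / k p p)\<^sup>2 * k p p = - (s * s / k p p)"
    by (cases "k p p = 0") (simp_all add: field_simps power2_eq_square)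
  then show "0 \<le> (\<Sum>x\<in>A. \<Sum>y\<in>A. c x * c y * (k x y - k x p * k p y / k p p))"
    using psd_on_form_insert[OF k A p, of c "- s / k p p"] unfolding eq s_def[symmetric] by linarith
qed

text \<open>A vanishing pivot is harmless: its row vanishes too, and the division yields \<open>0\<close>.\<close>

fun cholesky_residue :: "(nat \<Rightarrow> nat \<Rightarrow> real) \<Rightarrow> nat \<Rightarrow> nat \<Rightarrow> nat \<Rightarrow> real" where
  "cholesky_residue K 0 i j = K i j"
| "cholesky_residue K (Suc m) i j = cholesky_residue K m i j
     - cholesky_residue K m i m * cholesky_residue K m m j / cholesky_residue K m m m"

lemma psd_on_cholesky_residue:
  assumes "psd_on UNIV K"
  shows "psd_on UNIV (cholesky_residue K m)"
proof (induction m)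
  case 0
  have "cholesky_residue K 0 = K" by (intro ext) simp
  then show ?case using assms by simp
next
  case (Suc m)
  have "cholesky_residue K (Suc m) = (\<lambda>i j. cholesky_residue K m i j
     - cholesky_residue K m i m * cholesky_residue K m m j / cholesky_residue K m m m)"
    by (intro ext) simp
  then show ?case using psd_on_Schur_complement[OF Suc] by simp
qed

text \<open>Step \<open>j\<close> clears column \<open>j\<close>, where a zero pivot needs
  \<open>psd_on_null\<close>. Later steps subtract multiples of entries of that column, which are
  already \<open>0\<close>.\<close>

lemma cholesky_residue_eq_0:
  assumes K: "psd_on UNIV K" and "j < m"
  shows "cholesky_residue K m i j = 0"
  using assms(2)
proof (induction m arbitrary: i)
  case (Suc m)
  note R = psd_on_cholesky_residue[OF K, of m]
  show ?case
  proof (cases "j = m")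
    case True
    then show ?thesis using psd_on_null[OF R, of m i] by simp
  next
    case False
    then have "cholesky_residue K m i j = 0" for i using Suc by simp
    then show ?thesis by simp
  qed
qed simp

definition cholesky_factor :: "(nat \<Rightarrow> nat \<Rightarrow> real) \<Rightarrow> nat \<Rightarrow> nat \<Rightarrow> real" where
  "cholesky_factor K i m = cholesky_residue K m i m / sqrt (cholesky_residue K m m m)"

lemma cholesky_factor_eq_0: "psd_on UNIV K \<Longrightarrow> i < m \<Longrightarrow> cholesky_factor K i m = 0"
  using cholesky_residue_eq_0[of K i m m] psd_on_sym[OF psd_on_cholesky_residue, of K i m m]
  by (simp add: cholesky_factor_def)

lemma cholesky_factorization:
  assumes K: "psd_on UNIV K" and "j < n"
  shows "K i j = (\<Sum>m<n. cholesky_factor K i m * cholesky_factor K j m)"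
proof -
  have "K i j = cholesky_residue K n i j + (\<Sum>m<n. cholesky_factor K i m * cholesky_factor K j m)" for n
  proof (induction n)
    case (Suc n)
    note R = psd_on_cholesky_residue[OF K, of n]
    have "cholesky_factor K i n * cholesky_factor K j n
        = cholesky_residue K n i n * cholesky_residue K n n j / cholesky_residue K n n n"
      using psd_on_diag[OF R, of n] psd_on_sym[OF R, of j n] by (simp add: cholesky_factor_def)
    then show ?case using Suc by simp
  qed simp
  from this[of n] show ?thesis using cholesky_residue_eq_0[OF K assms(2), of i] by linarith
qed

text \<open>An enumeration of \<open>M\<close> makes the kernel a matrix with a lower triangular
  Cholesky factor. So every vector has finite support and all inner products are finite sums, which
  avoids completing a pre-Hilbert space.\<close>

lemma psd_on_factorization:
  assumes M: "countable M" and k: "psd_on M k"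
  obtains v :: "'a \<Rightarrow> nat \<Rightarrow> real" and N :: "'a \<Rightarrow> nat"
  where "\<And>x m. x \<in> M \<Longrightarrow> N x \<le> m \<Longrightarrow> v x m = 0"
    and "\<And>x y n. x \<in> M \<Longrightarrow> y \<in> M \<Longrightarrow> N y \<le> n \<Longrightarrow> k x y = (\<Sum>m<n. v x m * v y m)"
proof (cases "M = {}")
  case True
  then show ?thesis using that by blast
next
  case False
  define e where "e = from_nat_into M"
  define idx where "idx = to_nat_on M"
  have e: "e \<in> UNIV \<rightarrow> M" using from_nat_into[OF False] by (auto simp: e_def)
  have inv: "e (idx x) = x" if "x \<in> M" for x using M that by (simp add: e_def idx_def)
  \<comment> \<open>For finite \<open>M\<close> the enumeration repeats points, which a pullback
    tolerates.\<close>
  define K where "K i j = k (e i) (e j)" for i j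
  have K: "psd_on UNIV K" unfolding K_def by (rule psd_on_pullback[OF k e])
  show ?thesis
  proof (rule that[where v = "\<lambda>x. cholesky_factor K (idx x)" and N = "\<lambda>x. Suc (idx x)"])
    fix x m assume "Suc (idx x) \<le> m"
    then show "cholesky_factor K (idx x) m = 0" using cholesky_factor_eq_0[OF K] by simp
  next
    fix x y n assume "x \<in> M" "y \<in> M" "Suc (idx y) \<le> n"
    then show "k x y = (\<Sum>m<n. cholesky_factor K (idx x) m * cholesky_factor K (idx y) m)"
      using cholesky_factorization[OF K, of "idx y" n "idx x"] by (simp add: K_def inv)
  qed
qed

text \<open>The Schur product theorem. On finitely many points \<open>k\<close> is a sum of kernels
  \<open>v x m * v y m\<close>, and multiplying \<open>l\<close> by one of these only rescales the
  coefficients in the form of \<open>l\<close>.\<close>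

lemma psd_on_mult:
  assumes k: "psd_on M k" and l: "psd_on M l"
  shows "psd_on M (\<lambda>x y. k x y * l x y)"
proof (rule psd_onI)
  fix x y assume "x \<in> M" "y \<in> M"
  then show "k x y * l x y = k y x * l y x"
    using psd_on_sym[OF k] psd_on_sym[OF l] by simp
next
  fix A and c :: "'a \<Rightarrow> real" assume A: "finite A" "A \<subseteq> M"
  obtain v :: "'a \<Rightarrow> nat \<Rightarrow> real" and N where
    v: "\<And>x y n. x \<in> A \<Longrightarrow> y \<in> A \<Longrightarrow> N y \<le> n \<Longrightarrow> k x y = (\<Sum>m<n. v x m * v y m)"
    using psd_on_factorization[OF countable_finite[OF A(1)] psd_on_subset[OF k A(2)]] by metis
  define n where "n = Max (insert 0 (N ` A))"
  have n: "N y \<le> n" if "y \<in> A" for y using A that by (auto simp: n_def intro: Max_ge)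
  have "psd_on A (\<lambda>x y. \<Sum>m<n. (v x m * v y m) * l x y)"
  proof (rule psd_on_sum)
    fix m
    show "psd_on A (\<lambda>x y. (v x m * v y m) * l x y)"
    proof (rule psd_onI)
      fix x y assume "x \<in> A" "y \<in> A"
      then show "(v x m * v y m) * l x y = (v y m * v x m) * l y x"
        using psd_on_sym[OF l] A by auto
    next
      fix B and c :: "'a \<Rightarrow> real" assume B: "finite B" "B \<subseteq> A"
      have "0 \<le> (\<Sum>x\<in>B. \<Sum>y\<in>B. (c x * v x m) * (c y * v y m) * l x y)"
        using B A by (intro psd_on_form[OF l]) auto
      also have "\<dots> = (\<Sum>x\<in>B. \<Sum>y\<in>B. c x * c y * ((v x m * v y m) * l x y))"
        by (simp add: mult_ac)
      finally show "0 \<le> (\<Sum>x\<in>B. \<Sum>y\<in>B. c x * c y * ((v x m * v y m) * l x y))" .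
    qed
  qed
  then have "psd_on A (\<lambda>x y. k x y * l x y)"
    by (rule psd_on_cong) (auto simp: v[OF _ _ n] sum_distrib_right)
  then show "0 \<le> (\<Sum>x\<in>A. \<Sum>y\<in>A. c x * c y * (k x y * l x y))"
    by (rule psd_on_form) (use A in auto)
qed

lemma psd_on_one: "psd_on M (\<lambda>x y. 1)"
  using psd_on_rank_one[of M "\<lambda>_. 1"] by simp

lemma psd_on_power: "psd_on M k \<Longrightarrow> psd_on M (\<lambda>x y. k x y ^ n)"
  by (induction n) (simp_all add: psd_on_one psd_on_mult)

text \<open>The exponential series has nonnegative coefficients, and powers are Schur
  products.\<close>

lemma psd_on_exp:
  assumes "psd_on M k"
  shows "psd_on M (\<lambda>x y. exp (k x y))"
proof (rule psd_on_limit)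
  fix n
  show "psd_on M (\<lambda>x y. \<Sum>i<n. inverse (fact i) * k x y ^ i)"
    using assms by (intro psd_on_sum psd_on_scale psd_on_power) auto
next
  fix x y
  show "(\<lambda>n. \<Sum>i<n. inverse (fact i) * k x y ^ i) \<longlonglongrightarrow> exp (k x y)"
    using exp_converges[of "k x y"] by (simp add: sums_def)
qed

section \<open>The sequence space\<close>

definition l2_space :: "(real, nat \<Rightarrow> real) module" where
  "l2_space = \<lparr>carrier = {f. summable (\<lambda>n. (f n)\<^sup>2)}, monoid.mult = (\<lambda>f g. f), one = (\<lambda>n. 0),
     ring.zero = (\<lambda>n. 0), add = (\<lambda>f g n. f n + g n), smult = (\<lambda>c f n. c * f n)\<rparr>"

definition l2_ip :: "(nat \<Rightarrow> real) \<Rightarrow> (nat \<Rightarrow> real) \<Rightarrow> real" where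
  "l2_ip f g = (\<Sum>n. f n * g n)"

lemma l2_simps:
  "carrier l2_space = {f. summable (\<lambda>n. (f n)\<^sup>2)}" "\<zero>\<^bsub>l2_space\<^esub> = (\<lambda>n. 0)"
  "add l2_space = (\<lambda>f g n. f n + g n)" "smult l2_space = (\<lambda>c f n. c * f n)"
  by (simp_all add: l2_space_def)

lemma l2_summable_mult:
  fixes f g :: "nat \<Rightarrow> real"
  assumes "summable (\<lambda>n. (f n)\<^sup>2)" "summable (\<lambda>n. (g n)\<^sup>2)"
  shows "summable (\<lambda>n. f n * g n)"
proof (rule summable_comparison_test')
  show "summable (\<lambda>n. (f n)\<^sup>2 + (g n)\<^sup>2)" by (intro summable_add assms)
  show "norm (f n * g n) \<le> (f n)\<^sup>2 + (g n)\<^sup>2" for n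
  proof -
    have "0 \<le> \<bar>f n\<bar> * \<bar>g n\<bar>" by simp
    then show ?thesis using sum_squares_bound[of "\<bar>f n\<bar>" "\<bar>g n\<bar>"]
      by (auto simp only: abs_mult real_norm_def power2_abs)
  qed
qed

lemma l2_summable_add:
  fixes f g :: "nat \<Rightarrow> real"
  assumes "summable (\<lambda>n. (f n)\<^sup>2)" "summable (\<lambda>n. (g n)\<^sup>2)"
  shows "summable (\<lambda>n. (f n + g n)\<^sup>2)"
  using summable_add[OF summable_add[OF assms] summable_mult[OF l2_summable_mult[OF assms], of 2]]
  by (simp add: power2_sum mult.assoc)

lemma l2_summable_scale:
  fixes f :: "nat \<Rightarrow> real"
  shows "summable (\<lambda>n. (f n)\<^sup>2) \<Longrightarrow> summable (\<lambda>n. (c * f n)\<^sup>2)"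
  by (simp add: power_mult_distrib summable_mult)

lemma l2_summable_diff:
  fixes f g :: "nat \<Rightarrow> real"
  assumes "summable (\<lambda>n. (f n)\<^sup>2)" "summable (\<lambda>n. (g n)\<^sup>2)"
  shows "summable (\<lambda>n. (f n - g n)\<^sup>2)"
  using l2_summable_add[OF assms(1) l2_summable_scale[OF assms(2), of "-1"]] by simp

lemma abelian_group_l2: "abelian_group l2_space"
proof (rule abelian_groupI)
  fix f assume "f \<in> carrier l2_space"
  then show "\<exists>g\<in>carrier l2_space. g \<oplus>\<^bsub>l2_space\<^esub> f = \<zero>\<^bsub>l2_space\<^esub>"
    using l2_summable_scale[of f "-1"] by (intro bexI[of _ "\<lambda>n. - f n"]) (auto simp: l2_simps)
qed (auto simp: l2_simps l2_summable_add)

lemma module_l2: "Module.module real_ring l2_space"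
  by (rule moduleI[OF cring_real_ring abelian_group_l2])
    (auto simp: l2_simps l2_summable_scale algebra_simps)

lemma l2_minus:
  assumes "f \<in> carrier l2_space" "g \<in> carrier l2_space"
  shows "f \<ominus>\<^bsub>l2_space\<^esub> g = (\<lambda>n. f n - g n)"
proof -
  interpret Module.module real_ring l2_space by (rule module_l2)
  have "(\<lambda>n. f n - g n) \<in> carrier l2_space" using assms l2_summable_diff by (auto simp: l2_simps)
  moreover have "f = (\<lambda>n. f n - g n) \<oplus>\<^bsub>l2_space\<^esub> g" by (simp add: l2_simps)
  ultimately have "(\<lambda>n. f n - g n) = f \<oplus>\<^bsub>l2_space\<^esub> \<ominus>\<^bsub>l2_space\<^esub> g"
    using assms by (subst M.add.inv_solve_right) auto
  then show ?thesis by (simp only: a_minus_def)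
qed

lemma real_hilbert_space_l2: "real_hilbert_space l2_space l2_ip"
proof -
  interpret Module.module real_ring l2_space by (rule module_l2)
  show ?thesis
  proof
    fix u v assume "u \<in> carrier l2_space" "v \<in> carrier l2_space"
    then show "l2_ip u v = l2_ip v u" by (simp add: l2_ip_def mult.commute)
    show "l2_ip (c \<odot>\<^bsub>l2_space\<^esub> u) v = c * l2_ip u v" for c
      using suminf_mult[OF l2_summable_mult, of u v c] \<open>u \<in> _\<close> \<open>v \<in> _\<close>
      by (simp add: l2_ip_def l2_simps mult.assoc)
  next
    fix u v w assume "u \<in> carrier l2_space" "v \<in> carrier l2_space" "w \<in> carrier l2_space"
    then show "l2_ip (u \<oplus>\<^bsub>l2_space\<^esub> v) w = l2_ip u w + l2_ip v w"
      using suminf_add[OF l2_summable_mult[of u w] l2_summable_mult[of v w]]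
      by (simp add: l2_ip_def l2_simps distrib_right)
  next
    fix u assume u: "u \<in> carrier l2_space" "u \<noteq> \<zero>\<^bsub>l2_space\<^esub>"
    then obtain m where "u m \<noteq> 0" by (auto simp: l2_simps)
    then have "0 < (\<Sum>n\<in>{m}. u n * u n)" by (auto simp: zero_less_mult_iff)
    also have "\<dots> \<le> l2_ip u u"
      unfolding l2_ip_def using u by (intro sum_le_suminf l2_summable_mult) (auto simp: l2_simps)
    finally show "0 < l2_ip u u" .
  next
    fix a :: "nat \<Rightarrow> nat \<Rightarrow> real"
    assume a: "\<And>n. a n \<in> carrier l2_space"
      and C: "\<And>e. 0 < e \<Longrightarrow> \<exists>N. \<forall>m\<ge>N. \<forall>n\<ge>N. ip_norm l2_ip (a m \<ominus>\<^bsub>l2_space\<^esub> a n) < e"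
    have nrm: "(ip_norm l2_ip (a m \<ominus>\<^bsub>l2_space\<^esub> a n))\<^sup>2 = (\<Sum>k. (a m k - a n k)\<^sup>2)" for m n
      using a[of m] a[of n] l2_summable_diff[of "a m" "a n"]
      by (simp add: ip_norm_def l2_minus l2_ip_def l2_simps power2_eq_square suminf_nonneg)
    have s: "summable (\<lambda>k. (a m k - a n k)\<^sup>2)" for m n
      using a[of m] a[of n] by (simp add: l2_simps l2_summable_diff)
    have nrm0: "0 \<le> ip_norm l2_ip (a m \<ominus>\<^bsub>l2_space\<^esub> a n)" for m n
    proof -
      have "(\<lambda>k. (a m k - a n k) * (a m k - a n k)) = (\<lambda>k. (a m k - a n k)\<^sup>2)"
        by (simp add: power2_eq_square)
      then show ?thesis
        using suminf_nonneg[OF s[of m n]] by (simp add: ip_norm_def l2_ip_def l2_minus a)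
    qed
    \<comment> \<open>Bounds are kept for finite partial sums, since these pass to the
      coordinatewise limit; the full sums are recovered from them at the end.\<close>
    have part: "\<exists>N. \<forall>m\<ge>N. \<forall>n\<ge>N. \<forall>K. finite K \<longrightarrow> (\<Sum>k\<in>K. (a m k - a n k)\<^sup>2) \<le> e\<^sup>2" if e: "0 < e" for e
    proof -
      obtain N where N: "\<And>m n. m \<ge> N \<Longrightarrow> n \<ge> N \<Longrightarrow> ip_norm l2_ip (a m \<ominus>\<^bsub>l2_space\<^esub> a n) < e"
        using C[OF e] by blast
      have "(\<Sum>k\<in>K. (a m k - a n k)\<^sup>2) \<le> e\<^sup>2" if "m \<ge> N" "n \<ge> N" "finite K" for m n K
      proof -
        have "(\<Sum>k\<in>K. (a m k - a n k)\<^sup>2) \<le> (\<Sum>k. (a m k - a n k)\<^sup>2)"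
          using that s by (intro sum_le_suminf) auto
        also have "\<dots> = (ip_norm l2_ip (a m \<ominus>\<^bsub>l2_space\<^esub> a n))\<^sup>2" by (simp add: nrm)
        also have "\<dots> \<le> e\<^sup>2"
          using N[OF that(1,2)] nrm0[of m n] by (intro power_mono) auto
        finally show ?thesis .
      qed
      then show ?thesis by blast
    qed
    have "Cauchy (\<lambda>n. a n k)" for k
    proof (rule metric_CauchyI)
      fix e :: real assume e: "0 < e"
      obtain N where N: "\<And>m n K. m \<ge> N \<Longrightarrow> n \<ge> N \<Longrightarrow> finite K \<Longrightarrow> (\<Sum>k\<in>K. (a m k - a n k)\<^sup>2) \<le> (e/2)\<^sup>2"
        using part[OF half_gt_zero[OF e]] by blast
      have "\<bar>a m k - a n k\<bar> < e" if "m \<ge> N" "n \<ge> N" for m n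
      proof -
        have "(a m k - a n k)\<^sup>2 \<le> (e/2)\<^sup>2" using N[OF that, of "{k}"] by simp
        then have "\<bar>a m k - a n k\<bar> \<le> \<bar>e/2\<bar>" by (simp only: abs_le_square_iff)
        then show ?thesis using e by simp
      qed
      then show "\<exists>N. \<forall>m\<ge>N. \<forall>n\<ge>N. dist (a m k) (a n k) < e" by (auto simp: dist_real_def)
    qed
    then have "\<exists>l. (\<lambda>n. a n k) \<longlonglongrightarrow> l" for k using Cauchy_convergent_iff convergent_def by blast
    then obtain v where v: "\<And>k. (\<lambda>n. a n k) \<longlonglongrightarrow> v k" by metis
    have lim: "\<exists>N. \<forall>m\<ge>N. \<forall>K. finite K \<longrightarrow> (\<Sum>k\<in>K. (a m k - v k)\<^sup>2) \<le> e\<^sup>2" if e: "0 < e" for e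
    proof -
      obtain N where N: "\<And>m n K. m \<ge> N \<Longrightarrow> n \<ge> N \<Longrightarrow> finite K \<Longrightarrow> (\<Sum>k\<in>K. (a m k - a n k)\<^sup>2) \<le> e\<^sup>2"
        using part[OF e] by blast
      have "(\<Sum>k\<in>K. (a m k - v k)\<^sup>2) \<le> e\<^sup>2" if "m \<ge> N" "finite K" for m K
      proof (rule LIMSEQ_le_const2)
        show "(\<lambda>n. \<Sum>k\<in>K. (a m k - a n k)\<^sup>2) \<longlonglongrightarrow> (\<Sum>k\<in>K. (a m k - v k)\<^sup>2)"
          by (intro tendsto_sum tendsto_power tendsto_diff tendsto_const v)
        show "\<exists>N. \<forall>n\<ge>N. (\<Sum>k\<in>K. (a m k - a n k)\<^sup>2) \<le> e\<^sup>2" using N that by blast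
      qed
      then show ?thesis by blast
    qed
    have sv: "summable (\<lambda>k. (a m k - v k)\<^sup>2)" if "\<And>K. finite K \<Longrightarrow> (\<Sum>k\<in>K. (a m k - v k)\<^sup>2) \<le> e" for m e
      by (rule summableI_nonneg_bounded[where x = e]) (use that in auto)
    have vc: "v \<in> carrier l2_space"
    proof -
      obtain m where m: "\<And>K. finite K \<Longrightarrow> (\<Sum>k\<in>K. (a m k - v k)\<^sup>2) \<le> 1\<^sup>2"
        using lim[OF zero_less_one] by blast
      have "summable (\<lambda>k. (a m k - (a m k - v k))\<^sup>2)"
        by (rule l2_summable_diff) (use a[of m] sv[OF m] in \<open>auto simp: l2_simps\<close>)
      then show ?thesis by (simp add: l2_simps)
    qed
    have "(\<lambda>n. ip_norm l2_ip (a n \<ominus>\<^bsub>l2_space\<^esub> v)) \<longlonglongrightarrow> 0"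
    proof (rule LIMSEQ_I)
      fix e :: real assume e: "0 < e"
      obtain N where N: "\<And>m K. m \<ge> N \<Longrightarrow> finite K \<Longrightarrow> (\<Sum>k\<in>K. (a m k - v k)\<^sup>2) \<le> (e/2)\<^sup>2"
        using lim[OF half_gt_zero[OF e]] by blast
      have "norm (ip_norm l2_ip (a m \<ominus>\<^bsub>l2_space\<^esub> v) - 0) < e" if m: "m \<ge> N" for m
      proof -
        have "l2_ip (a m \<ominus>\<^bsub>l2_space\<^esub> v) (a m \<ominus>\<^bsub>l2_space\<^esub> v) = (\<Sum>k. (a m k - v k)\<^sup>2)"
          by (simp add: l2_minus a vc l2_ip_def power2_eq_square)
        also have "\<dots> \<le> (e/2)\<^sup>2"
          by (rule suminf_le_const[OF sv[OF N[OF m]]]) (use N[OF m] in auto)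
        finally have "ip_norm l2_ip (a m \<ominus>\<^bsub>l2_space\<^esub> v) \<le> e/2"
          unfolding ip_norm_def using e by (intro real_le_lsqrt) auto
        moreover have "0 \<le> ip_norm l2_ip (a m \<ominus>\<^bsub>l2_space\<^esub> v)"
          using suminf_nonneg[OF sv[OF N[OF m]]]
          by (simp add: ip_norm_def l2_minus a vc l2_ip_def power2_eq_square)
        ultimately show ?thesis using e by simp
      qed
      then show "\<exists>no. \<forall>n\<ge>no. norm (ip_norm l2_ip (a n \<ominus>\<^bsub>l2_space\<^esub> v) - 0) < e" by blast
    qed
    then show "\<exists>v\<in>carrier l2_space. (\<lambda>n. ip_norm l2_ip (a n \<ominus>\<^bsub>l2_space\<^esub> v)) \<longlonglongrightarrow> 0"
      using vc by blast
  qed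
qed

lemma uniformly_embeddable_psdI:
  assumes M: "countable M" and G: "psd_on M G"
    and \<rho>: "mono_on {0..} \<rho>m" "mono_on {0..} \<rho>p" "\<rho>m \<in> {0..} \<rightarrow> {0..}" "\<rho>p \<in> {0..} \<rightarrow> {0..}"
      "filterlim \<rho>m at_top at_top" "filterlim \<rho>p at_top at_top"
    and lo: "\<And>x y. x \<in> M \<Longrightarrow> y \<in> M \<Longrightarrow> \<rho>m (d x y) \<le> sqrt (G x x + G y y - 2 * G x y)"
    and hi: "\<And>x y. x \<in> M \<Longrightarrow> y \<in> M \<Longrightarrow> sqrt (G x x + G y y - 2 * G x y) \<le> \<rho>p (d x y)"
  shows "uniformly_embeddable M d"
proof -
  obtain v :: "'a \<Rightarrow> nat \<Rightarrow> real" and N where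
    v0: "\<And>x m. x \<in> M \<Longrightarrow> N x \<le> m \<Longrightarrow> v x m = 0"
    and vG: "\<And>x y n. x \<in> M \<Longrightarrow> y \<in> M \<Longrightarrow> N y \<le> n \<Longrightarrow> G x y = (\<Sum>m<n. v x m * v y m)"
    by (rule psd_on_factorization[OF M G]) blast
  have vc: "v x \<in> carrier l2_space" if "x \<in> M" for x
  proof -
    have "summable (\<lambda>m. (v x m)\<^sup>2)"
      by (rule summable_finite[of "{..<N x}"]) (use v0[OF that] in auto)
    then show ?thesis by (simp add: l2_simps)
  qed
  have nrm: "ip_norm l2_ip (v x \<ominus>\<^bsub>l2_space\<^esub> v y) = sqrt (G x x + G y y - 2 * G x y)"
    if xy: "x \<in> M" "y \<in> M" for x y
  proof -
    define n where "n = max (N x) (N y)"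
    have "(\<Sum>m. (v x m - v y m) * (v x m - v y m)) = (\<Sum>m<n. (v x m - v y m) * (v x m - v y m))"
      using v0[OF xy(1)] v0[OF xy(2)] by (intro suminf_finite) (auto simp: n_def)
    also have "\<dots> = (\<Sum>m<n. v x m * v x m) + (\<Sum>m<n. v y m * v y m) - 2 * (\<Sum>m<n. v x m * v y m)"
      by (simp add: sum.distrib sum_subtractf sum_distrib_left algebra_simps)
    also have "\<dots> = G x x + G y y - 2 * G x y"
      using vG[of x x n] vG[of y y n] vG[of x y n] xy by (simp add: n_def)
    finally show ?thesis using xy by (simp add: ip_norm_def l2_minus vc l2_ip_def)
  qed
  have "uniform_embedding M d l2_space l2_ip v"
    unfolding uniform_embedding_def
  proof (rule conjI, use vc in blast, rule exI[of _ \<rho>m], rule exI[of _ \<rho>p], intro conjI ballI \<rho>)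
    fix x y assume "x \<in> M" "y \<in> M"
    then show "\<rho>m (d x y) \<le> ip_norm l2_ip (v x \<ominus>\<^bsub>l2_space\<^esub> v y)"
      "ip_norm l2_ip (v x \<ominus>\<^bsub>l2_space\<^esub> v y) \<le> \<rho>p (d x y)"
      using lo hi nrm by simp_all
  qed
  then show ?thesis by (rule uniformly_embeddableI[OF real_hilbert_space_l2])
qed

section \<open>A kernel criterion for uniform embeddability\<close>

text \<open>Decay at infinity is left to \<open>equi_embeddable\<close>, where it has to be uniform
  over a family.\<close>

definition normalized_kernel :: "'a set \<Rightarrow> ('a \<Rightarrow> 'a \<Rightarrow> real) \<Rightarrow> real \<Rightarrow> real \<Rightarrow> ('a \<Rightarrow> 'a \<Rightarrow> real) \<Rightarrow> bool" where
  "normalized_kernel M d R \<epsilon> k \<longleftrightarrow> psd_on M k \<and> (\<forall>x\<in>M. k x x = 1) \<and> (\<forall>x\<in>M. \<forall>y\<in>M. 0 \<le> k x y) \<and>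
     (\<forall>x\<in>M. \<forall>y\<in>M. d x y \<le> R \<longrightarrow> 1 - \<epsilon> \<le> k x y)"

text \<open>\<open>T\<close> is chosen before the member \<open>e\<close>: the kernels of the family
  decay at a common rate.\<close>

definition equi_embeddable :: "'e set \<Rightarrow> ('e \<Rightarrow> 'a set) \<Rightarrow> ('a \<Rightarrow> 'a \<Rightarrow> real) \<Rightarrow> bool" where
  "equi_embeddable I U d \<longleftrightarrow> (\<forall>R \<epsilon>. 0 < \<epsilon> \<longrightarrow>
     (\<exists>k. (\<forall>e\<in>I. normalized_kernel (U e) d R \<epsilon> (k e)) \<and>
          (\<forall>\<delta>>0. \<exists>T. \<forall>e\<in>I. \<forall>x\<in>U e. \<forall>y\<in>U e. T \<le> d x y \<longrightarrow> k e x y \<le> \<delta>)))"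

abbreviation kernel_embeddable :: "'a set \<Rightarrow> ('a \<Rightarrow> 'a \<Rightarrow> real) \<Rightarrow> bool" where
  "kernel_embeddable M d \<equiv> equi_embeddable {()} (\<lambda>_. M) d"

lemma kernel_embeddable_iff:
  "kernel_embeddable M d \<longleftrightarrow> (\<forall>R \<epsilon>. 0 < \<epsilon> \<longrightarrow> (\<exists>k. normalized_kernel M d R \<epsilon> k \<and>
     (\<forall>\<delta>>0. \<exists>T. \<forall>x\<in>M. \<forall>y\<in>M. T \<le> d x y \<longrightarrow> k x y \<le> \<delta>)))"
proof -
  have "(\<exists>k. (\<forall>e\<in>{()}. normalized_kernel M d R \<epsilon> (k e)) \<and>
          (\<forall>\<delta>>0. \<exists>T. \<forall>e\<in>{()}. \<forall>x\<in>M. \<forall>y\<in>M. T \<le> d x y \<longrightarrow> k e x y \<le> \<delta>))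
     \<longleftrightarrow> (\<exists>k. normalized_kernel M d R \<epsilon> k \<and>
     (\<forall>\<delta>>0. \<exists>T. \<forall>x\<in>M. \<forall>y\<in>M. T \<le> d x y \<longrightarrow> k x y \<le> \<delta>))" (is "?L = ?R") for R \<epsilon>
  proof
    assume ?L
    then obtain k where "(\<forall>e\<in>{()}. normalized_kernel M d R \<epsilon> (k e)) \<and>
          (\<forall>\<delta>>0. \<exists>T. \<forall>e\<in>{()}. \<forall>x\<in>M. \<forall>y\<in>M. T \<le> d x y \<longrightarrow> k e x y \<le> \<delta>)" by (rule exE)
    then show ?R by (intro exI[of _ "k ()"]) simp
  next
    assume ?R
    then obtain k where "normalized_kernel M d R \<epsilon> k \<and>
     (\<forall>\<delta>>0. \<exists>T. \<forall>x\<in>M. \<forall>y\<in>M. T \<le> d x y \<longrightarrow> k x y \<le> \<delta>)" by (rule exE)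
    then show ?L by (intro exI[of _ "\<lambda>_. k"]) simp
  qed
  then show ?thesis unfolding equi_embeddable_def by simp
qed

section \<open>Kernels from an embedding\<close>

lemma (in real_hilbert_space) psd_on_ip:
  fixes M :: "'m set"
  assumes F: "F \<in> M \<rightarrow> carrier V"
  shows "psd_on M (\<lambda>x y. ip (F x) (F y))"
proof (rule psd_onI)
  fix x y assume "x \<in> M" "y \<in> M"
  then show "ip (F x) (F y) = ip (F y) (F x)" using F by (intro ip_commute) auto
next
  fix A and c :: "'m \<Rightarrow> real" assume A: "finite A" "A \<subseteq> M"
  \<comment> \<open>\<open>v\<close> is the linear combination of the \<open>F x\<close> with
    coefficients \<open>c\<close>. Only its inner products are recorded, as they determine
    \<open>ip v v\<close>.\<close>
  have "\<exists>v\<in>carrier V. \<forall>w\<in>carrier V. ip v w = (\<Sum>x\<in>A. c x * ip (F x) w)"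
    using A
  proof (induction A rule: finite_induct)
    case empty
    then show ?case by (intro bexI[of _ \<zero>]) (auto simp: ip_zero)
  next
    case (insert a A)
    then obtain v where v: "v \<in> carrier V" "\<forall>w\<in>carrier V. ip v w = (\<Sum>x\<in>A. c x * ip (F x) w)"
      by auto
    have a: "F a \<in> carrier V" using insert.prems F by auto
    show ?case
      using v a insert.hyps
      by (intro bexI[of _ "c a \<odot> F a \<oplus> v"]) (auto simp: ip_add ip_smult)
  qed
  then obtain v where v: "v \<in> carrier V" "\<And>w. w \<in> carrier V \<Longrightarrow> ip v w = (\<Sum>x\<in>A. c x * ip (F x) w)"
    by blast
  have "ip v v = (\<Sum>x\<in>A. c x * ip (F x) v)" using v by blast
  also have "\<dots> = (\<Sum>x\<in>A. c x * (\<Sum>y\<in>A. c y * ip (F x) (F y)))"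
  proof (rule sum.cong[OF HOL.refl])
    fix x assume "x \<in> A"
    then have "F x \<in> carrier V" using A F by auto
    then have "ip (F x) v = (\<Sum>y\<in>A. c y * ip (F y) (F x))" using v ip_commute by metis
    also have "\<dots> = (\<Sum>y\<in>A. c y * ip (F x) (F y))"
    proof (rule sum.cong[OF HOL.refl])
      fix y assume "y \<in> A"
      then have "F y \<in> carrier V" using A F by auto
      then show "c y * ip (F y) (F x) = c y * ip (F x) (F y)"
        using \<open>F x \<in> carrier V\<close> ip_commute by simp
    qed
    finally show "c x * ip (F x) v = c x * (\<Sum>y\<in>A. c y * ip (F x) (F y))" by simp
  qed
  also have "\<dots> = (\<Sum>x\<in>A. \<Sum>y\<in>A. c x * c y * ip (F x) (F y))"
    by (simp add: sum_distrib_left mult.assoc)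
  finally show "0 \<le> (\<Sum>x\<in>A. \<Sum>y\<in>A. c x * c y * ip (F x) (F y))"
    using ip_nonneg[OF v(1)] by simp
qed

text \<open>The kernel is a Gaussian of the distance in the Hilbert space. It splits into a rank one
  kernel and the exponential of a multiple of the inner product. A small \<open>t\<close> keeps it
  close to \<open>1\<close> up to distance \<open>R\<close>, and the lower control function makes it
  decay.\<close>

lemma kernel_embeddable_if_uniformly_embeddable:
  assumes d: "\<And>x y. x \<in> M \<Longrightarrow> y \<in> M \<Longrightarrow> 0 \<le> d x y" and E: "uniformly_embeddable M d"
  shows "kernel_embeddable M d"
  unfolding kernel_embeddable_iff
proof (intro allI impI)
  fix R \<epsilon> :: real assume \<epsilon>: "0 < \<epsilon>"
  obtain V :: "(real, 'a \<Rightarrow> real) module" and ip F where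
    H: "real_hilbert_space V ip" and UE: "uniform_embedding M d V ip F"
    using E unfolding uniformly_embeddable_def by blast
  interpret real_hilbert_space V ip by (rule H)
  obtain \<rho>m \<rho>p where F: "F \<in> M \<rightarrow> carrier V"
    and \<rho>: "mono_on {0..} \<rho>p" "\<rho>p \<in> {0..} \<rightarrow> {0..}" "filterlim \<rho>m at_top at_top"
    and lo: "\<And>x y. x \<in> M \<Longrightarrow> y \<in> M \<Longrightarrow> \<rho>m (d x y) \<le> ip_norm ip (F x \<ominus>\<^bsub>V\<^esub> F y)"
    and hi: "\<And>x y. x \<in> M \<Longrightarrow> y \<in> M \<Longrightarrow> ip_norm ip (F x \<ominus>\<^bsub>V\<^esub> F y) \<le> \<rho>p (d x y)"
    using UE unfolding uniform_embedding_def by blast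
  define nr where "nr x y = ip_norm ip (F x \<ominus>\<^bsub>V\<^esub> F y)" for x y
  have FV: "F x \<in> carrier V" if "x \<in> M" for x using F that by auto
  have nr0: "0 \<le> nr x y" if "x \<in> M" "y \<in> M" for x y
    using ip_nonneg[of "F x \<ominus>\<^bsub>V\<^esub> F y"] FV that by (simp add: nr_def ip_norm_def)
  have nr2: "(nr x y)\<^sup>2 = ip (F x) (F x) + ip (F y) (F y) - 2 * ip (F x) (F y)"
    if "x \<in> M" "y \<in> M" for x y
    using ip_nonneg[of "F x \<ominus>\<^bsub>V\<^esub> F y"] FV that ip_commute[of "F x" "F y"]
    by (simp add: nr_def ip_norm_def ip_diff)
  \<comment> \<open>\<open>R\<close> may be negative while the control functions are only known on
    \<open>{0..}\<close>. Adding \<open>1\<close> keeps the denominator of \<open>t\<close>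
    positive.\<close>
  define \<rho> where "\<rho> = \<rho>p (max R 0) + 1"
  have \<rho>1: "1 \<le> \<rho>" using \<rho>(2) by (auto simp: \<rho>_def Pi_iff)
  define t where "t = \<epsilon> / \<rho>\<^sup>2"
  have t: "0 < t" using \<epsilon> \<rho>1 by (simp add: t_def)
  define k where "k x y = exp (- t * (nr x y)\<^sup>2)" for x y
  have "psd_on M (\<lambda>x y. (exp (- t * ip (F x) (F x)) * exp (- t * ip (F y) (F y))) * exp (2 * t * ip (F x) (F y)))"
    using t by (intro psd_on_mult psd_on_exp psd_on_rank_one psd_on_scale psd_on_ip F) auto
  then have psd: "psd_on M k"
    by (rule psd_on_cong) (simp add: k_def nr2 exp_add[symmetric] algebra_simps)
  have diag: "k x x = 1" if "x \<in> M" for x using nr2[OF that that] by (simp add: k_def)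
  have near: "1 - \<epsilon> \<le> k x y" if xy: "x \<in> M" "y \<in> M" "d x y \<le> R" for x y
  proof -
    have "nr x y \<le> \<rho>p (d x y)" using hi xy by (simp add: nr_def)
    also have "\<dots> \<le> \<rho>p (max R 0)" using xy d by (intro mono_onD[OF \<rho>(1)]) auto
    finally have "nr x y \<le> \<rho>" by (simp add: \<rho>_def)
    then have "(nr x y)\<^sup>2 \<le> \<rho>\<^sup>2" using nr0 xy by (intro power_mono) auto
    then have "t * (nr x y)\<^sup>2 \<le> t * \<rho>\<^sup>2" using t by simp
    also have "\<dots> = \<epsilon>" using \<rho>1 by (simp add: t_def)
    finally show ?thesis using exp_ge_add_one_self[of "- t * (nr x y)\<^sup>2"] by (simp add: k_def)
  qed
  have far: "\<exists>T. \<forall>x\<in>M. \<forall>y\<in>M. T \<le> d x y \<longrightarrow> k x y \<le> \<delta>" if \<delta>: "0 < \<delta>" for \<delta>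
  proof -
    \<comment> \<open>The \<open>1\<close> in the maximum ensures that the norm is at most its
      square.\<close>
    define c where "c = max 1 (- ln \<delta> / t)"
    obtain T where T: "\<And>s. T \<le> s \<Longrightarrow> c \<le> \<rho>m s"
      using \<rho>(3) unfolding filterlim_at_top eventually_at_top_linorder by blast
    have "k x y \<le> \<delta>" if xy: "x \<in> M" "y \<in> M" "T \<le> d x y" for x y
    proof -
      have c: "c \<le> nr x y" using T[OF xy(3)] lo[OF xy(1,2)] by (simp add: nr_def)
      have "- ln \<delta> \<le> t * c" using t by (simp add: c_def max_def field_simps)
      also have "\<dots> \<le> t * (nr x y)\<^sup>2"
      proof -
        have "1 \<le> nr x y" using c by (simp add: c_def)
        then have "nr x y * 1 \<le> nr x y * nr x y" by (intro mult_left_mono) auto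
        then show ?thesis using c t by (simp add: power2_eq_square)
      qed
      finally have "- t * (nr x y)\<^sup>2 \<le> ln \<delta>" by simp
      then have "exp (- t * (nr x y)\<^sup>2) \<le> exp (ln \<delta>)" by (simp only: exp_le_cancel_iff)
      then show ?thesis using \<delta> by (simp add: k_def)
    qed
    then show ?thesis by blast
  qed
  show "\<exists>k. normalized_kernel M d R \<epsilon> k \<and>
          (\<forall>\<delta>>0. \<exists>T. \<forall>x\<in>M. \<forall>y\<in>M. T \<le> d x y \<longrightarrow> k x y \<le> \<delta>)"
    using psd diag near far unfolding normalized_kernel_def
    by (intro exI[of _ k] conjI) (auto simp: k_def)
qed

section \<open>An embedding from kernels\<close>

lemma psd_on_le_1:
  assumes "psd_on M k" "x \<in> M" "y \<in> M" "k x x = 1" "k y y = 1"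
  shows "k x y \<le> 1"
  using psd_on_form_insert[OF assms(1), of "{x}" y "\<lambda>_. 1" "-1"] assms by simp

text \<open>For the Gram kernel of unit vectors this is the Gram kernel of their differences from
  the vector of \<open>b\<close>. Subtracting that vector is what lets infinitely many kernels be
  summed.\<close>

lemma psd_on_recentre:
  assumes k: "psd_on M k" and b: "b \<in> M" "k b b = 1"
  shows "psd_on M (\<lambda>x y. 1 - k x b - k y b + k x y)"
proof (rule psd_onI)
  fix A and c :: "'a \<Rightarrow> real" assume A: "finite A" "A \<subseteq> M"
  define s where "s = (\<Sum>x\<in>A. c x)"
  have "(\<Sum>x\<in>A. \<Sum>y\<in>A. c x * c y * (1 - k x b - k y b + k x y))
      = (\<Sum>x\<in>A. \<Sum>y\<in>A. c x * c y) - (\<Sum>x\<in>A. \<Sum>y\<in>A. (c x * k x b) * c y)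
        - (\<Sum>x\<in>A. \<Sum>y\<in>A. c x * (c y * k y b)) + (\<Sum>x\<in>A. \<Sum>y\<in>A. c x * c y * k x y)"
    by (simp add: sum.distrib sum_subtractf algebra_simps)
  also have "\<dots> = s * s - (\<Sum>x\<in>A. c x * k x b) * s - s * (\<Sum>x\<in>A. c x * k x b)
      + (\<Sum>x\<in>A. \<Sum>y\<in>A. c x * c y * k x y)"
    unfolding s_def sum_product ..
  finally show "0 \<le> (\<Sum>x\<in>A. \<Sum>y\<in>A. c x * c y * (1 - k x b - k y b + k x y))"
    using psd_on_form_insert[OF k A b(1), of c "- s"] b(2)
    by (simp add: power2_eq_square algebra_simps)
qed (simp add: psd_on_sym[OF k])

text \<open>The embedding is the direct sum of the recentred vectors of kernels with
  \<open>R = n\<close> and \<open>\<epsilon> = (1/2) ^ n\<close>, so squared distances are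
  \<open>2 * N x y\<close>. The summands of \<open>N x y\<close> with \<open>n \<ge> d x y\<close>
  are at most \<open>(1/2) ^ n\<close>. Those whose kernel has dropped to \<open>1/2\<close> at this
  distance are at least \<open>1/2\<close>, and their number tends to infinity with the
  distance.\<close>

lemma uniformly_embeddable_if_kernel_embeddable:
  assumes d: "\<And>x y. x \<in> M \<Longrightarrow> y \<in> M \<Longrightarrow> 0 \<le> d x y" and M: "countable M" and b: "b \<in> M"
    and KE: "kernel_embeddable M d"
  shows "uniformly_embeddable M d"
proof -
  have "\<exists>k. normalized_kernel M d (real n) ((1/2) ^ n) k \<and>
     (\<exists>T. \<forall>x\<in>M. \<forall>y\<in>M. T \<le> d x y \<longrightarrow> k x y \<le> 1/2)" for n
  proof -
    obtain k where "normalized_kernel M d (real n) ((1/2) ^ n) k"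
      and "\<forall>\<delta>>0. \<exists>T. \<forall>x\<in>M. \<forall>y\<in>M. T \<le> d x y \<longrightarrow> k x y \<le> \<delta>"
      using KE[unfolded kernel_embeddable_iff, rule_format, of "(1/2) ^ n" "real n"] by auto
    then show ?thesis using half_gt_zero[OF zero_less_one] by (intro exI[of _ k]) blast
  qed
  then obtain k where kk: "\<And>n. normalized_kernel M d (real n) ((1/2) ^ n) (k n)"
    and kf: "\<And>n. \<exists>T. \<forall>x\<in>M. \<forall>y\<in>M. T \<le> d x y \<longrightarrow> k n x y \<le> 1/2"
    by metis
  have k: "\<And>n. psd_on M (k n)" "\<And>n x. x \<in> M \<Longrightarrow> k n x x = 1"
    and k0: "\<And>n x y. x \<in> M \<Longrightarrow> y \<in> M \<Longrightarrow> 0 \<le> k n x y"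
    and kn: "\<And>n x y. x \<in> M \<Longrightarrow> y \<in> M \<Longrightarrow> d x y \<le> real n \<Longrightarrow> 1 - (1/2) ^ n \<le> k n x y"
    using kk unfolding normalized_kernel_def by blast+
  obtain T where T: "\<And>n x y. x \<in> M \<Longrightarrow> y \<in> M \<Longrightarrow> T n \<le> d x y \<Longrightarrow> k n x y \<le> 1/2"
    using kf by metis
  have k1: "k n x y \<le> 1" if "x \<in> M" "y \<in> M" for n x y
    using that k by (intro psd_on_le_1[of M]) auto
  have geo: "(\<lambda>n. (1/2::real) ^ n) sums 2" using geometric_sums[of "1/2::real"] by simp
  have bound: "1 - k n x y \<le> (if n \<in> {..<nat \<lceil>d x y\<rceil>} then 1 else 0) + (1/2) ^ n"
    if xy: "x \<in> M" "y \<in> M" for n x y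
  proof (cases "n < nat \<lceil>d x y\<rceil>")
    case True
    then have "(if n \<in> {..<nat \<lceil>d x y\<rceil>} then 1 else 0) = (1::real)" by simp
    moreover have "0 \<le> (1/2::real) ^ n" by simp
    ultimately show ?thesis using k0[OF xy, of n] by linarith
  next
    case False
    then have "d x y \<le> real n" by linarith
    then show ?thesis using kn[OF xy, of n] False by simp
  qed
  have fin: "(\<lambda>n. if n \<in> {..<m} then 1 else 0) sums real m" for m
    using sums_If_finite_set[of "{..<m}" "\<lambda>_. 1::real"] by simp
  have summ: "summable (\<lambda>n. 1 - k n x y)" if xy: "x \<in> M" "y \<in> M" for x y
  proof (rule summable_comparison_test')
    show "summable (\<lambda>n. (if n \<in> {..<nat \<lceil>d x y\<rceil>} then 1 else 0) + (1/2::real) ^ n)"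
      using sums_add[OF fin geo] by (auto simp: sums_iff)
    show "norm (1 - k n x y) \<le> (if n \<in> {..<nat \<lceil>d x y\<rceil>} then 1 else 0) + (1/2::real) ^ n" for n
      using bound[OF xy, of n] k1[OF xy, of n] by simp
  qed
  define N where "N x y = (\<Sum>n. 1 - k n x y)" for x y
  define G where "G x y = N x b + N y b - N x y" for x y
  have psd: "psd_on M G"
  proof (rule psd_on_limit)
    fix m
    show "psd_on M (\<lambda>x y. \<Sum>n<m. 1 - k n x b - k n y b + k n x y)"
      using k b by (intro psd_on_sum psd_on_recentre) auto
  next
    fix x y assume xy: "x \<in> M" "y \<in> M"
    have "(\<lambda>n. (1 - k n x b) + (1 - k n y b) - (1 - k n x y)) sums G x y"
      unfolding G_def N_def using xy b by (intro sums_diff sums_add summable_sums summ)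
    then show "(\<lambda>m. \<Sum>n<m. 1 - k n x b - k n y b + k n x y) \<longlonglongrightarrow> G x y"
      by (simp add: sums_def algebra_simps)
  qed
  have N0: "N x x = 0" if "x \<in> M" for x using that k by (simp add: N_def)
  have GN: "G x x + G y y - 2 * G x y = 2 * N x y" if "x \<in> M" "y \<in> M" for x y
    using N0 that by (simp add: G_def)
  \<comment> \<open>At most \<open>d x y + 1\<close> summands are bounded only by \<open>1\<close>;
    the geometric series for the others has sum \<open>2\<close>.\<close>
  have upper: "N x y \<le> d x y + 3" if xy: "x \<in> M" "y \<in> M" for x y
  proof -
    have "N x y \<le> real (nat \<lceil>d x y\<rceil>) + 2"
      unfolding N_def by (rule sums_le[OF bound[OF xy] summable_sums[OF summ[OF xy]] sums_add[OF fin geo]])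
    then show ?thesis using d[OF xy] by linarith
  qed
  \<comment> \<open>The thresholds need not increase with \<open>j\<close>. Their partial sums do,
    and the summand \<open>j\<close> keeps every \<open>J t\<close> finite.\<close>
  define T' where "T' j = real j + (\<Sum>i\<le>j. \<bar>T i\<bar>)" for j
  have T'T: "T j \<le> T' j" for j
    using member_le_sum[of j "{..j}" "\<lambda>i. \<bar>T i\<bar>"] by (simp add: T'_def)
  have T'mono: "i \<le> j \<Longrightarrow> T' i \<le> T' j" for i j
    unfolding T'_def by (intro add_mono sum_mono2) auto
  define J where "J t = {j. T' j \<le> t}" for t
  have finJ: "finite (J t)" for t
  proof (rule finite_subset)
    show "J t \<subseteq> {..nat \<lceil>t\<rceil>}"
    proof
      fix j assume "j \<in> J t"
      then have "real j + (\<Sum>i\<le>j. \<bar>T i\<bar>) \<le> t" by (simp add: J_def T'_def)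
      moreover have "0 \<le> (\<Sum>i\<le>j. \<bar>T i\<bar>)" by (intro sum_nonneg) auto
      ultimately have "real j \<le> t" by linarith
      then show "j \<in> {..nat \<lceil>t\<rceil>}" by (simp add: le_nat_iff) linarith
    qed
  qed simp
  have lower: "real (card (J (d x y))) \<le> 2 * N x y" if xy: "x \<in> M" "y \<in> M" for x y
  proof -
    have "real (card (J (d x y))) = 2 * (\<Sum>n\<in>J (d x y). 1/2)" by simp
    also have "(\<Sum>n\<in>J (d x y). 1/2) \<le> (\<Sum>n\<in>J (d x y). 1 - k n x y)"
    proof (rule sum_mono)
      fix n assume "n \<in> J (d x y)"
      then have "T n \<le> d x y" using T'T[of n] by (simp add: J_def)
      then show "1/2 \<le> 1 - k n x y" using T[OF xy] by fastforce
    qed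
    also have "\<dots> \<le> N x y"
      unfolding N_def using k1[OF xy] by (intro sum_le_suminf summ xy finJ) auto
    finally show ?thesis by simp
  qed
  show ?thesis
  proof (rule uniformly_embeddable_psdI[OF M psd, where \<rho>m = "\<lambda>t. sqrt (real (card (J t)))"
        and \<rho>p = "\<lambda>t. sqrt (2 * (t + 3))"])
    show "mono_on {0..} (\<lambda>t. sqrt (real (card (J t))))"
      by (intro mono_onI real_sqrt_le_mono of_nat_mono card_mono finJ) (auto simp: J_def)
    show "mono_on {0..} (\<lambda>t::real. sqrt (2 * (t + 3)))" by (intro mono_onI) simp
    show "filterlim (\<lambda>t. sqrt (real (card (J t)))) at_top at_top"
      unfolding filterlim_at_top eventually_at_top_linorder
    proof
      fix Z :: real
      define m where "m = nat \<lceil>Z\<^sup>2\<rceil>"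
      have "Z \<le> sqrt (real (card (J t)))" if "T' m \<le> t" for t
      proof -
        have "{..m} \<subseteq> J t" using T'mono that by (fastforce simp: J_def)
        then have "card {..m} \<le> card (J t)" by (intro card_mono finJ)
        then have "m \<le> card (J t)" by simp
        moreover have "Z\<^sup>2 \<le> real m" by (simp add: m_def)
        ultimately have "Z\<^sup>2 \<le> real (card (J t))" by linarith
        then show ?thesis by (rule real_le_rsqrt)
      qed
      then show "\<exists>N. \<forall>t\<ge>N. Z \<le> sqrt (real (card (J t)))" by blast
    qed
    show "filterlim (\<lambda>t::real. sqrt (2 * (t + 3))) at_top at_top"
      unfolding filterlim_at_top eventually_at_top_linorder
    proof
      fix Z :: real
      have "Z \<le> sqrt (2 * (t + 3))" if t: "Z\<^sup>2 \<le> t" for t :: real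
      proof (rule real_le_rsqrt)
        have "0 \<le> t" using t zero_le_power2[of Z] by (rule order_trans[rotated])
        then show "Z\<^sup>2 \<le> 2 * (t + 3)" using t by simp
      qed
      then show "\<exists>N. \<forall>t\<ge>N. Z \<le> sqrt (2 * (t + 3))" by blast
    qed
  next
    fix x y assume xy: "x \<in> M" "y \<in> M"
    show "sqrt (real (card (J (d x y)))) \<le> sqrt (G x x + G y y - 2 * G x y)"
      using lower[OF xy] by (simp add: GN[OF xy])
    show "sqrt (G x x + G y y - 2 * G x y) \<le> sqrt (2 * (d x y + 3))"
      using upper[OF xy] by (simp add: GN[OF xy])
  qed auto
qed

text \<open>Uniformity comes from having finitely many models: the threshold is the maximum of
  theirs, and the distortion \<open>C\<close> shifts \<open>R\<close> and the threshold equally for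
  all members.\<close>

lemma equi_embeddable_coarse:
  assumes J: "finite J" and KE: "\<And>j. j \<in> J \<Longrightarrow> kernel_embeddable (N j) d"
    and f: "\<And>e. e \<in> I \<Longrightarrow> \<exists>j\<in>J. \<exists>f\<in>U e \<rightarrow> N j. \<forall>x\<in>U e. \<forall>y\<in>U e.
        d (f x) (f y) \<le> d x y + C \<and> d x y \<le> d (f x) (f y) + C"
  shows "equi_embeddable I U d"
  unfolding equi_embeddable_def
proof (intro allI impI)
  fix R \<epsilon> :: real assume \<epsilon>: "0 < \<epsilon>"
  have "\<exists>k. j \<in> J \<longrightarrow> normalized_kernel (N j) d (R + C) \<epsilon> k \<and>
     (\<forall>\<delta>>0. \<exists>T. \<forall>x\<in>N j. \<forall>y\<in>N j. T \<le> d x y \<longrightarrow> k x y \<le> \<delta>)" for j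
    using KE[unfolded kernel_embeddable_iff, rule_format, OF _ \<epsilon>] by blast
  then obtain k where kk: "\<And>j. j \<in> J \<Longrightarrow> normalized_kernel (N j) d (R + C) \<epsilon> (k j)"
    and k5: "\<And>j. j \<in> J \<Longrightarrow> \<forall>\<delta>>0. \<exists>T. \<forall>x\<in>N j. \<forall>y\<in>N j. T \<le> d x y \<longrightarrow> k j x y \<le> \<delta>"
    by metis
  have k: "\<And>j. j \<in> J \<Longrightarrow> psd_on (N j) (k j)"
    "\<And>j x. j \<in> J \<Longrightarrow> x \<in> N j \<Longrightarrow> k j x x = 1"
    "\<And>j x y. j \<in> J \<Longrightarrow> x \<in> N j \<Longrightarrow> y \<in> N j \<Longrightarrow> 0 \<le> k j x y"
    "\<And>j x y. j \<in> J \<Longrightarrow> x \<in> N j \<Longrightarrow> y \<in> N j \<Longrightarrow> d x y \<le> R + C \<Longrightarrow> 1 - \<epsilon> \<le> k j x y"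
    using kk unfolding normalized_kernel_def by blast+
  define P where "P e j f \<longleftrightarrow> j \<in> J \<and> f \<in> U e \<rightarrow> N j \<and>
      (\<forall>x\<in>U e. \<forall>y\<in>U e. d (f x) (f y) \<le> d x y + C \<and> d x y \<le> d (f x) (f y) + C)" for e j f
  have "\<exists>j f. e \<in> I \<longrightarrow> P e j f" for e
    using f unfolding P_def by blast
  then obtain j f where "\<And>e. e \<in> I \<Longrightarrow> P e (j e) (f e)" by metis
  then have j: "\<And>e. e \<in> I \<Longrightarrow> j e \<in> J" and fN: "\<And>e. e \<in> I \<Longrightarrow> f e \<in> U e \<rightarrow> N (j e)"
    and f1: "\<And>e x y. e \<in> I \<Longrightarrow> x \<in> U e \<Longrightarrow> y \<in> U e \<Longrightarrow> d (f e x) (f e y) \<le> d x y + C"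
    and f2: "\<And>e x y. e \<in> I \<Longrightarrow> x \<in> U e \<Longrightarrow> y \<in> U e \<Longrightarrow> d x y \<le> d (f e x) (f e y) + C"
    unfolding P_def by blast+
  define l where "l e x y = k (j e) (f e x) (f e y)" for e x y
  have fx: "f e x \<in> N (j e)" if "e \<in> I" "x \<in> U e" for e x using fN that by blast
  have "psd_on (U e) (l e)" if "e \<in> I" for e
    unfolding l_def by (rule psd_on_pullback[OF k(1)[OF j[OF that]] fN[OF that]])
  moreover have "l e x x = 1" if "e \<in> I" "x \<in> U e" for e x
    using k(2) j fx that by (simp add: l_def)
  moreover have "0 \<le> l e x y" if "e \<in> I" "x \<in> U e" "y \<in> U e" for e x y
    using k(3) j fx that by (simp add: l_def)
  moreover have "1 - \<epsilon> \<le> l e x y" if "e \<in> I" "x \<in> U e" "y \<in> U e" "d x y \<le> R" for e x y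
    using k(4)[of "j e" "f e x" "f e y"] j fx f1[of e x y] that by (simp add: l_def)
  moreover have "\<exists>T. \<forall>e\<in>I. \<forall>x\<in>U e. \<forall>y\<in>U e. T \<le> d x y \<longrightarrow> l e x y \<le> \<delta>" if \<delta>: "0 < \<delta>" for \<delta>
  proof -
    have "\<exists>T. j \<in> J \<longrightarrow> (\<forall>x\<in>N j. \<forall>y\<in>N j. T \<le> d x y \<longrightarrow> k j x y \<le> \<delta>)" for j
      using k5 \<delta> by blast
    then obtain T where T: "\<And>j x y. j \<in> J \<Longrightarrow> x \<in> N j \<Longrightarrow> y \<in> N j \<Longrightarrow> T j \<le> d x y \<Longrightarrow> k j x y \<le> \<delta>"
      by metis
    define T' where "T' = Max (insert 0 (T ` J))"
    have T': "T j \<le> T'" if "j \<in> J" for j using J that by (auto simp: T'_def)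
    have "l e x y \<le> \<delta>" if "e \<in> I" "x \<in> U e" "y \<in> U e" "T' + C \<le> d x y" for e x y
      using T[of "j e" "f e x" "f e y"] T'[of "j e"] j fx f2[of e x y] that by (simp add: l_def)
    then show ?thesis by blast
  qed
  ultimately show "\<exists>k. (\<forall>e\<in>I. normalized_kernel (U e) d R \<epsilon> (k e)) \<and>
          (\<forall>\<delta>>0. \<exists>T. \<forall>e\<in>I. \<forall>x\<in>U e. \<forall>y\<in>U e. T \<le> d x y \<longrightarrow> k e x y \<le> \<delta>)"
    unfolding normalized_kernel_def by (intro exI[of _ l]) auto
qed

text \<open>The inner product in \<open>\<ell>\<^sup>2\<close> of the index set. Summing over the
  support of the first vector keeps the sum finite when that support is finite.\<close>

definition overlap :: "('a \<Rightarrow> 'e \<Rightarrow> real) \<Rightarrow> 'a \<Rightarrow> 'a \<Rightarrow> real" where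
  "overlap \<zeta> x y = (\<Sum>e | \<zeta> x e \<noteq> 0. \<zeta> x e * \<zeta> y e)"

definition almost_invariant :: "'a set \<Rightarrow> ('a \<Rightarrow> 'a \<Rightarrow> bool) \<Rightarrow> real \<Rightarrow> ('a \<Rightarrow> 'e \<Rightarrow> real) \<Rightarrow> bool" where
  "almost_invariant M near \<epsilon> \<zeta> \<longleftrightarrow>
     (\<forall>x\<in>M. finite {e. \<zeta> x e \<noteq> 0} \<and> (\<forall>e. 0 \<le> \<zeta> x e) \<and> overlap \<zeta> x x = 1) \<and>
     (\<forall>x\<in>M. \<forall>y\<in>M. near x y \<longrightarrow> 1 - \<epsilon> \<le> overlap \<zeta> x y)"

text \<open>The glued kernel is the sum over \<open>e\<close> of
  \<open>\<zeta> x e * \<zeta> y e * \<kappa> e x y\<close>. For close points the overlap and the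
  local kernels are both close to \<open>1\<close>; for distant points the common decay of the local
  kernels is weighted by an overlap of at most \<open>1\<close>. A local kernel is known only on
  \<open>U e\<close>, so summands of weight \<open>0\<close> are treated apart.\<close>

lemma kernel_embeddable_glue:
  fixes M :: "'a set" and d :: "'a \<Rightarrow> 'a \<Rightarrow> real"
  assumes "\<And>R \<epsilon> :: real. 0 < \<epsilon> \<Longrightarrow> \<exists>(I :: 'e set) U \<zeta>. equi_embeddable I U d \<and>
      almost_invariant M (\<lambda>x y. d x y \<le> R) \<epsilon> \<zeta> \<and> (\<forall>x\<in>M. \<forall>e. \<zeta> x e \<noteq> 0 \<longrightarrow> e \<in> I \<and> x \<in> U e)"
  shows "kernel_embeddable M d"
  unfolding kernel_embeddable_iff
proof (intro allI impI)
  fix R \<epsilon>0 :: real assume \<epsilon>0: "0 < \<epsilon>0"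
  \<comment> \<open>The two errors multiply, and
    \<open>(1 - \<epsilon>)\<^sup>2 \<ge> 1 - 2 * \<epsilon>\<close>; the bound by \<open>1\<close>
    keeps \<open>1 - \<epsilon>\<close> nonnegative.\<close>
  define \<epsilon> where "\<epsilon> = min 1 (\<epsilon>0 / 2)"
  have \<epsilon>: "0 < \<epsilon>" "\<epsilon> \<le> 1" "2 * \<epsilon> \<le> \<epsilon>0" using \<epsilon>0 by (auto simp: \<epsilon>_def)
  obtain I :: "'e set" and U \<zeta> where EE: "equi_embeddable I U d"
    and \<zeta>: "almost_invariant M (\<lambda>x y. d x y \<le> R) \<epsilon> \<zeta>"
    and \<zeta>U: "\<forall>x\<in>M. \<forall>e. \<zeta> x e \<noteq> 0 \<longrightarrow> e \<in> I \<and> x \<in> U e"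
    using assms[OF \<epsilon>(1), of R] by blast
  have supp: "\<And>x. x \<in> M \<Longrightarrow> finite {e. \<zeta> x e \<noteq> 0}" "\<And>x e. x \<in> M \<Longrightarrow> \<zeta> x e \<noteq> 0 \<Longrightarrow> e \<in> I \<and> x \<in> U e"
    and \<zeta>0: "\<And>x e. x \<in> M \<Longrightarrow> 0 \<le> \<zeta> x e" and unit: "\<And>x. x \<in> M \<Longrightarrow> overlap \<zeta> x x = 1"
    and over: "\<And>x y. x \<in> M \<Longrightarrow> y \<in> M \<Longrightarrow> d x y \<le> R \<Longrightarrow> 1 - \<epsilon> \<le> overlap \<zeta> x y"
    using \<zeta> \<zeta>U unfolding almost_invariant_def by blast+
  obtain \<kappa> where \<kappa>\<kappa>: "\<And>e. e \<in> I \<Longrightarrow> normalized_kernel (U e) d R \<epsilon> (\<kappa> e)"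
    and \<kappa>far: "\<And>\<delta>. 0 < \<delta> \<Longrightarrow> \<exists>T. \<forall>e\<in>I. \<forall>x\<in>U e. \<forall>y\<in>U e. T \<le> d x y \<longrightarrow> \<kappa> e x y \<le> \<delta>"
    using EE[unfolded equi_embeddable_def, rule_format, OF \<epsilon>(1), of R] by blast
  have \<kappa>: "\<And>e. e \<in> I \<Longrightarrow> psd_on (U e) (\<kappa> e)" "\<And>e x. e \<in> I \<Longrightarrow> x \<in> U e \<Longrightarrow> \<kappa> e x x = 1"
    "\<And>e x y. e \<in> I \<Longrightarrow> x \<in> U e \<Longrightarrow> y \<in> U e \<Longrightarrow> 0 \<le> \<kappa> e x y"
    "\<And>e x y. e \<in> I \<Longrightarrow> x \<in> U e \<Longrightarrow> y \<in> U e \<Longrightarrow> d x y \<le> R \<Longrightarrow> 1 - \<epsilon> \<le> \<kappa> e x y"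
    using \<kappa>\<kappa> unfolding normalized_kernel_def by blast+
  define k where "k x y = (\<Sum>e\<in>{e. \<zeta> x e \<noteq> 0}. \<zeta> x e * \<zeta> y e * \<kappa> e x y)" for x y
  have k_eq: "k x y = (\<Sum>e\<in>E. \<zeta> x e * \<zeta> y e * \<kappa> e x y)" if "finite E" "{e. \<zeta> x e \<noteq> 0} \<subseteq> E" for x y E
    unfolding k_def using that by (intro sum.mono_neutral_left) auto
  have psd_e: "psd_on M (\<lambda>x y. \<zeta> x e * \<zeta> y e * \<kappa> e x y)" for e
  proof (rule psd_onI)
    fix x y assume xy: "x \<in> M" "y \<in> M"
    show "\<zeta> x e * \<zeta> y e * \<kappa> e x y = \<zeta> y e * \<zeta> x e * \<kappa> e y x"
    proof (cases "\<zeta> x e = 0 \<or> \<zeta> y e = 0")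
      case False
      then show ?thesis using supp(2) xy psd_on_sym[OF \<kappa>(1)] by (metis mult.commute)
    qed auto
  next
    fix A and c :: "'a \<Rightarrow> real" assume A: "finite A" "A \<subseteq> M"
    let ?A = "{x\<in>A. \<zeta> x e \<noteq> 0}"
    have "(\<Sum>x\<in>A. \<Sum>y\<in>A. c x * c y * (\<zeta> x e * \<zeta> y e * \<kappa> e x y))
        = (\<Sum>x\<in>?A. \<Sum>y\<in>A. c x * c y * (\<zeta> x e * \<zeta> y e * \<kappa> e x y))"
      using A by (intro sum.mono_neutral_right) auto
    also have "\<dots> = (\<Sum>x\<in>?A. \<Sum>y\<in>?A. c x * c y * (\<zeta> x e * \<zeta> y e * \<kappa> e x y))"
      using A by (intro sum.cong[OF HOL.refl] sum.mono_neutral_right) auto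
    also have "\<dots> = (\<Sum>x\<in>?A. \<Sum>y\<in>?A. (c x * \<zeta> x e) * (c y * \<zeta> y e) * \<kappa> e x y)"
      by (simp add: mult_ac)
    also have "0 \<le> \<dots>"
    proof (cases "?A = {}")
      case False
      then have "e \<in> I" "?A \<subseteq> U e" using supp(2) A by blast+
      then show ?thesis using A by (intro psd_on_form[OF \<kappa>(1)]) auto
    qed simp
    finally show "0 \<le> (\<Sum>x\<in>A. \<Sum>y\<in>A. c x * c y * (\<zeta> x e * \<zeta> y e * \<kappa> e x y))" .
  qed
  \<comment> \<open>The defining sum runs over the support of the first point; symmetry and
    positivity need one index set for all points involved.\<close>
  have kE: "\<exists>E. finite E \<and> (\<forall>x\<in>A. \<forall>y. k x y = (\<Sum>e\<in>E. \<zeta> x e * \<zeta> y e * \<kappa> e x y))"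
    if A: "finite A" "A \<subseteq> M" for A
  proof -
    have "finite (\<Union>x\<in>A. {e. \<zeta> x e \<noteq> 0})" using A supp(1) by auto
    then show ?thesis by (intro exI[of _ "\<Union>x\<in>A. {e. \<zeta> x e \<noteq> 0}"]) (auto intro!: k_eq)
  qed
  have psd: "psd_on M k"
  proof (rule psd_onI)
    fix x y assume xy: "x \<in> M" "y \<in> M"
    obtain E where "\<forall>u\<in>{x,y}. \<forall>v. k u v = (\<Sum>e\<in>E. \<zeta> u e * \<zeta> v e * \<kappa> e u v)"
      using kE[of "{x,y}"] xy by auto
    then show "k x y = k y x"
      using psd_on_sym[OF psd_on_sum[of E M "\<lambda>e x y. \<zeta> x e * \<zeta> y e * \<kappa> e x y", OF psd_e] xy] by simp
  next
    fix A and c :: "'a \<Rightarrow> real" assume A: "finite A" "A \<subseteq> M"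
    obtain E where E: "\<forall>u\<in>A. \<forall>v. k u v = (\<Sum>e\<in>E. \<zeta> u e * \<zeta> v e * \<kappa> e u v)"
      using kE[OF A] by auto
    show "0 \<le> (\<Sum>x\<in>A. \<Sum>y\<in>A. c x * c y * k x y)"
      using psd_on_form[OF psd_on_sum[of E M "\<lambda>e x y. \<zeta> x e * \<zeta> y e * \<kappa> e x y", OF psd_e] A, of c] E
      by simp
  qed
  have diag: "k x x = 1" if x: "x \<in> M" for x
  proof -
    have "k x x = overlap \<zeta> x x"
      unfolding k_def overlap_def using supp(2)[OF x] \<kappa>(2) x by (intro sum.cong) auto
    then show ?thesis using unit[OF x] by simp
  qed
  have nn: "0 \<le> \<zeta> x e * \<zeta> y e * \<kappa> e x y" if "x \<in> M" "y \<in> M" for x y e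
  proof (cases "\<zeta> x e = 0 \<or> \<zeta> y e = 0")
    case False
    then show ?thesis using supp(2) \<kappa>(3) \<zeta>0 that by simp
  qed auto
  have near: "1 - \<epsilon>0 \<le> k x y" if xy: "x \<in> M" "y \<in> M" "d x y \<le> R" for x y
  proof -
    have "(1 - \<epsilon>) * (1 - \<epsilon>) = 1 - 2 * \<epsilon> + \<epsilon> * \<epsilon>" by (simp add: algebra_simps)
    then have "1 - \<epsilon>0 \<le> (1 - \<epsilon>) * (1 - \<epsilon>)" using \<epsilon> zero_le_square[of \<epsilon>] by linarith
    also have "\<dots> \<le> (1 - \<epsilon>) * overlap \<zeta> x y"
      using over[OF xy] \<epsilon> by (intro mult_left_mono) auto
    also have "\<dots> = (\<Sum>e\<in>{e. \<zeta> x e \<noteq> 0}. \<zeta> x e * \<zeta> y e * (1 - \<epsilon>))"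
      by (simp add: overlap_def sum_distrib_left mult_ac)
    also have "\<dots> \<le> k x y"
      unfolding k_def
    proof (rule sum_mono)
      fix e
      show "\<zeta> x e * \<zeta> y e * (1 - \<epsilon>) \<le> \<zeta> x e * \<zeta> y e * \<kappa> e x y"
      proof (cases "\<zeta> x e = 0 \<or> \<zeta> y e = 0")
        case False
        then have "1 - \<epsilon> \<le> \<kappa> e x y" using supp(2) \<kappa>(4) xy by simp
        then show ?thesis using \<zeta>0 xy by (intro mult_left_mono) auto
      qed auto
    qed
    finally show ?thesis .
  qed
  have le1: "overlap \<zeta> x y \<le> 1" if xy: "x \<in> M" "y \<in> M" for x y
  proof -
    let ?E = "{e. \<zeta> x e \<noteq> 0} \<union> {e. \<zeta> y e \<noteq> 0}"
    have fin: "finite ?E" using supp(1) xy by simp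
    have "overlap \<zeta> x y = (\<Sum>e\<in>?E. \<zeta> x e * \<zeta> y e)"
      unfolding overlap_def using fin by (intro sum.mono_neutral_left) auto
    also have "\<dots> \<le> (\<Sum>e\<in>?E. ((\<zeta> x e)\<^sup>2 + (\<zeta> y e)\<^sup>2) / 2)"
    proof (rule sum_mono)
      fix e show "\<zeta> x e * \<zeta> y e \<le> ((\<zeta> x e)\<^sup>2 + (\<zeta> y e)\<^sup>2) / 2"
        using sum_squares_bound[of "\<zeta> x e" "\<zeta> y e"] by simp
    qed
    also have "\<dots> = ((\<Sum>e\<in>?E. (\<zeta> x e)\<^sup>2) + (\<Sum>e\<in>?E. (\<zeta> y e)\<^sup>2)) / 2"
      by (simp only: sum_divide_distrib[symmetric] sum.distrib)
    also have "(\<Sum>e\<in>?E. (\<zeta> x e)\<^sup>2) = 1"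
      unfolding unit[OF xy(1), symmetric] overlap_def power2_eq_square using fin by (intro sum.mono_neutral_right) auto
    also have "(\<Sum>e\<in>?E. (\<zeta> y e)\<^sup>2) = 1"
      unfolding unit[OF xy(2), symmetric] overlap_def power2_eq_square using fin by (intro sum.mono_neutral_right) auto
    finally show ?thesis by simp
  qed
  have far: "\<exists>T. \<forall>x\<in>M. \<forall>y\<in>M. T \<le> d x y \<longrightarrow> k x y \<le> \<delta>" if \<delta>: "0 < \<delta>" for \<delta>
  proof -
    obtain T where T: "\<And>e x y. e \<in> I \<Longrightarrow> x \<in> U e \<Longrightarrow> y \<in> U e \<Longrightarrow> T \<le> d x y \<Longrightarrow> \<kappa> e x y \<le> \<delta>"
      using \<kappa>far[OF \<delta>] by blast
    have "k x y \<le> \<delta>" if xy: "x \<in> M" "y \<in> M" "T \<le> d x y" for x y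
    proof -
      have "k x y \<le> (\<Sum>e\<in>{e. \<zeta> x e \<noteq> 0}. \<zeta> x e * \<zeta> y e * \<delta>)"
        unfolding k_def
      proof (rule sum_mono)
        fix e
        show "\<zeta> x e * \<zeta> y e * \<kappa> e x y \<le> \<zeta> x e * \<zeta> y e * \<delta>"
        proof (cases "\<zeta> x e = 0 \<or> \<zeta> y e = 0")
          case False
          then have "\<kappa> e x y \<le> \<delta>" using supp(2) T xy by simp
          then show ?thesis using \<zeta>0 xy by (intro mult_left_mono) auto
        qed auto
      qed
      also have "\<dots> = \<delta> * overlap \<zeta> x y"
        by (simp add: overlap_def sum_distrib_left mult_ac)
      also have "\<dots> \<le> \<delta> * 1" using le1[OF xy(1,2)] \<delta> by (intro mult_left_mono) auto
      finally show ?thesis by simp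
    qed
    then show ?thesis by blast
  qed
  show "\<exists>k. normalized_kernel M d R \<epsilon>0 k \<and>
          (\<forall>\<delta>>0. \<exists>T. \<forall>x\<in>M. \<forall>y\<in>M. T \<le> d x y \<longrightarrow> k x y \<le> \<delta>)"
    using psd diag near far nn unfolding normalized_kernel_def
    by (intro exI[of _ k] conjI ballI) (auto simp: k_def intro!: sum_nonneg)
qed

section \<open>Walks and cochains\<close>

type_synonym 'v darts = "('v \<times> 'v) list"

fun walk :: "('v \<times> 'v) set \<Rightarrow> 'v \<Rightarrow> 'v darts \<Rightarrow> 'v \<Rightarrow> bool" where
  "walk E u [] v \<longleftrightarrow> u = v"
| "walk E u (d # ds) v \<longleftrightarrow> fst d = u \<and> d \<in> E \<and> walk E (snd d) ds v"

definition reverse_walk :: "'v darts \<Rightarrow> 'v darts" where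
  "reverse_walk ds = rev (map prod.swap ds)"

definition cochain_sum :: "('v \<Rightarrow> 'v \<Rightarrow> int) \<Rightarrow> 'v darts \<Rightarrow> int" where
  "cochain_sum \<phi> ds = (\<Sum>(a, b)\<leftarrow>ds. \<phi> a b)"

definition antisymmetric :: "('v \<Rightarrow> 'v \<Rightarrow> int) \<Rightarrow> bool" where
  "antisymmetric \<phi> \<longleftrightarrow> (\<forall>a b. \<phi> a b = - \<phi> b a)"

lemma antisymmetricD: "antisymmetric \<phi> \<Longrightarrow> \<phi> a b = - \<phi> b a"
  unfolding antisymmetric_def by blast

lemma antisymmetric_refl: "antisymmetric \<phi> \<Longrightarrow> \<phi> a a = 0"
  using antisymmetricD[of \<phi> a a] by linarith

lemma cochain_sum_simps [simp]:
  "cochain_sum \<phi> [] = 0"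
  "cochain_sum \<phi> (d # ds) = \<phi> (fst d) (snd d) + cochain_sum \<phi> ds"
  "cochain_sum \<phi> (ds @ es) = cochain_sum \<phi> ds + cochain_sum \<phi> es"
  by (simp_all add: cochain_sum_def case_prod_beta)

lemma length_reverse_walk [simp]: "length (reverse_walk ds) = length ds"
  by (simp add: reverse_walk_def)

lemma set_reverse_walk [simp]: "set (reverse_walk ds) = prod.swap ` set ds"
  by (simp add: reverse_walk_def)

lemma walk_append: "walk E u (ds @ es) w \<longleftrightarrow> (\<exists>v. walk E u ds v \<and> walk E v es w)"
  by (induction ds arbitrary: u) auto

lemma walk_appendI: "walk E u ds v \<Longrightarrow> walk E v es w \<Longrightarrow> walk E u (ds @ es) w"
  by (auto simp: walk_append)

lemma walk_reverse:
  assumes "sym E"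
  shows "walk E u ds v \<Longrightarrow> walk E v (reverse_walk ds) u"
proof (induction ds arbitrary: u)
  case (Cons d ds)
  then have "walk E v (reverse_walk ds) (snd d)" by simp
  moreover have "walk E (snd d) [prod.swap d] u"
    using Cons.prems assms by (cases d) (auto dest: symD)
  ultimately show ?case by (auto simp: reverse_walk_def intro: walk_appendI)
qed (simp add: reverse_walk_def)

lemma walk_edges: "walk E u ds v \<Longrightarrow> set ds \<subseteq> E"
  by (induction ds arbitrary: u) auto

lemma cochain_sum_reverse:
  assumes "antisymmetric \<phi>"
  shows "cochain_sum \<phi> (reverse_walk ds) = - cochain_sum \<phi> ds"
proof (induction ds)
  case (Cons d ds)
  then show ?case
    using antisymmetricD[OF assms, of "snd d" "fst d"] by (simp add: reverse_walk_def)
qed (simp add: reverse_walk_def)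

lemma cochain_sum_coboundary: "walk E u ds v \<Longrightarrow> cochain_sum (\<lambda>a b. f b - f a) ds = f v - f u"
  by (induction ds arbitrary: u) auto

lemma cochain_sum_cong:
  "(\<And>a b. (a, b) \<in> set ds \<Longrightarrow> \<phi> a b = \<psi> a b) \<Longrightarrow> cochain_sum \<phi> ds = cochain_sum \<psi> ds"
  by (induction ds) auto

lemma cochain_sum_eq_0: "(\<And>a b. (a, b) \<in> set ds \<Longrightarrow> \<phi> a b = 0) \<Longrightarrow> cochain_sum \<phi> ds = 0"
  by (induction ds) auto

lemma relpow_iff_walk: "(u, v) \<in> E ^^ n \<longleftrightarrow> (\<exists>ds. walk E u ds v \<and> length ds = n)"
proof (induction n arbitrary: u)
  case (Suc n)
  have "(u, v) \<in> E ^^ Suc n \<longleftrightarrow> (\<exists>z. (u, z) \<in> E \<and> (\<exists>ds. walk E z ds v \<and> length ds = n))"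
    using Suc by (metis relpow_Suc_I2 relpow_Suc_E2)
  also have "\<dots> \<longleftrightarrow> (\<exists>ds. walk E u ds v \<and> length ds = Suc n)"
  proof
    assume "\<exists>z. (u, z) \<in> E \<and> (\<exists>ds. walk E z ds v \<and> length ds = n)"
    then obtain z ds where "(u, z) \<in> E" "walk E z ds v" "length ds = n" by blast
    then show "\<exists>ds. walk E u ds v \<and> length ds = Suc n" by (intro exI[of _ "(u, z) # ds"]) simp
  next
    assume "\<exists>ds. walk E u ds v \<and> length ds = Suc n"
    then obtain d ds where "walk E u (d # ds) v" "length ds = n" by (metis length_Suc_conv)
    then show "\<exists>z. (u, z) \<in> E \<and> (\<exists>ds. walk E z ds v \<and> length ds = n)"
      by (intro exI[of _ "snd d"]) (cases d, auto)
  qed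
  finally show ?case .
qed simp

lemma relpow_subset:
  fixes R S :: "('a \<times> 'a) set"
  shows "R \<subseteq> S \<Longrightarrow> R ^^ n \<subseteq> S ^^ n"
  by (induction n) (simp_all add: relcomp_mono)

lemma walk_vertex:
  assumes "walk E a c b" "d \<in> set c"
  shows "\<exists>c'. walk E a c' (fst d) \<and> length c' < length c" "\<exists>c'. walk E a c' (snd d) \<and> length c' \<le> length c"
proof -
  obtain c1 c2 where c: "c = c1 @ d # c2" using assms(2) by (meson split_list)
  have w: "walk E a c1 (fst d)" "d \<in> E" using assms(1) unfolding c walk_append by auto
  then show "\<exists>c'. walk E a c' (fst d) \<and> length c' < length c" using c by auto
  have "walk E a (c1 @ [d]) (snd d)" using w by (auto simp: walk_append)
  then show "\<exists>c'. walk E a c' (snd d) \<and> length c' \<le> length c" unfolding c by force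
qed

section \<open>Fine graphs with a linear isoperimetric inequality\<close>

definition sup_edges :: "'v darts \<Rightarrow> ('v \<times> 'v) set" where
  "sup_edges c = set c \<union> prod.swap ` set c"

definition cell_adjacent :: "'v darts set \<Rightarrow> (('v \<times> 'v) \<times> ('v \<times> 'v)) set" where
  "cell_adjacent Z = (\<Union>c\<in>Z. sup_edges c \<times> sup_edges c)"

text \<open>The edge relation is reflexive, so that \<open>E ^^ n\<close> means distance at most \<open>n\<close>. The equality of
  \<open>1\<close>-chains in \<open>fill\<close> is tested against antisymmetric cochains, which identifies an edge with minus
  its reverse and kills the loops.\<close>

locale fine_graph =
  fixes E :: "('v \<times> 'v) set" and Z :: "'v darts set" and b0 :: 'v and M N C :: nat
  assumes refl_E: "(v, v) \<in> E" and sym_E: "sym E"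
    and cell_closed: "c \<in> Z \<Longrightarrow> \<exists>u. walk E u c u"
    and cell_length: "c \<in> Z \<Longrightarrow> length c \<le> M"
    and fill: "(b0, u) \<in> E\<^sup>* \<Longrightarrow> walk E u w u \<Longrightarrow> \<exists>cs. set cs \<subseteq> Z \<and> length cs \<le> C * (length w + 2) \<and>
      (\<forall>\<phi>. antisymmetric \<phi> \<longrightarrow> cochain_sum \<phi> w = (\<Sum>c\<leftarrow>cs. cochain_sum \<phi> c))"
    and fine: "finite (cell_adjacent Z `` {e})" "card (cell_adjacent Z `` {e}) \<le> N"
begin

section \<open>Conservation of flow across a cut\<close>

lemma cell_edges: "c \<in> Z \<Longrightarrow> sup_edges c \<subseteq> E"
  using cell_closed walk_edges sym_E by (fastforce simp: sup_edges_def dest: symD)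

definition up_edges :: "('v \<Rightarrow> bool) \<Rightarrow> 'v darts \<Rightarrow> ('v \<times> 'v) set" where
  "up_edges \<tau> c = {(u, v) \<in> sup_edges c. \<not> \<tau> u \<and> \<tau> v}"

text \<open>The coboundary of the indicator of \<open>\<tau>\<close>, restricted to the edges of
  \<open>Q\<close>.\<close>

definition cut_flow :: "('v \<Rightarrow> bool) \<Rightarrow> ('v \<times> 'v) set \<Rightarrow> 'v \<Rightarrow> 'v \<Rightarrow> int" where
  "cut_flow \<tau> Q u v = (if \<not> \<tau> u \<and> \<tau> v \<and> (u, v) \<in> Q then 1
     else if \<tau> u \<and> \<not> \<tau> v \<and> (v, u) \<in> Q then - 1 else 0)"

text \<open>Only edges of the cut are related, so the length of a chain is controlled by the cells
  that meet this cut and not by the whole filling.\<close>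

definition linkage :: "('v \<Rightarrow> bool) \<Rightarrow> 'v darts list \<Rightarrow> (('v \<times> 'v) \<times> ('v \<times> 'v)) set" where
  "linkage \<tau> cs = (\<Union>c\<in>set cs. up_edges \<tau> c \<times> up_edges \<tau> c)"

lemma antisymmetric_cut_flow: "antisymmetric (cut_flow \<tau> Q)"
  by (auto simp: antisymmetric_def cut_flow_def)

text \<open>If \<open>Q\<close> contains all cut edges of the closed walk, \<open>cut_flow\<close>
  is a coboundary along it; if \<open>Q\<close> contains none, it vanishes there.\<close>

lemma cell_cut_flow:
  assumes c: "walk E u c u" and Q: "up_edges \<tau> c \<subseteq> Q \<or> up_edges \<tau> c \<inter> Q = {}"
  shows "cochain_sum (cut_flow \<tau> Q) c = 0"
  using Q
proof
  assume Q: "up_edges \<tau> c \<subseteq> Q"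
  have "cochain_sum (cut_flow \<tau> Q) c = cochain_sum (\<lambda>a b. of_bool (\<tau> b) - of_bool (\<tau> a)) c"
  proof (rule cochain_sum_cong)
    fix a b assume ab: "(a, b) \<in> set c"
    then have "(a, b) \<in> sup_edges c" "(b, a) \<in> sup_edges c" by (auto simp: sup_edges_def)
    then show "cut_flow \<tau> Q a b = of_bool (\<tau> b) - of_bool (\<tau> a)"
      using Q by (auto simp: cut_flow_def up_edges_def)
  qed
  also have "\<dots> = 0" using cochain_sum_coboundary[OF c, of "\<lambda>v. of_bool (\<tau> v)"] by simp
  finally show ?thesis .
next
  assume Q: "up_edges \<tau> c \<inter> Q = {}"
  show ?thesis
  proof (rule cochain_sum_eq_0)
    fix a b assume ab: "(a, b) \<in> set c"
    then have "(a, b) \<in> sup_edges c" "(b, a) \<in> sup_edges c" by (auto simp: sup_edges_def)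
    then show "cut_flow \<tau> Q a b = 0"
      using Q by (auto simp: cut_flow_def up_edges_def)
  qed
qed

text \<open>The cells of a filling that are linked to a given edge of the cut contribute closed walks,
  and the other cells do not meet the linked edges.\<close>

lemma linked_cut_flow_eq_0:
  assumes cs: "set cs \<subseteq> Z" and w: "\<And>\<phi>. antisymmetric \<phi> \<Longrightarrow> cochain_sum \<phi> w = (\<Sum>c\<leftarrow>cs. cochain_sum \<phi> c)"
  shows "cochain_sum (cut_flow \<tau> ((linkage \<tau> cs)\<^sup>* `` {e})) w = 0"
proof -
  let ?Q = "(linkage \<tau> cs)\<^sup>* `` {e}"
  have "cochain_sum (cut_flow \<tau> ?Q) c = 0" if c: "c \<in> set cs" for c
  proof -
    obtain u where u: "walk E u c u" using cell_closed c cs by blast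
    have "up_edges \<tau> c \<subseteq> ?Q" if meet: "up_edges \<tau> c \<inter> ?Q \<noteq> {}"
    proof
      fix x assume x: "x \<in> up_edges \<tau> c"
      obtain y where y: "y \<in> up_edges \<tau> c" "y \<in> ?Q" using meet by blast
      then have "(y, x) \<in> linkage \<tau> cs" using x c by (auto simp: linkage_def)
      then show "x \<in> ?Q" using y(2) by (auto intro: rtrancl_into_rtrancl)
    qed
    then show ?thesis using cell_cut_flow[OF u] by blast
  qed
  then have "map (cochain_sum (cut_flow \<tau> ?Q)) cs = map (\<lambda>_. 0) cs"
    by (rule map_cong[OF HOL.refl])
  then have "(\<Sum>c\<leftarrow>cs. cochain_sum (cut_flow \<tau> ?Q) c) = 0" by (simp only: sum_list_0)
  then show ?thesis using w[OF antisymmetric_cut_flow] by simp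
qed

text \<open>The cut selects one orientation of each edge, so there is no factor
  \<open>2\<close>.\<close>

lemma up_edges_bound: "finite (up_edges \<tau> c)" "card (up_edges \<tau> c) \<le> length c"
proof -
  have sub: "up_edges \<tau> c \<subseteq> (\<lambda>(u, v). if \<tau> v then (u, v) else (v, u)) ` set c"
  proof
    fix e assume "e \<in> up_edges \<tau> c"
    then obtain u v where e: "e = (u, v)" "\<not> \<tau> u" "\<tau> v" "(u, v) \<in> set c \<or> (v, u) \<in> set c"
      by (auto simp: up_edges_def sup_edges_def)
    then show "e \<in> (\<lambda>(u, v). if \<tau> v then (u, v) else (v, u)) ` set c"
      by (auto simp: image_iff intro: bexI[of _ "(u, v)"] bexI[of _ "(v, u)"])
  qed
  then show "finite (up_edges \<tau> c)" by (rule finite_subset) simp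
  have "card (up_edges \<tau> c) \<le> card ((\<lambda>(u, v). if \<tau> v then (u, v) else (v, u)) ` set c)"
    by (intro card_mono sub) simp
  also have "\<dots> \<le> card (set c)" by (rule card_image_le) simp
  also have "\<dots> \<le> length c" by (rule card_length)
  finally show "card (up_edges \<tau> c) \<le> length c" .
qed

definition crossing_count :: "('v \<Rightarrow> bool) \<Rightarrow> 'v darts list \<Rightarrow> nat" where
  "crossing_count \<tau> cs = length (filter (\<lambda>c. up_edges \<tau> c \<noteq> {}) cs)"

lemma linkage_bound:
  assumes "set cs \<subseteq> Z"
  shows "finite (linkage \<tau> cs)" "card (linkage \<tau> cs) \<le> M * M * crossing_count \<tau> cs"
proof -
  show "finite (linkage \<tau> cs)" by (auto simp: linkage_def up_edges_bound)
  show "card (linkage \<tau> cs) \<le> M * M * crossing_count \<tau> cs"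
    using assms
  proof (induction cs)
    case (Cons c cs)
    have eq: "linkage \<tau> (c # cs) = up_edges \<tau> c \<times> up_edges \<tau> c \<union> linkage \<tau> cs"
      by (simp add: linkage_def)
    have "card (up_edges \<tau> c) \<le> M"
      using up_edges_bound(2)[of \<tau> c] cell_length[of c] Cons.prems by auto
    then have "card (up_edges \<tau> c \<times> up_edges \<tau> c) \<le> M * M"
      by (simp add: card_cartesian_product mult_le_mono)
    moreover have "card (linkage \<tau> cs) \<le> M * M * crossing_count \<tau> cs" using Cons by simp
    moreover note card_Un_le[of "up_edges \<tau> c \<times> up_edges \<tau> c" "linkage \<tau> cs"]
    ultimately show ?case
      unfolding eq by (cases "up_edges \<tau> c = {}") (simp_all add: crossing_count_def)
  qed (simp add: linkage_def)
qed

text \<open>In a finite relation as many steps suffice as it has pairs, and a cell contributes at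
  most \<open>M * M\<close> pairs, and none unless it meets the cut.\<close>

lemma linkage_steps:
  assumes "set cs \<subseteq> Z" and "(e, e') \<in> (linkage \<tau> cs)\<^sup>*"
  shows "\<exists>k \<le> M * M * crossing_count \<tau> cs. (e, e') \<in> cell_adjacent Z ^^ k"
proof -
  have sub: "linkage \<tau> cs \<subseteq> cell_adjacent Z"
    using assms(1) by (auto simp: linkage_def cell_adjacent_def up_edges_def)
  obtain k where k: "k \<le> card (linkage \<tau> cs)" "(e, e') \<in> linkage \<tau> cs ^^ k"
    using assms(2) rtrancl_finite_eq_relpow[OF linkage_bound(1)[OF assms(1)]] by auto
  have "(e, e') \<in> cell_adjacent Z ^^ k"
    using k(2) relpow_subset[OF sub] by blast
  then show ?thesis using k(1) linkage_bound(2)[OF assms(1)] le_trans by blast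
qed

section \<open>Cell steps and graph distance\<close>

lemma relpow_E_mono: "m \<le> n \<Longrightarrow> (u, v) \<in> E ^^ m \<Longrightarrow> (u, v) \<in> E ^^ n"
proof (induction n rule: dec_induct)
  case (step n)
  then show ?case using refl_E by (auto intro: relpow_Suc_I)
qed simp

lemma relpow_E_sym: "(u, v) \<in> E ^^ n \<Longrightarrow> (v, u) \<in> E ^^ n"
  using walk_reverse[OF sym_E] length_reverse_walk unfolding relpow_iff_walk by metis

lemma relpow_E_trans: "(u, v) \<in> E ^^ m \<Longrightarrow> (v, w) \<in> E ^^ n \<Longrightarrow> (u, w) \<in> E ^^ (m + n)"
  by (auto simp: relpow_add)

lemma cell_diameter:
  assumes "(e, e') \<in> cell_adjacent Z"
  shows "(fst e, fst e') \<in> E ^^ (2 * M)"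
proof -
  obtain c where c: "c \<in> Z" "e \<in> sup_edges c" "e' \<in> sup_edges c"
    using assms by (auto simp: cell_adjacent_def)
  obtain u where u: "walk E u c u" using cell_closed c by blast
  have near: "(u, fst x) \<in> E ^^ M" if xc: "x \<in> sup_edges c" for x
  proof -
    have "\<exists>c'. walk E u c' (fst x) \<and> length c' \<le> length c"
    proof (cases "x \<in> set c")
      case True
      then show ?thesis using walk_vertex(1)[OF u] less_imp_le by blast
    next
      case False
      then obtain y where "y \<in> set c" "x = prod.swap y" using xc unfolding sup_edges_def by blast
      then show ?thesis using walk_vertex(2)[OF u] by auto
    qed
    then obtain c' where "walk E u c' (fst x)" "length c' \<le> M"
      using cell_length[OF c(1)] by fastforce
    then show ?thesis using relpow_E_mono relpow_iff_walk by metis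
  qed
  show ?thesis
    using relpow_E_trans[OF relpow_E_sym[OF near[OF c(2)]] near[OF c(3)]] by (simp add: mult_2)
qed

lemma cell_adjacent_steps_distance:
  "(e, e') \<in> cell_adjacent Z ^^ k \<Longrightarrow> (fst e, fst e') \<in> E ^^ (2 * M * k)"
proof (induction k arbitrary: e')
  case (Suc k)
  then obtain e1 where "(e, e1) \<in> cell_adjacent Z ^^ k" "(e1, e') \<in> cell_adjacent Z" by auto
  then have "(fst e, fst e') \<in> E ^^ (2 * M * k + 2 * M)"
    using Suc.IH cell_diameter relpow_E_trans by blast
  then show ?case by (simp add: algebra_simps)
qed simp

text \<open>Fineness replaces local finiteness: degrees may be infinite, but boundedly many cell
  steps lead to boundedly many edges.\<close>

lemma card_cell_adjacent_steps:
  "finite ((cell_adjacent Z ^^ k) `` {e}) \<and> card ((cell_adjacent Z ^^ k) `` {e}) \<le> N ^ k"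
proof (induction k)
  case (Suc k)
  let ?A = "(cell_adjacent Z ^^ k) `` {e}"
  have eq: "(cell_adjacent Z ^^ Suc k) `` {e} = (\<Union>x\<in>?A. cell_adjacent Z `` {x})" by auto
  have "card (\<Union>x\<in>?A. cell_adjacent Z `` {x}) \<le> (\<Sum>x\<in>?A. card (cell_adjacent Z `` {x}))"
    using Suc by (intro card_UN_le) auto
  also have "\<dots> \<le> card ?A * N" using fine(2) by (intro sum_bounded_above[where K = N, simplified]) auto
  also have "\<dots> \<le> N ^ Suc k" using Suc by (simp add: mult.commute)
  finally show ?case unfolding eq using Suc fine(1) by auto
qed simp

subsection \<open>Levels and geodesics\<close>

definition gdist :: "'v \<Rightarrow> 'v \<Rightarrow> nat" where
  "gdist u v = (LEAST n. (u, v) \<in> E ^^ n)"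

abbreviation lev :: "'v \<Rightarrow> nat" where
  "lev \<equiv> gdist b0"

abbreviation reachable :: "'v set" where
  "reachable \<equiv> E\<^sup>* `` {b0}"

lemma gdist_le: "(u, v) \<in> E ^^ n \<Longrightarrow> gdist u v \<le> n"
  unfolding gdist_def by (rule Least_le)

lemma relpow_gdist: "(u, v) \<in> E ^^ n \<Longrightarrow> (u, v) \<in> E ^^ gdist u v"
  unfolding gdist_def by (rule LeastI)

lemma relpow_lev: "v \<in> reachable \<Longrightarrow> (b0, v) \<in> E ^^ lev v"
  using rtrancl_power relpow_gdist by blast

lemma reachable_relpow: "u \<in> reachable \<Longrightarrow> (u, v) \<in> E ^^ n \<Longrightarrow> v \<in> reachable"
  using relpow_imp_rtrancl by (fastforce intro: rtrancl_trans)

text \<open>For unreachable vertices the level is the junk value \<open>LEAST n. False\<close>, which is constant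
  along edges.\<close>

lemma lev_step: "(u, v) \<in> E \<Longrightarrow> lev v \<le> Suc (lev u)"
proof (cases "\<exists>n. (b0, u) \<in> E ^^ n")
  case True
  assume "(u, v) \<in> E"
  then have "(b0, v) \<in> E ^^ Suc (lev u)" using True relpow_gdist by (auto intro: relpow_Suc_I)
  then show ?thesis by (rule gdist_le)
next
  case False
  assume uv: "(u, v) \<in> E"
  have "\<nexists>n. (b0, v) \<in> E ^^ n"
  proof
    assume "\<exists>n. (b0, v) \<in> E ^^ n"
    then obtain n where "(b0, v) \<in> E ^^ n" by blast
    moreover have "(v, u) \<in> E" using uv sym_E by (rule symD[rotated])
    ultimately have "(b0, u) \<in> E ^^ Suc n" by (auto intro: relpow_Suc_I)
    then show False using False by blast
  qed
  then show ?thesis using False by (simp add: gdist_def)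
qed

lemma lev_relpow: "(u, v) \<in> E ^^ n \<Longrightarrow> lev v \<le> lev u + n"
proof (induction n arbitrary: v)
  case (Suc n)
  then obtain z where "(u, z) \<in> E ^^ n" "(z, v) \<in> E" by auto
  then show ?case using Suc.IH[of z] lev_step[of z v] by simp
qed simp

definition geodesic :: "(nat \<Rightarrow> 'v) \<Rightarrow> nat \<Rightarrow> bool" where
  "geodesic \<gamma> h \<longleftrightarrow> \<gamma> 0 = b0 \<and> (\<forall>t<h. (\<gamma> t, \<gamma> (Suc t)) \<in> E) \<and> (\<forall>t\<le>h. lev (\<gamma> t) = t)"

text \<open>The hypothesis on \<open>x\<close> says that \<open>v\<close> lies on a geodesic from
  \<open>b0\<close> to \<open>x\<close>. A shortest path to \<open>v\<close> and one from
  \<open>v\<close> to \<open>x\<close> are joined, and the levels along the result are forced by the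
  distances to its two ends.\<close>

lemma geodesic_through:
  assumes v: "v \<in> reachable" and vx: "(v, x) \<in> E ^^ (lev x - lev v)" "lev v \<le> lev x"
  shows "\<exists>\<gamma>. geodesic \<gamma> (lev x) \<and> \<gamma> (lev v) = v \<and> \<gamma> (lev x) = x"
proof -
  obtain f where f: "f 0 = b0" "f (lev v) = v" "\<And>i. i < lev v \<Longrightarrow> (f i, f (Suc i)) \<in> E"
    using relpow_lev[OF v] unfolding relpow_fun_conv by blast
  obtain g where g: "g 0 = v" "g (lev x - lev v) = x" "\<And>i. i < lev x - lev v \<Longrightarrow> (g i, g (Suc i)) \<in> E"
    using vx(1) unfolding relpow_fun_conv by blast
  define \<gamma> where "\<gamma> t = (if t \<le> lev v then f t else g (t - lev v))" for t
  have st: "(\<gamma> t, \<gamma> (Suc t)) \<in> E" if "t < lev x" for t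
  proof (cases "t < lev v")
    case True
    then show ?thesis using f(3) by (simp add: \<gamma>_def)
  next
    case False
    then have "\<gamma> t = g (t - lev v)" "\<gamma> (Suc t) = g (Suc (t - lev v))"
      using f(2) g(1) by (auto simp: \<gamma>_def Suc_diff_le)
    then show ?thesis using g(3)[of "t - lev v"] that False by simp
  qed
  have "\<gamma> (lev x) = x"
  proof (cases "lev x = lev v")
    case True
    then have "x = v" using g(1,2) by simp
    then show ?thesis using f(2) by (simp add: \<gamma>_def)
  next
    case False
    then show ?thesis using g(2) vx(2) by (simp add: \<gamma>_def)
  qed
  moreover have "\<gamma> 0 = b0" "\<gamma> (lev v) = v" using f(1,2) by (simp_all add: \<gamma>_def)
  ultimately have ends: "\<gamma> 0 = b0" "\<gamma> (lev v) = v" "\<gamma> (lev x) = x" by blast+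
  have up: "(\<gamma> s, \<gamma> t) \<in> E ^^ (t - s)" if "s \<le> t" "t \<le> lev x" for s t
    using that
  proof (induction t rule: dec_induct)
    case (step t)
    then have "(\<gamma> s, \<gamma> (Suc t)) \<in> E ^^ Suc (t - s)" using st[of t] by (auto intro: relpow_Suc_I)
    then show ?case using step.hyps by (simp add: Suc_diff_le)
  qed simp
  have "lev (\<gamma> t) = t" if "t \<le> lev x" for t
    using gdist_le[OF up[of 0 t, unfolded ends]] lev_relpow[OF up[of t "lev x", unfolded ends]] that
    by simp
  then show ?thesis using st ends by (intro exI[of _ \<gamma>]) (auto simp: geodesic_def)
qed

lemma geodesic_walk:
  assumes "geodesic \<gamma> h" "a \<le> b" "b \<le> h"
  shows "walk E (\<gamma> a) (map (\<lambda>t. (\<gamma> t, \<gamma> (Suc t))) [a..<b]) (\<gamma> b)"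
  using assms(2,3)
proof (induction b rule: dec_induct)
  case (step b)
  then have "(\<gamma> b, \<gamma> (Suc b)) \<in> E" using assms(1) by (simp add: geodesic_def)
  then show ?case using step by (auto simp: walk_append)
qed simp

lemma geodesic_relpow:
  assumes "geodesic \<gamma> h" "a \<le> b" "b \<le> h"
  shows "(\<gamma> a, \<gamma> b) \<in> E ^^ (b - a)"
  unfolding relpow_iff_walk using geodesic_walk[OF assms]
  by (intro exI[of _ "map (\<lambda>t. (\<gamma> t, \<gamma> (Suc t))) [a..<b]"]) simp

lemma geodesic_reachable:
  assumes "geodesic \<gamma> h" "t \<le> h"
  shows "\<gamma> t \<in> reachable"
proof -
  have "(b0, \<gamma> t) \<in> E ^^ t" using geodesic_relpow[OF assms(1), of 0 t] assms by (simp add: geodesic_def)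
  then show ?thesis using relpow_imp_rtrancl by blast
qed

text \<open>Levels increase by one along a geodesic, so it crosses the sphere at \<open>t\<close> in
  a single edge.\<close>

lemma cut_flow_geodesic:
  assumes \<gamma>: "geodesic \<gamma> h" and ab: "a \<le> t" "t < b" "b \<le> h"
  shows "cochain_sum (cut_flow (\<lambda>v. t < lev v) Q) (map (\<lambda>t. (\<gamma> t, \<gamma> (Suc t))) [a..<b])
    = (if (\<gamma> t, \<gamma> (Suc t)) \<in> Q then 1 else 0)"
proof -
  let ?\<phi> = "cut_flow (\<lambda>v. t < lev v) Q"
  let ?p = "\<lambda>a b. map (\<lambda>t. (\<gamma> t, \<gamma> (Suc t))) [a..<b]"
  have "[a..<b] = [a..<t] @ t # [Suc t..<b]"
    using ab upt_add_eq_append[of a t "b - t"] by (simp add: upt_conv_Cons)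
  then have "cochain_sum ?\<phi> (?p a b)
      = cochain_sum ?\<phi> (?p a t) + ?\<phi> (\<gamma> t) (\<gamma> (Suc t)) + cochain_sum ?\<phi> (?p (Suc t) b)"
    by simp
  also have "cochain_sum ?\<phi> (?p a t) = 0"
    using \<gamma> ab by (intro cochain_sum_eq_0) (auto simp: geodesic_def cut_flow_def)
  also have "cochain_sum ?\<phi> (?p (Suc t) b) = 0"
    using \<gamma> ab by (intro cochain_sum_eq_0) (auto simp: geodesic_def cut_flow_def)
  also have "?\<phi> (\<gamma> t) (\<gamma> (Suc t)) = (if (\<gamma> t, \<gamma> (Suc t)) \<in> Q then 1 else 0)"
    using \<gamma> ab by (simp add: geodesic_def cut_flow_def)
  finally show ?thesis by simp
qed

lemma walk_levels:
  assumes "walk E u ds v" "d \<in> set ds"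
  shows "lev (fst d) \<le> lev u + length ds" "lev (snd d) \<le> lev u + length ds"
    "lev u \<le> lev (fst d) + length ds" "lev u \<le> lev (snd d) + length ds"
proof -
  obtain c1 c2 where c: "walk E u c1 (fst d)" "length c1 < length ds" "walk E u c2 (snd d)" "length c2 \<le> length ds"
    using walk_vertex[OF assms] by blast
  have "(u, fst d) \<in> E ^^ length ds" "(u, snd d) \<in> E ^^ length ds"
    using c relpow_iff_walk relpow_E_mono less_imp_le by metis+
  then show "lev (fst d) \<le> lev u + length ds" "lev (snd d) \<le> lev u + length ds"
    "lev u \<le> lev (fst d) + length ds" "lev u \<le> lev (snd d) + length ds"
    using lev_relpow relpow_E_sym by blast+
qed

text \<open>The quadrilateral spanned by two geodesics and two connecting walks crosses an
  intermediate level in exactly two edges; by conservation of flow they are linked in any filling.\<close>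

lemma bigon_linkage:
  assumes \<gamma>: "geodesic \<gamma> h" and \<gamma>': "geodesic \<gamma>' h'" and ab: "a \<le> b" "b \<le> h" "b \<le> h'"
    and p: "(\<gamma> a, \<gamma>' a) \<in> E ^^ p" and q: "(\<gamma> b, \<gamma>' b) \<in> E ^^ q"
  shows "\<exists>cs. set cs \<subseteq> Z \<and> length cs \<le> C * (2 * (b - a) + p + q + 2) \<and>
    (\<forall>t. a + p \<le> t \<and> t + q < b \<longrightarrow>
      ((\<gamma> t, \<gamma> (Suc t)), (\<gamma>' t, \<gamma>' (Suc t))) \<in> (linkage (\<lambda>v. t < lev v) cs)\<^sup>*)"
proof -
  let ?g = "map (\<lambda>t. (\<gamma> t, \<gamma> (Suc t))) [a..<b]" and ?g' = "map (\<lambda>t. (\<gamma>' t, \<gamma>' (Suc t))) [a..<b]"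
  obtain wp where wp: "walk E (\<gamma> a) wp (\<gamma>' a)" "length wp = p" using p relpow_iff_walk by metis
  obtain wq where wq: "walk E (\<gamma> b) wq (\<gamma>' b)" "length wq = q" using q relpow_iff_walk by metis
  define w where "w = ?g @ wq @ reverse_walk ?g' @ reverse_walk wp"
  have w: "walk E (\<gamma> a) w (\<gamma> a)"
    unfolding w_def
    by (rule walk_appendI[OF geodesic_walk[OF \<gamma> ab(1,2)] walk_appendI[OF wq(1) walk_appendI[OF
        walk_reverse[OF sym_E geodesic_walk[OF \<gamma>' ab(1,3)]] walk_reverse[OF sym_E wp(1)]]]])
  have len: "length w = 2 * (b - a) + p + q" by (simp add: w_def wp wq)
  have "(b0, \<gamma> a) \<in> E\<^sup>*" using geodesic_reachable[OF \<gamma>, of a] ab by simp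
  then obtain cs where cs: "set cs \<subseteq> Z" "length cs \<le> C * (length w + 2)"
    and fill_w: "\<And>\<phi>. antisymmetric \<phi> \<Longrightarrow> cochain_sum \<phi> w = (\<Sum>c\<leftarrow>cs. cochain_sum \<phi> c)"
    using fill[OF _ w] by blast
  have "((\<gamma> t, \<gamma> (Suc t)), (\<gamma>' t, \<gamma>' (Suc t))) \<in> (linkage (\<lambda>v. t < lev v) cs)\<^sup>*"
    if t: "a + p \<le> t" "t + q < b" for t
  proof (rule ccontr)
    assume no: "\<not> ?thesis"
    let ?Q = "(linkage (\<lambda>v. t < lev v) cs)\<^sup>* `` {(\<gamma> t, \<gamma> (Suc t))}"
    let ?\<phi> = "cut_flow (\<lambda>v. t < lev v) ?Q"
    have 1: "cochain_sum ?\<phi> ?g = 1" using cut_flow_geodesic[OF \<gamma>, of a t b ?Q] t ab by simp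
    have 2: "cochain_sum ?\<phi> ?g' = 0" using cut_flow_geodesic[OF \<gamma>', of a t b ?Q] t ab no by auto
    \<comment> \<open>The connecting walks avoid the cut: \<open>wq\<close> is too short to descend
      to level \<open>t\<close>, and \<open>wp\<close> is too short to rise above it.\<close>
    have 3: "cochain_sum ?\<phi> wq = 0"
    proof (rule cochain_sum_eq_0)
      fix u v assume "(u, v) \<in> set wq"
      then have "b \<le> lev u + q" "b \<le> lev v + q"
        using walk_levels(3,4)[OF wq(1), of "(u, v)"] wq(2) \<gamma> ab by (simp_all add: geodesic_def)
      then show "?\<phi> u v = 0" using t by (simp add: cut_flow_def)
    qed
    have 4: "cochain_sum ?\<phi> wp = 0"
    proof (rule cochain_sum_eq_0)
      fix u v assume "(u, v) \<in> set wp"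
      then have "lev u \<le> a + p" "lev v \<le> a + p"
        using walk_levels(1,2)[OF wp(1), of "(u, v)"] wp(2) \<gamma> ab by (simp_all add: geodesic_def)
      then show "?\<phi> u v = 0" using t by (simp add: cut_flow_def)
    qed
    have "cochain_sum ?\<phi> w = 1"
      by (simp only: w_def cochain_sum_simps cochain_sum_reverse[OF antisymmetric_cut_flow] 1 2 3 4)
    moreover have "cochain_sum ?\<phi> w = 0" by (rule linked_cut_flow_eq_0[OF cs(1) fill_w])
    ultimately show False by simp
  qed
  then show ?thesis using cs len by (intro exI[of _ cs]) auto
qed

text \<open>An edge crosses at most one sphere, so a cell meets at most as many spheres as it has
  edges.\<close>

lemma sum_crossing_count:
  assumes "set cs \<subseteq> Z" "finite T"
  shows "(\<Sum>t\<in>T. crossing_count (\<lambda>v. t < lev v) cs) \<le> M * length cs"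
  using assms(1)
proof (induction cs)
  case (Cons c cs)
  let ?U = "\<lambda>t. up_edges (\<lambda>v. t < lev v) c"
  have "{t\<in>T. ?U t \<noteq> {}} \<subseteq> (\<lambda>(u, v). min (lev u) (lev v)) ` set c"
  proof
    fix t assume "t \<in> {t\<in>T. ?U t \<noteq> {}}"
    then obtain u v where "(u, v) \<in> ?U t" by fastforce
    then have uv: "(u, v) \<in> set c \<or> (v, u) \<in> set c" "lev u \<le> t" "t < lev v"
      by (auto simp: up_edges_def sup_edges_def)
    have "(u, v) \<in> E" using cell_edges[of c] \<open>(u, v) \<in> ?U t\<close> Cons.prems by (auto simp: up_edges_def)
    then have "min (lev u) (lev v) = t" "min (lev v) (lev u) = t" using lev_step[of u v] uv by auto
    then show "t \<in> (\<lambda>(u, v). min (lev u) (lev v)) ` set c"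
      using uv(1) by (auto simp: image_iff intro: bexI[of _ "(u, v)"] bexI[of _ "(v, u)"])
  qed
  then have "card {t\<in>T. ?U t \<noteq> {}} \<le> card ((\<lambda>(u, v). min (lev u) (lev v)) ` set c)"
    by (intro card_mono) auto
  also have "\<dots> \<le> card (set c)" by (rule card_image_le) simp
  also have "\<dots> \<le> M" using card_length[of c] cell_length[of c] Cons.prems by simp
  finally have "card {t\<in>T. ?U t \<noteq> {}} \<le> M" .
  moreover have "(\<Sum>t\<in>T. crossing_count (\<lambda>v. t < lev v) (c # cs))
      = (\<Sum>t\<in>T. if ?U t \<noteq> {} then 1 else 0) + (\<Sum>t\<in>T. crossing_count (\<lambda>v. t < lev v) cs)"
    unfolding sum.distrib[symmetric] by (intro sum.cong HOL.refl) (simp add: crossing_count_def)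
  moreover have "(\<Sum>t\<in>T. if ?U t \<noteq> {} then 1 else 0) = card {t\<in>T. ?U t \<noteq> {}}"
    using assms(2) by (simp add: sum.If_cases Int_def)
  ultimately show ?case using Cons by simp
qed (simp add: crossing_count_def)

text \<open>In order: \<open>2 * M\<close> for the distance covered by a cell step,
  \<open>M * M\<close> for the linked pairs of a cell, \<open>M\<close> for the levels that it
  meets, and \<open>C\<close> from the isoperimetric inequality.\<close>

definition filling_const :: nat where "filling_const = 2 * M * (M * M) * (M * C)"

lemma bigon_sum:
  assumes \<gamma>: "geodesic \<gamma> h" and \<gamma>': "geodesic \<gamma>' h'" and ab: "a \<le> b" "b \<le> h" "b \<le> h'"
    and p: "(\<gamma> a, \<gamma>' a) \<in> E ^^ p" and q: "(\<gamma> b, \<gamma>' b) \<in> E ^^ q"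
  shows "(\<Sum>t\<in>{a + p..<b - q}. gdist (\<gamma> t) (\<gamma>' t)) \<le> filling_const * (2 * (b - a) + p + q + 2)"
proof -
  obtain cs where cs: "set cs \<subseteq> Z" "length cs \<le> C * (2 * (b - a) + p + q + 2)"
    and link: "\<And>t. a + p \<le> t \<Longrightarrow> t + q < b \<Longrightarrow>
      ((\<gamma> t, \<gamma> (Suc t)), (\<gamma>' t, \<gamma>' (Suc t))) \<in> (linkage (\<lambda>v. t < lev v) cs)\<^sup>*"
    using bigon_linkage[OF assms] by blast
  have "gdist (\<gamma> t) (\<gamma>' t) \<le> 2 * M * (M * M) * crossing_count (\<lambda>v. t < lev v) cs"
    if tab: "t \<in> {a + p..<b - q}" for t
  proof -
    have t: "a + p \<le> t" "t + q < b" using tab by auto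
    obtain k where k: "k \<le> M * M * crossing_count (\<lambda>v. t < lev v) cs"
      "((\<gamma> t, \<gamma> (Suc t)), (\<gamma>' t, \<gamma>' (Suc t))) \<in> cell_adjacent Z ^^ k"
      using linkage_steps[OF cs(1) link[OF t]] by blast
    have "gdist (\<gamma> t) (\<gamma>' t) \<le> 2 * M * k"
      using cell_adjacent_steps_distance[OF k(2)] by (intro gdist_le) simp
    also have "\<dots> \<le> 2 * M * (M * M * crossing_count (\<lambda>v. t < lev v) cs)"
      using k(1) by (rule mult_le_mono2)
    finally show ?thesis by (simp only: mult.assoc)
  qed
  then have "(\<Sum>t\<in>{a + p..<b - q}. gdist (\<gamma> t) (\<gamma>' t))
      \<le> (\<Sum>t\<in>{a + p..<b - q}. 2 * M * (M * M) * crossing_count (\<lambda>v. t < lev v) cs)"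
    by (rule sum_mono)
  also have "\<dots> = 2 * M * (M * M) * (\<Sum>t\<in>{a + p..<b - q}. crossing_count (\<lambda>v. t < lev v) cs)"
    by (simp add: sum_distrib_left)
  also have "\<dots> \<le> 2 * M * (M * M) * (M * length cs)"
    by (intro mult_le_mono2 sum_crossing_count[OF cs(1)]) simp
  also have "\<dots> \<le> 2 * M * (M * M) * (M * (C * (2 * (b - a) + p + q + 2)))"
    by (intro mult_le_mono2 cs)
  finally show ?thesis by (simp only: filling_const_def mult.assoc)
qed

text \<open>While two geodesics are more than \<open>thinness\<close> apart, the sum in \<open>bigon_sum\<close> grows faster than its bound.\<close>

definition thinness :: nat where "thinness = 4 * filling_const + 1"

lemma bigon_gap:
  assumes \<gamma>: "geodesic \<gamma> h" and \<gamma>': "geodesic \<gamma>' h'" and ab: "a \<le> b" "b \<le> h" "b \<le> h'"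
    and p: "(\<gamma> a, \<gamma>' a) \<in> E ^^ p" and q: "(\<gamma> b, \<gamma>' b) \<in> E ^^ q"
    and far: "\<And>t. a < t \<Longrightarrow> t < b \<Longrightarrow> thinness < gdist (\<gamma> t) (\<gamma>' t)"
  shows "b - a \<le> 3 * (p + q) + 4"
proof -
  \<comment> \<open>\<open>far\<close> starts strictly above \<open>a\<close>, so for
    \<open>p = 0\<close> the sum has to start one level higher; \<open>p\<close> is therefore raised
    by one.\<close>
  define r where "r = Suc p + q"
  define n where "n = b - a"
  have "card {a + Suc p..<b - q} * thinness \<le> (\<Sum>t\<in>{a + Suc p..<b - q}. gdist (\<gamma> t) (\<gamma>' t))"
    by (rule order_trans[OF _ sum_bounded_below[where K = thinness]]) (use far in \<open>auto intro!: less_imp_le\<close>)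
  also have "\<dots> \<le> filling_const * (2 * (b - a) + Suc p + q + 2)"
    by (rule bigon_sum[OF \<gamma> \<gamma>' ab relpow_E_mono[OF _ p] q]) simp
  finally have "(n - r) * (4 * filling_const + 1) \<le> filling_const * (2 * n + r + 2)"
    by (simp add: n_def r_def thinness_def add_ac)
  then have "n * (4 * filling_const + 1) \<le> filling_const * (2 * n + r + 2) + r * (4 * filling_const + 1)"
    by (simp add: diff_mult_distrib)
  \<comment> \<open>The sum of distances grows in \<open>n\<close> with slope
    \<open>4 * filling_const + 1\<close> and its bound with slope \<open>2 * filling_const\<close>;
    the difference bounds \<open>n\<close> in terms of the ends.\<close>
  then have "n * (2 * filling_const + 1) \<le> 5 * (filling_const * r) + 2 * filling_const + r" by (simp add: algebra_simps)
  also have "\<dots> \<le> (3 * r + 1) * (2 * filling_const + 1)" by (simp add: algebra_simps)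
  finally have "n \<le> 3 * r + 1" by (simp only: mult_le_cancel2)
  then show ?thesis by (simp add: n_def r_def)
qed

text \<open>The order of the quantifiers matters: the depth \<open>L\<close> may depend on the
  distance \<open>n\<close> of the endpoints, but \<open>k0\<close> may not. Well below the ends,
  levels at which the geodesics are \<open>thinness\<close> close recur with bounded gaps by
  \<open>bigon_gap\<close>, and the quadrilateral between two such levels around \<open>t\<close>
  has a filling of bounded size.\<close>

lemma geodesics_linked:
  "\<exists>k0. \<forall>n. \<exists>L. \<forall>\<gamma> \<gamma>' h h' t. geodesic \<gamma> h \<longrightarrow> geodesic \<gamma>' h' \<longrightarrow> (\<gamma> h, \<gamma>' h') \<in> E ^^ n \<longrightarrow>
     t + L \<le> h \<longrightarrow> t + L \<le> h' \<longrightarrow>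
     (\<exists>k\<le>k0. ((\<gamma> t, \<gamma> (Suc t)), (\<gamma>' t, \<gamma>' (Suc t))) \<in> cell_adjacent Z ^^ k)"
proof -
  \<comment> \<open>The bracketing levels found below satisfy
    \<open>b - a \<le> 14 * thinness + 9\<close>, and the sides there have length at most
    \<open>thinness\<close>.\<close>
  define k0 where "k0 = M * M * (C * (2 * (14 * thinness + 9) + thinness + thinness + 2))"
  have "\<exists>k\<le>k0. ((\<gamma> t, \<gamma> (Suc t)), (\<gamma>' t, \<gamma>' (Suc t))) \<in> cell_adjacent Z ^^ k"
    if \<gamma>: "geodesic \<gamma> h" and \<gamma>': "geodesic \<gamma>' h'" and ends: "(\<gamma> h, \<gamma>' h') \<in> E ^^ n"
      and t: "t + (thinness + 1 + (3 * (thinness + 2 * n) + 5)) \<le> h" "t + (thinness + 1 + (3 * (thinness + 2 * n) + 5)) \<le> h'"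
    for n \<gamma> \<gamma>' h h' t
  proof -
    define T where "T = min h h'"
    have Th: "T \<le> h" "T \<le> h'" by (auto simp: T_def)
    have levs: "lev (\<gamma> h) = h" "lev (\<gamma>' h') = h'" using \<gamma> \<gamma>' by (auto simp: geodesic_def)
    have hh: "h' \<le> h + n" "h \<le> h' + n"
      using lev_relpow[OF ends] lev_relpow[OF relpow_E_sym[OF ends]] levs by auto
    have top: "(\<gamma> T, \<gamma>' T) \<in> E ^^ (2 * n)"
    proof (rule relpow_E_mono)
      have "(\<gamma> T, \<gamma> h) \<in> E ^^ (h - T)" by (rule geodesic_relpow[OF \<gamma>]) (auto simp: T_def)
      moreover have "(\<gamma>' h', \<gamma>' T) \<in> E ^^ (h' - T)"
        by (rule relpow_E_sym[OF geodesic_relpow[OF \<gamma>']]) (auto simp: T_def)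
      ultimately show "(\<gamma> T, \<gamma>' T) \<in> E ^^ (h - T + (n + (h' - T)))"
        using ends by (intro relpow_E_trans)
      show "h - T + (n + (h' - T)) \<le> 2 * n" using hh by (auto simp: T_def)
    qed
    define good where "good s \<longleftrightarrow> s \<le> T \<and> (\<gamma> s, \<gamma>' s) \<in> E ^^ thinness" for s
    have rel: "\<exists>n. (\<gamma> s, \<gamma>' s) \<in> E ^^ n" if "s \<le> T" for s
    proof -
      have "(b0, \<gamma> s) \<in> E ^^ s" "(b0, \<gamma>' s) \<in> E ^^ s"
        using geodesic_relpow[OF \<gamma>, of 0 s] geodesic_relpow[OF \<gamma>', of 0 s] that Th \<gamma> \<gamma>'
        by (simp_all add: geodesic_def)
      then show ?thesis using relpow_E_trans relpow_E_sym by blast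
    qed
    have bad: "thinness < gdist (\<gamma> s) (\<gamma>' s)" if "\<not> good s" "s \<le> T" for s
    proof (rule ccontr)
      assume "\<not> thinness < gdist (\<gamma> s) (\<gamma>' s)"
      then have "gdist (\<gamma> s) (\<gamma>' s) \<le> thinness" by simp
      then have "(\<gamma> s, \<gamma>' s) \<in> E ^^ thinness" using relpow_gdist rel[OF that(2)] relpow_E_mono by blast
      then show False using that by (simp add: good_def)
    qed
    have good0: "good 0" unfolding good_def
      using relpow_E_mono[of 0 thinness b0 b0] \<gamma> \<gamma>' by (simp add: geodesic_def)
    have below: "\<exists>a. good a \<and> a \<le> s \<and> (\<forall>u. a < u \<and> u \<le> s \<longrightarrow> \<not> good u)" for s
    proof -
      let ?A = "{a. good a \<and> a \<le> s}"
      have A: "finite ?A" "?A \<noteq> {}" using good0 by auto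
      have "Max ?A \<in> ?A" by (rule Max_in[OF A])
      moreover have "u \<le> Max ?A" if "good u" "u \<le> s" for u using A that by (intro Max_ge) auto
      ultimately show ?thesis by (intro exI[of _ "Max ?A"]) (auto simp: not_le[symmetric])
    qed
    \<comment> \<open>Above the last good level the geodesics stay far apart up to \<open>T\<close>,
      where they are \<open>2 * n\<close> close again, so this gap is short.\<close>
    have later: "\<exists>b. good b \<and> s \<le> b" if s: "s + (3 * (thinness + 2 * n) + 4) < T" for s
    proof (rule ccontr)
      assume no: "\<not> ?thesis"
      obtain a where a: "good a" "a \<le> s" "\<And>u. a < u \<Longrightarrow> u \<le> s \<Longrightarrow> \<not> good u" using below by blast
      have "T - a \<le> 3 * (thinness + 2 * n) + 4"
      proof (rule bigon_gap[OF \<gamma> \<gamma>' _ Th _ top])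
        show "a \<le> T" "(\<gamma> a, \<gamma>' a) \<in> E ^^ thinness" using a by (auto simp: good_def)
        fix u assume "a < u" "u < T"
        then show "thinness < gdist (\<gamma> u) (\<gamma>' u)" using a(3) no bad by (meson less_imp_le nat_le_linear)
      qed
      then show False using a s by linarith
    qed
    have near: "\<exists>a b. good a \<and> good b \<and> a \<le> s \<and> s \<le> b \<and> b \<le> a + (6 * thinness + 4)"
      if s: "s + (3 * (thinness + 2 * n) + 4) < T" for s
    proof -
      obtain a where a: "good a" "a \<le> s" "\<And>u. a < u \<Longrightarrow> u \<le> s \<Longrightarrow> \<not> good u" using below by blast
      define b where "b = (LEAST b. good b \<and> s \<le> b)"
      have b: "good b" "s \<le> b" unfolding b_def using LeastI_ex[OF later[OF s]] by auto
      have b': "\<not> good u" if "s \<le> u" "u < b" for u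
        using not_less_Least[of u "\<lambda>b. good b \<and> s \<le> b"] that by (auto simp: b_def)
      have "b - a \<le> 3 * (thinness + thinness) + 4"
      proof (rule bigon_gap[OF \<gamma> \<gamma>'])
        show "a \<le> b" "b \<le> h" "b \<le> h'" "(\<gamma> a, \<gamma>' a) \<in> E ^^ thinness" "(\<gamma> b, \<gamma>' b) \<in> E ^^ thinness"
          using a b Th by (auto simp: good_def)
        fix u assume u: "a < u" "u < b"
        then have "\<not> good u" using a(3) b' by (meson nat_le_linear)
        then show "thinness < gdist (\<gamma> u) (\<gamma>' u)" using u b bad by (auto simp: good_def)
      qed
      then show ?thesis using a b by (intro exI[of _ a] exI[of _ b]) auto
    qed
    have tT: "t + (thinness + 1 + (3 * (thinness + 2 * n) + 5)) \<le> T" using t by (simp add: T_def)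
    \<comment> \<open>The brackets keep the distance \<open>thinness\<close> from \<open>t\<close>,
      so that the short sides do not reach its level. The upper one is one level further because
      \<open>bigon_linkage\<close> asks for \<open>t + q < b\<close>.\<close>
    obtain b where b: "good b" "t + thinness + 1 \<le> b" "b \<le> t + thinness + 1 + (6 * thinness + 4)"
      using near[of "t + thinness + 1"] tT by fastforce
    have "\<exists>a p. (\<gamma> a, \<gamma>' a) \<in> E ^^ p \<and> p \<le> thinness \<and> a + p \<le> t \<and> t \<le> a + (7 * thinness + 4)"
    proof (cases "t < thinness")
      \<comment> \<open>Close to \<open>b0\<close> there is no room for a lower bracket, but the
        geodesics agree at level \<open>0\<close>.\<close>
      case True
      then show ?thesis using \<gamma> \<gamma>' by (intro exI[of _ 0]) (auto simp: geodesic_def)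
    next
      case False
      then obtain a where "good a" "a \<le> t - thinness" "t - thinness \<le> a + (6 * thinness + 4)"
        using near[of "t - thinness"] tT by fastforce
      then show ?thesis using False by (intro exI[of _ a] exI[of _ thinness]) (auto simp: good_def)
    qed
    then obtain a p where a: "(\<gamma> a, \<gamma>' a) \<in> E ^^ p" "p \<le> thinness" "a + p \<le> t" "t \<le> a + (7 * thinness + 4)"
      by blast
    have ab: "a \<le> b" "b \<le> h" "b \<le> h'" "(\<gamma> b, \<gamma>' b) \<in> E ^^ thinness"
      using a b Th by (auto simp: good_def)
    obtain cs where cs: "set cs \<subseteq> Z" "length cs \<le> C * (2 * (b - a) + p + thinness + 2)"
      and link: "((\<gamma> t, \<gamma> (Suc t)), (\<gamma>' t, \<gamma>' (Suc t))) \<in> (linkage (\<lambda>v. t < lev v) cs)\<^sup>*"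
      using bigon_linkage[OF \<gamma> \<gamma>' ab(1-3) a(1) ab(4)] a b by fastforce
    obtain k where k: "k \<le> M * M * crossing_count (\<lambda>v. t < lev v) cs"
      "((\<gamma> t, \<gamma> (Suc t)), (\<gamma>' t, \<gamma>' (Suc t))) \<in> cell_adjacent Z ^^ k"
      using linkage_steps[OF cs(1) link] by blast
    have "crossing_count (\<lambda>v. t < lev v) cs \<le> length cs" by (simp add: crossing_count_def)
    also note cs(2)
    also have "C * (2 * (b - a) + p + thinness + 2) \<le> C * (2 * (14 * thinness + 9) + thinness + thinness + 2)"
      using a b by (intro mult_le_mono2 add_mono) auto
    finally have "k \<le> k0" unfolding k0_def using k(1) mult_le_mono2 le_trans by blast
    then show ?thesis using k(2) by blast
  qed
  then show ?thesis by blast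
qed

end

subsection \<open>Slices of geodesics\<close>

context fine_graph
begin

text \<open>The truncation of the levels is essential: it makes the slice equal to \<open>{b0}\<close> when \<open>x\<close> is close
  to the base point, where geodesics to nearby points need not be linked.\<close>

definition slice :: "nat \<Rightarrow> 'v \<Rightarrow> nat \<Rightarrow> 'v set" where
  "slice L x k = {v \<in> reachable. lev v \<le> lev x + k - L \<and> lev x \<le> lev v + L + k \<and>
     (\<exists>y. (x, y) \<in> E ^^ k \<and> lev v \<le> lev y \<and> (v, y) \<in> E ^^ (lev y - lev v))}"

text \<open>\<open>k\<close> enters all conditions on levels and endpoints, so that widening by
  \<open>m\<close> absorbs the change of the centre.\<close>

lemma slice_mono:
  assumes xy: "(x, y) \<in> E ^^ m"
  shows "slice L x k \<subseteq> slice L y (k + m)"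
proof
  fix v assume v: "v \<in> slice L x k"
  then obtain z where z: "(x, z) \<in> E ^^ k" "lev v \<le> lev z" "(v, z) \<in> E ^^ (lev z - lev v)"
    by (auto simp: slice_def)
  have "(y, z) \<in> E ^^ (k + m)"
    using relpow_E_trans[OF relpow_E_sym[OF xy] z(1)] by (simp add: add.commute)
  moreover have "lev x \<le> lev y + m" "lev y \<le> lev x + m"
    using lev_relpow[OF xy] lev_relpow[OF relpow_E_sym[OF xy]] by auto
  ultimately show "v \<in> slice L y (k + m)" using v z(2,3) by (auto simp: slice_def)
qed

lemma slice_nonempty:
  assumes x: "x \<in> reachable"
  shows "slice L x k \<noteq> {}"
proof -
  obtain \<gamma> where \<gamma>: "geodesic \<gamma> (lev x)" "\<gamma> (lev x) = x" using geodesic_through[OF x, of x] by auto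
  let ?v = "\<gamma> (lev x - L)"
  have lev: "lev ?v = lev x - L" using \<gamma>(1) by (simp add: geodesic_def)
  have "?v \<in> reachable" using geodesic_reachable[OF \<gamma>(1)] by simp
  moreover have "(?v, x) \<in> E ^^ (lev x - lev ?v)"
    unfolding lev using geodesic_relpow[OF \<gamma>(1), of "lev x - L" "lev x"] \<gamma>(2) by simp
  moreover have "(x, x) \<in> E ^^ k" using relpow_E_mono[of 0 k x x] by simp
  ultimately have "?v \<in> slice L x k" unfolding slice_def using lev by (auto intro!: exI[of _ x])
  then show ?thesis by blast
qed

lemma slice_bounded:
  assumes v: "v \<in> slice L x k"
  shows "(x, v) \<in> E ^^ (L + 3 * k)"
proof -
  obtain z where z: "(x, z) \<in> E ^^ k" "lev v \<le> lev z" "(v, z) \<in> E ^^ (lev z - lev v)"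
    using v by (auto simp: slice_def)
  have "lev z \<le> lev x + k" by (rule lev_relpow[OF z(1)])
  moreover have "lev x \<le> lev v + L + k" using v by (simp add: slice_def)
  ultimately have "k + (lev z - lev v) \<le> L + 3 * k" by linarith
  then show ?thesis
    by (rule relpow_E_mono[OF _ relpow_E_trans[OF z(1) relpow_E_sym[OF z(3)]]])
qed

text \<open>A point of a slice lies on a geodesic that ends near \<open>x\<close>, hence is linked
  to a fixed geodesic to \<open>x\<close> at its own level by at most \<open>k0\<close> cell steps.
  The window has at most \<open>2 * k + 1\<close> levels, and \<open>D\<close> bounds the points of
  each independently of \<open>n\<close>. The summand \<open>1\<close> counts
  \<open>b0\<close>.\<close>

lemma slice_card:
  "\<exists>D. \<forall>n. \<exists>L. \<forall>x\<in>reachable. \<forall>k\<le>n. finite (slice L x k) \<and> card (slice L x k) \<le> 1 + (2 * n + 1) * D"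
proof -
  obtain k0 where k0: "\<And>n. \<exists>L. \<forall>\<gamma> \<gamma>' h h' t. geodesic \<gamma> h \<longrightarrow> geodesic \<gamma>' h' \<longrightarrow> (\<gamma> h, \<gamma>' h') \<in> E ^^ n \<longrightarrow>
     t + L \<le> h \<longrightarrow> t + L \<le> h' \<longrightarrow>
     (\<exists>k\<le>k0. ((\<gamma> t, \<gamma> (Suc t)), (\<gamma>' t, \<gamma>' (Suc t))) \<in> cell_adjacent Z ^^ k)"
    using geodesics_linked by blast
  define D where "D = (\<Sum>k\<le>k0. N ^ k)"
  have "\<exists>L. \<forall>x\<in>reachable. \<forall>k\<le>n. finite (slice L x k) \<and> card (slice L x k) \<le> 1 + (2 * n + 1) * D" for n
  proof -
    obtain L0 where L0: "\<And>\<gamma> \<gamma>' h h' t. geodesic \<gamma> h \<Longrightarrow> geodesic \<gamma>' h' \<Longrightarrow> (\<gamma> h, \<gamma>' h') \<in> E ^^ n \<Longrightarrow>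
       t + L0 \<le> h \<Longrightarrow> t + L0 \<le> h' \<Longrightarrow>
       (\<exists>k\<le>k0. ((\<gamma> t, \<gamma> (Suc t)), (\<gamma>' t, \<gamma>' (Suc t))) \<in> cell_adjacent Z ^^ k)"
      using k0[of n] by blast
    \<comment> \<open>One \<open>n\<close> pays for the width of the window and the other for the
      drop of level from \<open>x\<close> to \<open>y\<close>.\<close>
    define L where "L = L0 + 2 * n"
    have "finite (slice L x k) \<and> card (slice L x k) \<le> 1 + (2 * n + 1) * D"
      if x: "x \<in> reachable" and k: "k \<le> n" for x k
    proof -
      obtain \<gamma> where \<gamma>: "geodesic \<gamma> (lev x)" "\<gamma> (lev x) = x" using geodesic_through[OF x, of x] by auto
      define B where "B t = fst ` (\<Union>j\<le>k0. (cell_adjacent Z ^^ j) `` {(\<gamma> t, \<gamma> (Suc t))})" for t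
      define I where "I = {lev x - L - k..lev x + k - L}"
      have B: "finite (B t)" "card (B t) \<le> D" for t
      proof -
        have fin: "finite (\<Union>j\<le>k0. (cell_adjacent Z ^^ j) `` {(\<gamma> t, \<gamma> (Suc t))})"
          using card_cell_adjacent_steps by blast
        then show "finite (B t)" by (simp add: B_def)
        have "card (B t) \<le> card (\<Union>j\<le>k0. (cell_adjacent Z ^^ j) `` {(\<gamma> t, \<gamma> (Suc t))})"
          unfolding B_def by (rule card_image_le[OF fin])
        also have "\<dots> \<le> (\<Sum>j\<le>k0. card ((cell_adjacent Z ^^ j) `` {(\<gamma> t, \<gamma> (Suc t))}))"
          by (rule card_UN_le) simp
        also have "\<dots> \<le> D" unfolding D_def using card_cell_adjacent_steps by (intro sum_mono) blast
        finally show "card (B t) \<le> D" .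
      qed
      have sub: "slice L x k \<subseteq> insert b0 (\<Union>t\<in>I. B t)"
      proof
        fix v assume v: "v \<in> slice L x k"
        then have vr: "v \<in> reachable" and lv: "lev v \<le> lev x + k - L" "lev x \<le> lev v + L + k"
          by (auto simp: slice_def)
        obtain y where y: "(x, y) \<in> E ^^ k" "lev v \<le> lev y" "(v, y) \<in> E ^^ (lev y - lev v)"
          using v by (auto simp: slice_def)
        show "v \<in> insert b0 (\<Union>t\<in>I. B t)"
        \<comment> \<open>At level \<open>0\<close> the bound \<open>lev x + k - L\<close> may come
          from truncated subtraction, and the point need not be deep enough for linking.\<close>
        proof (cases "lev v = 0")
          case True
          then show ?thesis using relpow_lev[OF vr] by simp
        next
          case False
          obtain \<gamma>' where \<gamma>': "geodesic \<gamma>' (lev y)" "\<gamma>' (lev v) = v" "\<gamma>' (lev y) = y"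
            using geodesic_through[OF vr y(3,2)] by blast
          have "lev x \<le> lev y + k" using lev_relpow[OF relpow_E_sym[OF y(1)]] by simp
          then have deep: "lev v + L0 \<le> lev x" "lev v + L0 \<le> lev y"
            using False lv(1) k by (auto simp: L_def)
          have "(\<gamma> (lev x), \<gamma>' (lev y)) \<in> E ^^ n"
            using relpow_E_mono[OF k y(1)] \<gamma>(2) \<gamma>'(3) by simp
          then obtain j where "j \<le> k0"
            "((\<gamma> (lev v), \<gamma> (Suc (lev v))), (\<gamma>' (lev v), \<gamma>' (Suc (lev v)))) \<in> cell_adjacent Z ^^ j"
            using L0[OF \<gamma>(1) \<gamma>'(1) _ deep] by blast
          then have "v \<in> B (lev v)" unfolding B_def using \<gamma>'(2) by force
          moreover have "lev v \<in> I" using lv by (auto simp: I_def)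
          ultimately show ?thesis by blast
        qed
      qed
      have fin: "finite (insert b0 (\<Union>t\<in>I. B t))" using B(1) by (auto simp: I_def)
      have "card (slice L x k) \<le> card (insert b0 (\<Union>t\<in>I. B t))" by (rule card_mono[OF fin sub])
      also have "\<dots> \<le> 1 + card (\<Union>t\<in>I. B t)" using card_insert_le_m1 by (simp add: card_insert_if I_def B(1))
      also have "card (\<Union>t\<in>I. B t) \<le> (\<Sum>t\<in>I. card (B t))" by (rule card_UN_le) (simp add: I_def)
      also have "\<dots> \<le> card I * D" using B(2) sum_bounded_above[of I "\<lambda>t. card (B t)" D] by simp
      also have "\<dots> \<le> (2 * n + 1) * D" using k by (intro mult_le_mono1) (auto simp: I_def)
      finally show ?thesis using finite_subset[OF sub fin] by simp
    qed
    then show ?thesis by blast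
  qed
  then show ?thesis by blast
qed

text \<open>Slices of \<open>x\<close> are nested and contained in slightly larger slices of nearby points. As their
  size is at most linear in \<open>n\<close>, they are nearly equal on average over the widths up to \<open>n\<close>.\<close>

lemma almost_invariant_vectors:
  fixes \<epsilon> :: real
  assumes \<epsilon>: "0 < \<epsilon>"
  shows "\<exists>r (\<zeta> :: 'v \<Rightarrow> nat \<times> 'v \<Rightarrow> real). almost_invariant reachable (\<lambda>x y. (x, y) \<in> E ^^ R) \<epsilon> \<zeta> \<and>
    (\<forall>x\<in>reachable. \<forall>e. \<zeta> x e \<noteq> 0 \<longrightarrow> (x, snd e) \<in> E ^^ r)"
proof -
  obtain D where D: "\<And>n. \<exists>L. \<forall>x\<in>reachable. \<forall>k\<le>n. finite (slice L x k) \<and> card (slice L x k) \<le> 1 + (2 * n + 1) * D"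
    using slice_card by blast
  \<comment> \<open>This is the average loss of overlap. It tends to \<open>0\<close> because the
    slices grow linearly in \<open>n\<close>, hence subexponentially.\<close>
  have "(\<lambda>n. ln (1 + (2 * (real n * real R) + 1) * real D) / real n) \<longlonglongrightarrow> 0"
  proof (cases "D = 0")
    case False
    then show ?thesis by (cases "R = 0"; real_asymp)
  qed simp
  then have "\<forall>\<^sub>F n in sequentially. ln (1 + (2 * (real n * real R) + 1) * real D) / real n < \<epsilon>"
    using \<epsilon> by (rule order_tendstoD)
  from eventually_happens'[OF sequentially_bot eventually_conj[OF eventually_gt_at_top[of 0] this]] obtain n where n: "0 < n" "ln (1 + (2 * (real n * real R) + 1) * real D) / real n < \<epsilon>"
    by auto
  obtain L where L: "\<And>x k. x \<in> reachable \<Longrightarrow> k \<le> n * R \<Longrightarrow> finite (slice L x k)"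
    "\<And>x k. x \<in> reachable \<Longrightarrow> k \<le> n * R \<Longrightarrow> card (slice L x k) \<le> 1 + (2 * (n * R) + 1) * D"
    using D[of "n * R"] by blast
  define S where "S x j = slice L x (j * R)" for x j
  have S: "finite (S x j)" "card (S x j) \<le> 1 + (2 * (n * R) + 1) * D" "S x j \<noteq> {}" "0 < card (S x j)"
    if "x \<in> reachable" "j \<le> n" for x j
    using L[of x "j * R"] slice_nonempty[of x L "j * R"] that by (auto simp: S_def card_gt_0_iff)
  \<comment> \<open>An orthogonal sum of \<open>n\<close> normalised indicator functions with equal
    weights.\<close>
  define \<zeta> where "\<zeta> x e = (if 1 \<le> fst e \<and> fst e \<le> n \<and> snd e \<in> S x (fst e)
      then 1 / sqrt (real n * real (card (S x (fst e)))) else 0)" for x e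
  have supp: "{e. \<zeta> x e \<noteq> 0} = (SIGMA j:{1..n}. S x j)" if "x \<in> reachable" for x
    using n(1) S(4)[OF that] by (auto simp: \<zeta>_def)
  have fin: "finite (SIGMA j:{1..n}. S x j)" if "x \<in> reachable" for x using S(1)[OF that] by auto
  have over: "overlap \<zeta> x y = (\<Sum>j\<in>{1..n}. \<Sum>v\<in>S x j. \<zeta> x (j, v) * \<zeta> y (j, v))" if x: "x \<in> reachable" for x y
    unfolding overlap_def supp[OF x] using S(1)[OF x] by (subst sum.Sigma) (auto simp: case_prod_beta)
  have "overlap \<zeta> x x = 1" if x: "x \<in> reachable" for x
  proof -
    have "overlap \<zeta> x x = (\<Sum>j\<in>{1..n}. \<Sum>v\<in>S x j. (\<zeta> x (j, v))\<^sup>2)"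
      by (simp add: over[OF x] power2_eq_square)
    also have "\<dots> = (\<Sum>j\<in>{1..n}. 1 / real n)"
    proof (rule sum.cong[OF HOL.refl])
      fix j assume j: "j \<in> {1..n}"
      have "(\<Sum>v\<in>S x j. (\<zeta> x (j, v))\<^sup>2) = (\<Sum>v\<in>S x j. 1 / (real n * real (card (S x j))))"
        using j by (intro sum.cong) (auto simp: \<zeta>_def power_divide)
      then show "(\<Sum>v\<in>S x j. (\<zeta> x (j, v))\<^sup>2) = 1 / real n" using S(4)[OF x, of j] j by simp
    qed
    finally show ?thesis using n(1) by simp
  qed
  moreover have "(x, snd e) \<in> E ^^ (L + 3 * (n * R))" if "x \<in> reachable" "\<zeta> x e \<noteq> 0" for x e
  proof -
    have "snd e \<in> slice L x (fst e * R)" "fst e \<le> n" using that(2) by (auto simp: \<zeta>_def S_def split: if_splits)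
    then show ?thesis using slice_bounded relpow_E_mono[of "L + 3 * (fst e * R)" "L + 3 * (n * R)"] by simp
  qed
  moreover have "1 - \<epsilon> \<le> overlap \<zeta> x y"
    if x: "x \<in> reachable" and y: "y \<in> reachable" and xy: "(x, y) \<in> E ^^ R" for x y
  proof -
    \<comment> \<open>\<open>m (j - 1)\<close> bounds the intersection of the slices at
      \<open>j\<close> from below, since it contains both slices at \<open>j - 1\<close>;
      \<open>m j\<close> bounds the normalising factor from above.\<close>
    define m where "m j = real (max (card (S x j)) (card (S y j)))" for j
    have m1: "1 \<le> m j" if "j \<le> n" for j using S(4)[OF x that] by (auto simp: m_def)
    note over[OF x, of y]
    moreover have "(1 - ln (m j) + ln (m (j - 1))) / real n \<le> (\<Sum>v\<in>S x j. \<zeta> x (j, v) * \<zeta> y (j, v))"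
      if j: "j \<in> {1..n}" for j
    proof -
      let ?q = "sqrt (real (card (S x j)) * real (card (S y j)))"
      have jn: "j \<le> n" "j - 1 \<le> n" and jR: "(j - 1) * R + R = j * R" "(j - 1) * R + 0 \<le> j * R"
        using j by (auto simp: algebra_simps diff_mult_distrib)
      have nest: "S u (j - 1) \<subseteq> S v j" if "(u, v) \<in> E ^^ R" for u v
        using slice_mono[OF that, of L "(j - 1) * R"] jR(1) by (simp add: S_def)
      have nest': "S u (j - 1) \<subseteq> S u j" for u
        using nest[OF relpow_E_mono[of 0 R u u]] by simp
      have "S x (j - 1) \<subseteq> S x j \<inter> S y j" "S y (j - 1) \<subseteq> S x j \<inter> S y j"
        using nest' nest[OF xy] nest[OF relpow_E_sym[OF xy]] by blast+
      then have "card (S x (j - 1)) \<le> card (S x j \<inter> S y j)" "card (S y (j - 1)) \<le> card (S x j \<inter> S y j)"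
        using S(1)[OF x jn(1)] by (auto intro!: card_mono)
      then have inter: "m (j - 1) \<le> real (card (S x j \<inter> S y j))" by (simp add: m_def)
      have "?q \<le> sqrt (m j * m j)"
        unfolding m_def by (intro real_sqrt_le_mono mult_mono) auto
      then have q: "?q \<le> m j" using m1[OF jn(1)] by simp
      have q0: "0 < ?q" using S(4)[OF x jn(1)] S(4)[OF y jn(1)] by simp
      \<comment> \<open>\<open>ln x \<le> x - 1\<close> turns the sum of the quotients into a
        telescoping sum.\<close>
      have "ln (m (j - 1)) - ln (m j) = ln (m (j - 1) / m j)"
        using m1[OF jn(1)] m1[OF jn(2)] by (simp add: ln_div)
      also have "\<dots> \<le> m (j - 1) / m j - 1"
        using m1[OF jn(1)] m1[OF jn(2)] by (intro ln_le_minus_one) auto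
      finally have "1 - ln (m j) + ln (m (j - 1)) \<le> m (j - 1) / m j" by simp
      also have "\<dots> \<le> m (j - 1) / ?q"
        using q q0 m1[OF jn(2)] m1[OF jn(1)] by (intro divide_left_mono mult_pos_pos) auto
      also have "\<dots> \<le> real (card (S x j \<inter> S y j)) / ?q"
        using inter q0 by (intro divide_right_mono) auto
      finally have "(1 - ln (m j) + ln (m (j - 1))) / real n \<le> real (card (S x j \<inter> S y j)) / ?q / real n"
        by (intro divide_right_mono) auto
      also have "\<dots> = (\<Sum>v\<in>S x j \<inter> S y j. 1 / (real n * ?q))" by simp
      also have "\<dots> = (\<Sum>v\<in>S x j \<inter> S y j. \<zeta> x (j, v) * \<zeta> y (j, v))"
        using j by (intro sum.cong) (auto simp: \<zeta>_def real_sqrt_mult)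
      also have "\<dots> = (\<Sum>v\<in>S x j. \<zeta> x (j, v) * \<zeta> y (j, v))"
        using S(1)[OF x jn(1)] by (intro sum.mono_neutral_left) (auto simp: \<zeta>_def)
      finally show ?thesis .
    qed
    then have "(\<Sum>j\<in>{1..n}. (1 - ln (m j) + ln (m (j - 1))) / real n)
        \<le> (\<Sum>j\<in>{1..n}. \<Sum>v\<in>S x j. \<zeta> x (j, v) * \<zeta> y (j, v))" by (rule sum_mono)
    moreover have "(\<Sum>j\<in>{1..n}. (1 - ln (m j) + ln (m (j - 1))) / real n)
        = 1 - (ln (m n) - ln (m 0)) / real n"
    proof -
      have "(\<Sum>j\<in>{1..n}. 1 - ln (m j) + ln (m (j - 1))) = real n - (ln (m n) - ln (m 0))" for n
        by (induction n) auto
      then show ?thesis using n(1) by (simp add: sum_divide_distrib[symmetric] diff_divide_distrib)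
    qed
    moreover have "ln (m n) - ln (m 0) \<le> ln (1 + (2 * (real n * real R) + 1) * real D)"
    proof -
      have "m n \<le> real (1 + (2 * (n * R) + 1) * D)"
        unfolding m_def of_nat_le_iff using S(2)[OF x, of n] S(2)[OF y, of n] by simp
      then have "ln (m n) \<le> ln (1 + (2 * (real n * real R) + 1) * real D)"
        using m1[of n] by (subst ln_le_cancel_iff) (auto simp: algebra_simps)
      moreover have "0 \<le> ln (m 0)" using m1[of 0] by simp
      ultimately show ?thesis by linarith
    qed
    then have "(ln (m n) - ln (m 0)) / real n \<le> ln (1 + (2 * (real n * real R) + 1) * real D) / real n"
      by (intro divide_right_mono) auto
    ultimately show ?thesis using n(2) by linarith
  qed
  moreover have "0 \<le> \<zeta> x e" for x e by (simp add: \<zeta>_def)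
  moreover have "finite {e. \<zeta> x e \<noteq> 0}" if "x \<in> reachable" for x using supp[OF that] fin[OF that] by simp
  ultimately show ?thesis unfolding almost_invariant_def
    by (intro exI[of _ "L + 3 * (n * R)"] exI[of _ \<zeta>]) blast
qed

end

section \<open>Word metrics\<close>

locale marked_group = group G for G :: "('g, 'b) monoid_scheme" (structure) +
  fixes S :: "'g set"
  assumes finite_S: "finite S" and symmetric_S: "symmetric_subset G S"
    and generate_S: "generate G S = carrier G"
begin

abbreviation word_prod :: "'g list \<Rightarrow> 'g" where
  "word_prod ws \<equiv> foldr (\<otimes>) ws \<one>"

abbreviation wlen :: "'g \<Rightarrow> nat" where
  "wlen \<equiv> word_length G S"

definition wdist :: "'g \<Rightarrow> 'g \<Rightarrow> nat" where
  "wdist x y = wlen (inv x \<otimes> y)"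

lemma word_metric_eq: "word_metric G S x y = real (wdist x y)"
  by (simp add: word_metric_def wdist_def)

lemma S_carrier: "S \<subseteq> carrier G" and S_inv: "s \<in> S \<Longrightarrow> inv s \<in> S"
  using symmetric_S by (auto simp: symmetric_subset_def)

lemma word_prod_closed: "set ws \<subseteq> S \<Longrightarrow> word_prod ws \<in> carrier G"
  using S_carrier by (induction ws) auto

lemma word_prod_append:
  "set us \<subseteq> S \<Longrightarrow> set vs \<subseteq> S \<Longrightarrow> word_prod (us @ vs) = word_prod us \<otimes> word_prod vs"
proof (induction us)
  case Nil
  then show ?case using word_prod_closed[of vs] by simp
next
  case (Cons s us)
  then show ?case using S_carrier word_prod_closed[of us] word_prod_closed[of vs] by (auto simp: m_assoc)
qed

lemma word_prod_inv:
  "set ws \<subseteq> S \<Longrightarrow> word_prod (rev (map (m_inv G) ws)) = inv (word_prod ws)"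
proof (induction ws)
  case (Cons s ws)
  have "set (rev (map (m_inv G) ws)) \<subseteq> S" "set [inv s] \<subseteq> S" using Cons.prems S_inv by auto
  then have "word_prod (rev (map (m_inv G) ws) @ [inv s]) = word_prod (rev (map (m_inv G) ws)) \<otimes> inv s"
    using word_prod_append[of _ "[inv s]"] S_carrier by auto
  then show ?case
    using Cons S_carrier word_prod_closed[of ws] by (auto simp: inv_mult_group)
qed simp

lemma ex_word:
  assumes "g \<in> carrier G"
  shows "\<exists>ws. set ws \<subseteq> S \<and> word_prod ws = g"
proof -
  have "g \<in> generate G S" using assms generate_S by simp
  then show ?thesis
  proof induction
    case one
    then show ?case by (intro exI[of _ "[]"]) simp
  next
    case (incl h)
    then show ?case using S_carrier by (intro exI[of _ "[h]"]) auto
  next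
    case (inv h)
    then show ?case using S_carrier S_inv by (intro exI[of _ "[inv h]"]) auto
  next
    case (eng h1 h2)
    then obtain us vs where "set us \<subseteq> S" "word_prod us = h1" "set vs \<subseteq> S" "word_prod vs = h2" by blast
    then show ?case using word_prod_append[of us vs] by (intro exI[of _ "us @ vs"]) auto
  qed
qed

lemma countable_carrier: "countable (carrier G)"
proof -
  have "carrier G \<subseteq> word_prod ` lists S" using ex_word by (fastforce simp: lists_eq_set)
  then show ?thesis
    using finite_S by (meson countable_finite countable_image countable_lists countable_subset)
qed

lemma wlen_le: "set ws \<subseteq> S \<Longrightarrow> wlen (word_prod ws) \<le> length ws"
  unfolding word_length_def by (rule Least_le) blast

lemma wlen_word:
  assumes "g \<in> carrier G"
  shows "\<exists>ws. set ws \<subseteq> S \<and> length ws = wlen g \<and> word_prod ws = g"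
  unfolding word_length_def by (rule LeastI_ex) (use ex_word[OF assms] in blast)

lemma wlen_one: "wlen \<one> = 0"
  using wlen_le[of "[]"] by simp

lemma wlen_mult:
  assumes "g \<in> carrier G" "h \<in> carrier G"
  shows "wlen (g \<otimes> h) \<le> wlen g + wlen h"
proof -
  obtain us vs where "set us \<subseteq> S" "length us = wlen g" "word_prod us = g"
    "set vs \<subseteq> S" "length vs = wlen h" "word_prod vs = h"
    using wlen_word assms by metis
  then show ?thesis using wlen_le[of "us @ vs"] word_prod_append[of us vs] by simp
qed

lemma wlen_inv_le: "g \<in> carrier G \<Longrightarrow> wlen (inv g) \<le> wlen g"
proof -
  assume "g \<in> carrier G"
  then obtain us where us: "set us \<subseteq> S" "length us = wlen g" "word_prod us = g" using wlen_word by blast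
  then have "set (rev (map (m_inv G) us)) \<subseteq> S" using S_inv by auto
  then show ?thesis using wlen_le[of "rev (map (m_inv G) us)"] word_prod_inv[OF us(1)] us by simp
qed

lemma wlen_inv: "g \<in> carrier G \<Longrightarrow> wlen (inv g) = wlen g"
  using wlen_inv_le[of g] wlen_inv_le[of "inv g"] by simp

lemma wdist_self: "x \<in> carrier G \<Longrightarrow> wdist x x = 0"
  by (simp add: wdist_def wlen_one)

lemma wdist_commute: "x \<in> carrier G \<Longrightarrow> y \<in> carrier G \<Longrightarrow> wdist x y = wdist y x"
  using wlen_inv[of "inv x \<otimes> y"] by (simp add: wdist_def inv_mult_group)

lemma wdist_left_mult:
  "a \<in> carrier G \<Longrightarrow> x \<in> carrier G \<Longrightarrow> y \<in> carrier G \<Longrightarrow> wdist (a \<otimes> x) (a \<otimes> y) = wdist x y"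
  by (simp add: wdist_def inv_mult_group m_assoc[symmetric] inv_solve_right)
    (simp add: m_assoc)

lemma wdist_triangle:
  assumes "x \<in> carrier G" "y \<in> carrier G" "z \<in> carrier G"
  shows "wdist x z \<le> wdist x y + wdist y z"
proof -
  have "inv x \<otimes> z = (inv x \<otimes> y) \<otimes> (inv y \<otimes> z)"
    using assms by (simp add: m_assoc inv_solve_left) (simp add: m_assoc[symmetric])
  then show ?thesis using wlen_mult[of "inv x \<otimes> y" "inv y \<otimes> z"] assms by (simp add: wdist_def)
qed

end

section \<open>The coned-off Cayley graph\<close>

text \<open>Cone points carry the index, so that equal cosets from different indices stay
  distinct.\<close>

type_synonym ('g, 'i) vertex = "'g + 'i \<times> 'g set"

locale peripheral_group = marked_group G S for G :: "('g, 'b) monoid_scheme" (structure) and S +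
  fixes I :: "'i set" and H :: "'i \<Rightarrow> 'g set"
  assumes H_subgroup: "i \<in> I \<Longrightarrow> subgroup (H i) G"
begin

lemma H_carrier: "i \<in> I \<Longrightarrow> H i \<subseteq> carrier G"
  using H_subgroup subgroup.subset by blast

definition graph_edges :: "(('g, 'i) vertex \<times> ('g, 'i) vertex) set" where
  "graph_edges = Id \<union> {(Inl g, Inl (g \<otimes> s)) | g s. g \<in> carrier G \<and> s \<in> S} \<union>
     {(Inl g, Inr (i, g <# H i)) | g i. g \<in> carrier G \<and> i \<in> I} \<union>
     {(Inr (i, g <# H i), Inl g) | g i. g \<in> carrier G \<and> i \<in> I}"

definition graph_vertices :: "('g, 'i) vertex set" where
  "graph_vertices = Inl ` carrier G \<union> {Inr (i, g <# H i) | g i. g \<in> carrier G \<and> i \<in> I}"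

fun act :: "'g \<Rightarrow> ('g, 'i) vertex \<Rightarrow> ('g, 'i) vertex" where
  "act a (Inl g) = Inl (a \<otimes> g)"
| "act a (Inr (i, P)) = Inr (i, a <# P)"

definition act_dart :: "'g \<Rightarrow> ('g, 'i) vertex \<times> ('g, 'i) vertex \<Rightarrow> ('g, 'i) vertex \<times> ('g, 'i) vertex" where
  "act_dart a d = (act a (fst d), act a (snd d))"

lemma coset_mult: "a \<in> carrier G \<Longrightarrow> g \<in> carrier G \<Longrightarrow> i \<in> I \<Longrightarrow> a <# (g <# H i) = (a \<otimes> g) <# H i"
  using lcos_m_assoc H_carrier by blast

lemma coset_absorb:
  assumes "g \<in> carrier G" "i \<in> I" "h \<in> H i"
  shows "(g \<otimes> h) <# H i = g <# H i"
proof -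
  interpret Hi: subgroup "H i" G by (rule H_subgroup[OF assms(2)])
  have "h <# H i = H i" using coset_join3[OF _ H_subgroup[OF assms(2)]] assms Hi.mem_carrier by blast
  then show ?thesis using coset_mult[of g h i] assms Hi.mem_carrier by simp
qed

lemma coset_eqD:
  assumes "g \<in> carrier G" "b \<in> carrier G" "i \<in> I" "g <# H i = b <# H i"
  shows "inv g \<otimes> b \<in> H i"
proof -
  interpret Hi: subgroup "H i" G by (rule H_subgroup[OF assms(3)])
  have "b \<in> b <# H i" using assms Hi.one_closed by (force simp: l_coset_def)
  then have "b \<in> g <# H i" using assms by simp
  then obtain h where "h \<in> H i" "b = g \<otimes> h" by (auto simp: l_coset_def)
  then show ?thesis using assms Hi.mem_carrier by (simp add: m_assoc[symmetric])
qed

lemma sym_graph_edges: "sym graph_edges"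
proof (rule symI)
  fix u v assume "(u, v) \<in> graph_edges"
  then consider "u = v" | g s where "u = Inl g" "v = Inl (g \<otimes> s)" "g \<in> carrier G" "s \<in> S"
    | g i where "u = Inl g" "v = Inr (i, g <# H i)" "g \<in> carrier G" "i \<in> I"
    | g i where "v = Inl g" "u = Inr (i, g <# H i)" "g \<in> carrier G" "i \<in> I"
    by (auto simp: graph_edges_def)
  then show "(v, u) \<in> graph_edges"
  proof cases
    case 2
    then have "g = (g \<otimes> s) \<otimes> inv s" "g \<otimes> s \<in> carrier G" using S_carrier by (auto simp: m_assoc)
    then have "v = Inl (g \<otimes> s) \<and> u = Inl ((g \<otimes> s) \<otimes> inv s) \<and> g \<otimes> s \<in> carrier G \<and> inv s \<in> S"
      using 2 S_inv by auto
    then show ?thesis unfolding graph_edges_def by blast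
  qed (auto simp: graph_edges_def)
qed

lemma act_edge:
  assumes a: "a \<in> carrier G" and uv: "(u, v) \<in> graph_edges"
  shows "(act a u, act a v) \<in> graph_edges"
proof -
  consider "u = v" | g s where "u = Inl g" "v = Inl (g \<otimes> s)" "g \<in> carrier G" "s \<in> S"
    | g i where "u = Inl g" "v = Inr (i, g <# H i)" "g \<in> carrier G" "i \<in> I"
    | g i where "v = Inl g" "u = Inr (i, g <# H i)" "g \<in> carrier G" "i \<in> I"
    using uv by (auto simp: graph_edges_def)
  then show ?thesis
  proof cases
    case 2
    then have "act a v = Inl ((a \<otimes> g) \<otimes> s)" using a S_carrier by (auto simp: m_assoc)
    then show ?thesis using 2 a by (auto simp: graph_edges_def)
  qed (use a in \<open>auto simp: graph_edges_def coset_mult\<close>)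
qed

lemma act_walk: "a \<in> carrier G \<Longrightarrow> walk graph_edges u ds v \<Longrightarrow> walk graph_edges (act a u) (map (act_dart a) ds) (act a v)"
proof (induction ds arbitrary: u)
  case (Cons d ds)
  then show ?case using act_edge[of a "fst d" "snd d"] by (auto simp: act_dart_def)
qed simp

lemma edge_vertices: "u \<in> graph_vertices \<Longrightarrow> (u, v) \<in> graph_edges \<Longrightarrow> v \<in> graph_vertices"
  using S_carrier by (auto simp: graph_edges_def graph_vertices_def)

lemma walk_vertices:
  "walk graph_edges u ds v \<Longrightarrow> u \<in> graph_vertices \<Longrightarrow> d \<in> set ds \<Longrightarrow> fst d \<in> graph_vertices \<and> snd d \<in> graph_vertices"
proof (induction ds arbitrary: u)
  case (Cons d' ds)
  then have "snd d' \<in> graph_vertices" using edge_vertices[of "fst d'" "snd d'"] by auto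
  then show ?case using Cons by auto
qed simp

lemma act_act: "a \<in> carrier G \<Longrightarrow> b \<in> carrier G \<Longrightarrow> u \<in> graph_vertices \<Longrightarrow> act a (act b u) = act (a \<otimes> b) u"
  by (auto simp: graph_vertices_def m_assoc coset_mult)

lemma act_one: "u \<in> graph_vertices \<Longrightarrow> act \<one> u = u"
  by (auto simp: graph_vertices_def coset_mult)

lemma act_inverse_walk:
  assumes a: "a \<in> carrier G" and u: "u \<in> graph_vertices" and w: "walk graph_edges u ds v"
  shows "map (act_dart a) (map (act_dart (inv a)) ds) = ds"
  unfolding map_map by (rule map_idI) (use walk_vertices[OF w u] a in \<open>simp add: act_dart_def act_act act_one\<close>)

lemma cochain_sum_act: "cochain_sum \<phi> (map (act_dart a) ds) = cochain_sum (\<lambda>u v. \<phi> (act a u) (act a v)) ds"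
  by (induction ds) (auto simp: act_dart_def)

lemma antisymmetric_act: "antisymmetric \<phi> \<Longrightarrow> antisymmetric (\<lambda>u v. \<phi> (act a u) (act a v))"
  unfolding antisymmetric_def by blast

lemma sup_edges_act: "sup_edges (map (act_dart a) c) = act_dart a ` sup_edges c"
  by (simp add: sup_edges_def image_Un image_image act_dart_def)

section \<open>Words as paths in the coned-off graph\<close>

fun word_path :: "'g \<Rightarrow> 'g list \<Rightarrow> ('g, 'i) vertex darts" where
  "word_path g [] = []"
| "word_path g (s # ws) = (Inl g, Inl (g \<otimes> s)) # word_path (g \<otimes> s) ws"

lemma walk_word_path:
  "g \<in> carrier G \<Longrightarrow> set ws \<subseteq> S \<Longrightarrow> walk graph_edges (Inl g) (word_path g ws) (Inl (g \<otimes> word_prod ws))"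
proof (induction ws arbitrary: g)
  case (Cons s ws)
  then have s: "s \<in> carrier G" using S_carrier by auto
  have "walk graph_edges (Inl (g \<otimes> s)) (word_path (g \<otimes> s) ws) (Inl (g \<otimes> s \<otimes> word_prod ws))"
    using Cons s by auto
  moreover have "(Inl g, Inl (g \<otimes> s)) \<in> graph_edges" using Cons.prems by (auto simp: graph_edges_def)
  ultimately show ?case using Cons.prems s word_prod_closed[of ws] by (simp add: m_assoc)
qed simp

lemma word_path_act:
  "a \<in> carrier G \<Longrightarrow> g \<in> carrier G \<Longrightarrow> set ws \<subseteq> S \<Longrightarrow> map (act_dart a) (word_path g ws) = word_path (a \<otimes> g) ws"
proof (induction ws arbitrary: g)
  case (Cons s ws)
  then have "s \<in> carrier G" using S_carrier by auto
  then show ?case using Cons by (simp add: act_dart_def m_assoc)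
qed simp

definition geodesic_word :: "'g \<Rightarrow> 'g list" where
  "geodesic_word g = (SOME ws. set ws \<subseteq> S \<and> length ws = wlen g \<and> word_prod ws = g)"

lemma geodesic_word:
  assumes "g \<in> carrier G"
  shows "set (geodesic_word g) \<subseteq> S" "length (geodesic_word g) = wlen g" "word_prod (geodesic_word g) = g"
  using someI_ex[OF wlen_word[OF assms]] by (simp_all add: geodesic_word_def)

lemma wdist_walk:
  assumes "x \<in> carrier G" "y \<in> carrier G"
  shows "walk graph_edges (Inl x) (word_path x (geodesic_word (inv x \<otimes> y))) (Inl y)"
    "length (word_path x (geodesic_word (inv x \<otimes> y))) = wdist x y"
proof -
  have "length (word_path x ws) = length ws" for ws by (induction ws arbitrary: x) auto
  then show "length (word_path x (geodesic_word (inv x \<otimes> y))) = wdist x y"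
    using geodesic_word[of "inv x \<otimes> y"] assms by (simp add: wdist_def)
  show "walk graph_edges (Inl x) (word_path x (geodesic_word (inv x \<otimes> y))) (Inl y)"
    using walk_word_path[OF assms(1), of "geodesic_word (inv x \<otimes> y)"] geodesic_word[of "inv x \<otimes> y"] assms
    by (simp add: m_assoc[symmetric])
qed

text \<open>An inverse letter runs the path of \<open>x\<close> backwards instead of using a word
  for \<open>inv x\<close>, so that cancelling pairs vanish as chains.\<close>

fun letter_path :: "'g \<Rightarrow> ('g, 'i, 'g) letter \<Rightarrow> ('g, 'i) vertex darts" where
  "letter_path g (Gen b x) = (if b then word_path g (geodesic_word x)
     else reverse_walk (word_path (g \<otimes> inv x) (geodesic_word x)))"
| "letter_path g (Factor i h) = [(Inl g, Inr (i, g <# H i)), (Inr (i, g <# H i), Inl (g \<otimes> h))]"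

fun letters_path :: "'g \<Rightarrow> ('g, 'i, 'g) letter list \<Rightarrow> ('g, 'i) vertex darts" where
  "letters_path g [] = []"
| "letters_path g (l # w) = letter_path g l @ letters_path (g \<otimes> letter_value G l) w"

context
  fixes B :: "'g set"
  assumes B: "B \<subseteq> carrier G"
begin

abbreviation rel_letters :: "('g, 'i, 'g) letter set" where
  "rel_letters \<equiv> fp_letters B I (\<lambda>i. G\<lparr>carrier := H i\<rparr>)"

lemma rel_letters_cases:
  assumes "l \<in> rel_letters"
  obtains b x where "l = Gen b x" "x \<in> B" "x \<in> carrier G"
  | i h where "l = Factor i h" "i \<in> I" "h \<in> H i" "h \<in> carrier G"
proof (cases l)
  case (Gen b x)
  then show ?thesis using assms B that(1) by (auto simp: fp_letters_def)
next
  case (Factor i h)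
  then have "i \<in> I" "h \<in> H i" using assms by (auto simp: fp_letters_def)
  then show ?thesis using Factor H_carrier that(2) by blast
qed

lemma letter_value_closed: "l \<in> rel_letters \<Longrightarrow> letter_value G l \<in> carrier G"
  by (erule rel_letters_cases) auto

lemma word_value_Cons: "word_value G (l # w) = letter_value G l \<otimes> word_value G w"
  by (simp add: word_value_def)

lemma word_value_Nil: "word_value G [] = \<one>"
  by (simp add: word_value_def)

lemma word_value_closed: "w \<in> lists rel_letters \<Longrightarrow> word_value G w \<in> carrier G"
  by (induction w) (auto simp: word_value_Cons word_value_Nil letter_value_closed)

lemma walk_letter_path:
  assumes g: "g \<in> carrier G" and l: "l \<in> rel_letters"
  shows "walk graph_edges (Inl g) (letter_path g l) (Inl (g \<otimes> letter_value G l))"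
  using l
proof (cases rule: rel_letters_cases)
  case (1 b x)
  show ?thesis
  proof (cases b)
    case True
    then show ?thesis using 1 walk_word_path[OF g, of "geodesic_word x"] geodesic_word[of x] by simp
  next
    case False
    have "walk graph_edges (Inl (g \<otimes> inv x)) (word_path (g \<otimes> inv x) (geodesic_word x)) (Inl g)"
      using walk_word_path[of "g \<otimes> inv x" "geodesic_word x"] geodesic_word[of x] 1 g by (simp add: m_assoc)
    then show ?thesis using walk_reverse[OF sym_graph_edges] False 1 by simp
  qed
next
  case (2 i h)
  have "(Inr (i, (g \<otimes> h) <# H i), Inl (g \<otimes> h)) \<in> graph_edges" using 2 g by (auto simp: graph_edges_def)
  moreover have "(Inl g, Inr (i, g <# H i)) \<in> graph_edges" using 2 g by (auto simp: graph_edges_def)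
  ultimately show ?thesis using 2 coset_absorb[OF g] by simp
qed

lemma walk_letters_path:
  "g \<in> carrier G \<Longrightarrow> w \<in> lists rel_letters \<Longrightarrow> walk graph_edges (Inl g) (letters_path g w) (Inl (g \<otimes> word_value G w))"
proof (induction w arbitrary: g)
  case (Cons l w)
  then have l: "l \<in> rel_letters" "letter_value G l \<in> carrier G" using letter_value_closed by auto
  have "walk graph_edges (Inl (g \<otimes> letter_value G l)) (letters_path (g \<otimes> letter_value G l) w)
      (Inl (g \<otimes> letter_value G l \<otimes> word_value G w))"
    using Cons l by auto
  then show ?case
    using walk_appendI[OF walk_letter_path[OF Cons.prems(1) l(1)]] Cons.prems l word_value_closed[of w]
    by (simp add: m_assoc word_value_Cons)
qed (simp add: word_value_Nil)

lemma letter_path_act: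
  assumes a: "a \<in> carrier G" and g: "g \<in> carrier G" and l: "l \<in> rel_letters"
  shows "map (act_dart a) (letter_path g l) = letter_path (a \<otimes> g) l"
  using l
proof (cases rule: rel_letters_cases)
  case (1 b x)
  have "map (act_dart a) (reverse_walk ds) = reverse_walk (map (act_dart a) ds)" for ds
    by (simp add: reverse_walk_def rev_map act_dart_def)
  then show ?thesis using 1 a g word_path_act geodesic_word(1)[of x] by (simp add: m_assoc)
next
  case (2 i h)
  then show ?thesis using a g by (simp add: act_dart_def coset_mult m_assoc)
qed

lemma letters_path_act:
  "a \<in> carrier G \<Longrightarrow> g \<in> carrier G \<Longrightarrow> w \<in> lists rel_letters \<Longrightarrow>
    map (act_dart a) (letters_path g w) = letters_path (a \<otimes> g) w"
proof (induction w arbitrary: g)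
  case (Cons l w)
  then show ?case using letter_path_act[of a g l] letter_value_closed[of l] by (simp add: m_assoc)
qed simp

lemma letters_path_append:
  "g \<in> carrier G \<Longrightarrow> u \<in> lists rel_letters \<Longrightarrow> v \<in> lists rel_letters \<Longrightarrow>
    letters_path g (u @ v) = letters_path g u @ letters_path (g \<otimes> word_value G u) v"
proof (induction u arbitrary: g)
  case (Cons l u)
  then show ?case using letter_value_closed[of l] word_value_closed[of u] by (simp add: m_assoc word_value_Cons)
qed (simp add: word_value_Nil)

lemma H_group: "i \<in> I \<Longrightarrow> group (G\<lparr>carrier := H i\<rparr>)"
  using subgroup.subgroup_is_group[OF H_subgroup group_axioms] .

text \<open>Passing through the cone point makes the \<open>H i\<close>-letters additive:
  \<open>g \<rightarrow> gH \<rightarrow> ga \<rightarrow> gH \<rightarrow> gab\<close> and \<open>g \<rightarrow> gH \<rightarrow> gab\<close> are the same \<open>1\<close>-chain.\<close>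

lemma cochain_sum_fp_cong:
  assumes \<phi>: "antisymmetric \<phi>"
  shows "fp_cong B I (\<lambda>i. G\<lparr>carrier := H i\<rparr>) u v \<Longrightarrow> g \<in> carrier G \<Longrightarrow>
    cochain_sum \<phi> (letters_path g u) = cochain_sum \<phi> (letters_path g v)"
proof (induction arbitrary: g rule: fp_cong.induct)
  case (append u u' v v')
  have ls: "u \<in> lists rel_letters" "u' \<in> lists rel_letters" "v \<in> lists rel_letters" "v' \<in> lists rel_letters"
    using fp_cong_lists[OF append.hyps(1)] fp_cong_lists[OF append.hyps(2)] H_group by auto
  have "word_value G u = word_value G u'"
    by (rule word_value_cong[OF group_axioms B H_subgroup append.hyps(1)])
  then show ?case
    using append.IH append.prems ls word_value_closed[of u'] by (simp add: letters_path_append)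
next
  case (cancel x s)
  then have x: "x \<in> carrier G" using B by auto
  show ?case
  proof (cases s)
    case True
    then show ?thesis using x cancel.prems \<phi> by (simp add: cochain_sum_reverse m_assoc)
  next
    case False
    then show ?thesis using x cancel.prems \<phi> by (simp add: cochain_sum_reverse m_assoc)
  qed
next
  case (mult i a b)
  then have ab: "a \<in> carrier G" "b \<in> carrier G" using H_carrier by auto
  have "(g \<otimes> a) <# H i = g <# H i" using coset_absorb mult by simp
  then show ?case
    using ab mult.prems antisymmetricD[OF \<phi>, of "Inr (i, g <# H i)" "Inl (g \<otimes> a)"]
    by (simp add: m_assoc)
next
  case (one i)
  then show ?case using antisymmetricD[OF \<phi>, of "Inr (i, g <# H i)" "Inl g"] by simp
qed simp_all

section \<open>Chains of elements of the free product\<close>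

abbreviation FP :: "('g, 'i, 'g) letter list set monoid" where
  "FP \<equiv> rel_free_product G B I H"

lemma FP_carrier: "carrier FP = rel_class G B I H ` lists rel_letters"
  by (simp add: free_product_def)

lemma FP_one: "\<one>\<^bsub>FP\<^esub> = rel_class G B I H []"
  by (simp add: free_product_def)

definition class_sum :: "(('g, 'i) vertex \<Rightarrow> ('g, 'i) vertex \<Rightarrow> int) \<Rightarrow> 'g
    \<Rightarrow> ('g, 'i, 'g) letter list set \<Rightarrow> int" where
  "class_sum \<phi> g A = the_elem ((\<lambda>w. cochain_sum \<phi> (letters_path g w)) ` A)"

lemma class_sum_class:
  assumes \<phi>: "antisymmetric \<phi>" and g: "g \<in> carrier G" and w: "w \<in> lists rel_letters"
  shows "class_sum \<phi> g (rel_class G B I H w) = cochain_sum \<phi> (letters_path g w)"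
proof -
  have "cochain_sum \<phi> (letters_path g v) = cochain_sum \<phi> (letters_path g w)" if "v \<in> rel_class G B I H w" for v
    using cochain_sum_fp_cong[OF \<phi> _ g, of w v] that by (simp add: fp_class_def)
  moreover have "w \<in> rel_class G B I H w"
    using fp_cong.refl[OF w] by (simp add: fp_class_def)
  ultimately have "(\<lambda>w. cochain_sum \<phi> (letters_path g w)) ` rel_class G B I H w
      = {cochain_sum \<phi> (letters_path g w)}" by blast
  then show ?thesis by (simp add: class_sum_def)
qed

lemma FP_group: "group FP"
  by (rule group_free_product[OF H_group])

lemma natural_map_hom_FP: "natural_map G \<in> hom FP G"
  by (rule natural_map_hom[OF group_axioms B H_subgroup])

lemma natural_map_closed: "A \<in> carrier FP \<Longrightarrow> natural_map G A \<in> carrier G"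
  using natural_map_hom_FP by (auto simp: hom_def)

lemma natural_map_mult: "A \<in> carrier FP \<Longrightarrow> D \<in> carrier FP \<Longrightarrow>
    natural_map G (A \<otimes>\<^bsub>FP\<^esub> D) = natural_map G A \<otimes> natural_map G D"
  using natural_map_hom_FP by (simp add: hom_def)

lemma natural_map_rel_class: "w \<in> lists rel_letters \<Longrightarrow> natural_map G (rel_class G B I H w) = word_value G w"
  by (rule natural_map_class[OF group_axioms B H_subgroup])

text \<open>A crossed homomorphism: the second factor is read from where the first one ends.\<close>

lemma class_sum_mult:
  assumes \<phi>: "antisymmetric \<phi>" and g: "g \<in> carrier G" and A: "A \<in> carrier FP" and D: "D \<in> carrier FP"
  shows "class_sum \<phi> g (A \<otimes>\<^bsub>FP\<^esub> D) = class_sum \<phi> g A + class_sum \<phi> (g \<otimes> natural_map G A) D"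
proof -
  obtain u v where u: "u \<in> lists rel_letters" "A = rel_class G B I H u" and v: "v \<in> lists rel_letters" "D = rel_class G B I H v"
    using A D by (auto simp: FP_carrier)
  have "A \<otimes>\<^bsub>FP\<^esub> D = rel_class G B I H (u @ v)"
    unfolding u v by (rule free_product_mult[OF H_group u(1) v(1)])
  then show ?thesis
    using u v g word_value_closed[OF u(1)]
    by (simp add: class_sum_class[OF \<phi>] natural_map_rel_class letters_path_append)
qed

lemma class_sum_one: "antisymmetric \<phi> \<Longrightarrow> g \<in> carrier G \<Longrightarrow> class_sum \<phi> g \<one>\<^bsub>FP\<^esub> = 0"
  using class_sum_class[of \<phi> g "[]"] by (simp add: FP_one)

text \<open>A relator is read along a closed path, so the path of \<open>f\<close> is run back from
  where it ended and cancels. What remains is the relator translated by the image of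
  \<open>f\<close>.\<close>

lemma class_sum_conjugate:
  assumes \<phi>: "antisymmetric \<phi>" and g: "g \<in> carrier G" and f: "f \<in> carrier FP" and r: "r \<in> carrier FP"
    and r1: "natural_map G r = \<one>"
  shows "class_sum \<phi> g (f \<otimes>\<^bsub>FP\<^esub> r \<otimes>\<^bsub>FP\<^esub> inv\<^bsub>FP\<^esub> f) = class_sum \<phi> (g \<otimes> natural_map G f) r"
    and "natural_map G (f \<otimes>\<^bsub>FP\<^esub> r \<otimes>\<^bsub>FP\<^esub> inv\<^bsub>FP\<^esub> f) = \<one>"
proof -
  interpret F: group FP by (rule FP_group)
  have nf: "natural_map G f \<in> carrier G" by (rule natural_map_closed[OF f])
  have "class_sum \<phi> g (f \<otimes>\<^bsub>FP\<^esub> inv\<^bsub>FP\<^esub> f) = 0" using f g by (simp add: class_sum_one[OF \<phi>])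
  then have "class_sum \<phi> g f + class_sum \<phi> (g \<otimes> natural_map G f) (inv\<^bsub>FP\<^esub> f) = 0"
    using class_sum_mult[OF \<phi> g f, of "inv\<^bsub>FP\<^esub> f"] f by simp
  moreover have fr: "f \<otimes>\<^bsub>FP\<^esub> r \<in> carrier FP" using f r by simp
  ultimately show "class_sum \<phi> g (f \<otimes>\<^bsub>FP\<^esub> r \<otimes>\<^bsub>FP\<^esub> inv\<^bsub>FP\<^esub> f) = class_sum \<phi> (g \<otimes> natural_map G f) r"
    using class_sum_mult[OF \<phi> g fr, of "inv\<^bsub>FP\<^esub> f"] class_sum_mult[OF \<phi> g f r] natural_map_mult[OF f r] f r1 nf
    by simp
  have "natural_map G (f \<otimes>\<^bsub>FP\<^esub> inv\<^bsub>FP\<^esub> f) = \<one>"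
    using f natural_map_rel_class[of "[]"] by (simp add: FP_one word_value_Nil)
  then show "natural_map G (f \<otimes>\<^bsub>FP\<^esub> r \<otimes>\<^bsub>FP\<^esub> inv\<^bsub>FP\<^esub> f) = \<one>"
    using natural_map_mult[OF fr, of "inv\<^bsub>FP\<^esub> f"] natural_map_mult[OF f r] natural_map_mult[OF f, of "inv\<^bsub>FP\<^esub> f"] f r1 nf
    by simp
qed

lemma class_sum_conj_product:
  assumes \<phi>: "antisymmetric \<phi>"
  shows "set ps \<subseteq> carrier FP \<times> {r \<in> carrier FP. natural_map G r = \<one>} \<Longrightarrow> g \<in> carrier G \<Longrightarrow>
    conj_product FP ps \<in> carrier FP \<and> natural_map G (conj_product FP ps) = \<one> \<and>
    class_sum \<phi> g (conj_product FP ps) = (\<Sum>(f, r)\<leftarrow>ps. class_sum \<phi> (g \<otimes> natural_map G f) r)"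
proof (induction ps)
  case Nil
  then show ?case
    using natural_map_rel_class[of "[]"] FP_group
    by (auto simp: conj_product_def class_sum_one[OF \<phi>] FP_one[symmetric] word_value_Nil
        intro: monoid.one_closed[OF group.is_monoid] )
next
  case (Cons p ps)
  interpret F: group FP by (rule FP_group)
  obtain f r where p: "p = (f, r)" "f \<in> carrier FP" "r \<in> carrier FP" "natural_map G r = \<one>"
    using Cons.prems by (cases p) auto
  let ?c = "f \<otimes>\<^bsub>FP\<^esub> r \<otimes>\<^bsub>FP\<^esub> inv\<^bsub>FP\<^esub> f"
  have c: "?c \<in> carrier FP" using p by simp
  have eq: "conj_product FP ((f, r) # ps) = ?c \<otimes>\<^bsub>FP\<^esub> conj_product FP ps" by (simp add: conj_product_def)
  note IH = Cons.IH[OF _ Cons.prems(2)]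
  show ?case
    using IH Cons.prems c class_sum_conjugate[OF \<phi> Cons.prems(2) p(2-4)]
      class_sum_mult[OF \<phi> Cons.prems(2) c] natural_map_mult[OF c]
    unfolding p(1) eq by auto
qed

end

end

section \<open>Translates of finitely many cells\<close>

context peripheral_group
begin

text \<open>Cone points may have nontrivial stabilisers, whereas a dart with an end in the group has
  a trivial one. Edges without such an end are loops.\<close>

definition has_group_vertex :: "('g, 'i) vertex \<times> ('g, 'i) vertex \<Rightarrow> bool" where
  "has_group_vertex d \<longleftrightarrow> (\<exists>x\<in>carrier G. fst d = Inl x \<or> snd d = Inl x)"

lemma has_group_vertex_swap: "has_group_vertex (prod.swap d) \<longleftrightarrow> has_group_vertex d"
  by (auto simp: has_group_vertex_def)

definition translates :: "('g, 'i) vertex darts set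
    \<Rightarrow> ('g, 'i) vertex darts set" where
  "translates \<P> = {map (act_dart a) c | a c. a \<in> carrier G \<and> c \<in> \<P>}"

text \<open>The group acts freely on the edges, so every edge lies in a bounded number of translates
  of a finite set of cells.\<close>

lemma act_dart_free:
  assumes "a \<in> carrier G" "a' \<in> carrier G" "has_group_vertex d" "act_dart a d = act_dart a' d"
  shows "a = a'"
  using assms by (auto simp: has_group_vertex_def act_dart_def)

lemma cell_adjacent_translates:
  assumes fin: "finite \<P>" and gv: "\<And>c d. c \<in> \<P> \<Longrightarrow> d \<in> set c \<Longrightarrow> has_group_vertex d"
  shows "\<exists>N. \<forall>e. finite (cell_adjacent (translates \<P>) `` {e}) \<and> card (cell_adjacent (translates \<P>) `` {e}) \<le> N"
proof -
  define X where "X = (\<Union>c\<in>\<P>. sup_edges c)"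
  have X: "finite X" using fin by (auto simp: X_def sup_edges_def)
  have Xg: "has_group_vertex d" if dX: "d \<in> X" for d
  proof -
    obtain c where c: "c \<in> \<P>" "d \<in> set c \<or> (\<exists>d'\<in>set c. d = prod.swap d')"
      using dX unfolding X_def sup_edges_def by blast
    then show ?thesis using gv[OF c(1)] has_group_vertex_swap by blast
  qed
  have "finite (cell_adjacent (translates \<P>) `` {e}) \<and> card (cell_adjacent (translates \<P>) `` {e}) \<le> card (X \<times> X)" for e
  proof -
    \<comment> \<open>By freeness \<open>t e1\<close> is the only element that takes
      \<open>e1\<close> to \<open>e\<close>, so the pair \<open>(e1, e2)\<close> determines
      \<open>e'\<close>.\<close>
    define t where "t e1 = (SOME a. a \<in> carrier G \<and> act_dart a e1 = e)" for e1
    have "cell_adjacent (translates \<P>) `` {e} \<subseteq> (\<lambda>(e1, e2). act_dart (t e1) e2) ` (X \<times> X)"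
    proof
      fix e' assume "e' \<in> cell_adjacent (translates \<P>) `` {e}"
      then obtain a c where a: "a \<in> carrier G" "c \<in> \<P>"
        and "e \<in> act_dart a ` sup_edges c" "e' \<in> act_dart a ` sup_edges c"
        by (auto simp: cell_adjacent_def translates_def sup_edges_act)
      then obtain e1 e2 where e12: "e1 \<in> X" "e2 \<in> X" "e = act_dart a e1" "e' = act_dart a e2"
        using a(2) unfolding X_def by blast
      have "t e1 \<in> carrier G \<and> act_dart (t e1) e1 = e"
        unfolding t_def by (rule someI[of _ a]) (use a e12 in auto)
      then have "t e1 = a" using act_dart_free[OF _ a(1) Xg[OF e12(1)]] e12(3) by simp
      then show "e' \<in> (\<lambda>(e1, e2). act_dart (t e1) e2) ` (X \<times> X)" using e12 by force
    qed
    then show ?thesis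
      using X by (meson card_image_le card_mono finite_SigmaI finite_imageI finite_subset le_trans)
  qed
  then show ?thesis by blast
qed

text \<open>The coned-off graph forgets word distances inside cosets. As the cells are translates of
  finitely many, a cell step still moves group vertices by a bounded word distance, which is what
  makes the separation of cosets a statement about the word metric.\<close>

lemma wdist_translates:
  assumes fin: "finite \<P>" and P: "\<And>c. c \<in> \<P> \<Longrightarrow> walk graph_edges (Inl \<one>) c (Inl \<one>)"
  shows "\<exists>\<omega>. \<forall>e e' x y. (e, e') \<in> cell_adjacent (translates \<P>) \<longrightarrow> fst e = Inl x \<longrightarrow> fst e' = Inl y \<longrightarrow> wdist x y \<le> \<omega>"
proof -
  define X where "X = (\<Union>c\<in>\<P>. sup_edges c)"
  define Y where "Y = {x. Inl x \<in> fst ` X}"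
  have "finite X" using fin by (auto simp: X_def sup_edges_def)
  then have "finite (fst ` X)" by simp
  then have "finite (Inl -` (fst ` X))" by (rule finite_vimageI) simp
  then have Y: "finite Y" by (simp add: Y_def vimage_def)
  have YG: "Y \<subseteq> carrier G"
  proof -
    have one: "Inl \<one> \<in> graph_vertices" by (simp add: graph_vertices_def)
    have "fst d \<in> graph_vertices" if "d \<in> X" for d
      using that walk_vertices[OF P one] unfolding X_def sup_edges_def by fastforce
    then show ?thesis by (fastforce simp: Y_def graph_vertices_def)
  qed
  define \<omega> where "\<omega> = Max ((\<lambda>(x, y). wdist x y) ` (Y \<times> Y))"
  have "wdist x y \<le> \<omega>"
    if ee: "(e, e') \<in> cell_adjacent (translates \<P>)" and x: "fst e = Inl x" and y: "fst e' = Inl y" for e e' x y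
  proof -
    obtain a c where a: "a \<in> carrier G" "c \<in> \<P>"
      and "e \<in> act_dart a ` sup_edges c" "e' \<in> act_dart a ` sup_edges c"
      using ee by (auto simp: cell_adjacent_def translates_def sup_edges_act)
    then obtain e1 e2 where e12: "e1 \<in> X" "e2 \<in> X" "e = act_dart a e1" "e' = act_dart a e2"
      using a(2) unfolding X_def by blast
    have "\<exists>u\<in>Y. x = a \<otimes> u"
      using x e12 by (cases "fst e1") (force simp: act_dart_def Y_def image_iff)+
    moreover have "\<exists>u\<in>Y. y = a \<otimes> u"
      using y e12 by (cases "fst e2") (force simp: act_dart_def Y_def image_iff)+
    ultimately obtain u v where uv: "u \<in> Y" "v \<in> Y" "x = a \<otimes> u" "y = a \<otimes> v" by blast
    then have "wdist x y = wdist u v" using a YG by (simp add: wdist_left_mult subset_iff)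
    also have "\<dots> \<le> \<omega>" unfolding \<omega>_def using uv Y by (intro Max_ge) auto
    finally show ?thesis .
  qed
  then show ?thesis by blast
qed

lemma has_group_vertex_word_path:
  "g \<in> carrier G \<Longrightarrow> set ws \<subseteq> S \<Longrightarrow> d \<in> set (word_path g ws) \<Longrightarrow> has_group_vertex d"
proof (induction ws arbitrary: g)
  case (Cons s ws)
  then have "s \<in> carrier G" using S_carrier by auto
  then show ?case using Cons by (auto simp: has_group_vertex_def)
qed simp

lemma has_group_vertex_letters_path:
  assumes B: "B \<subseteq> carrier G"
  shows "g \<in> carrier G \<Longrightarrow> w \<in> lists (rel_letters B) \<Longrightarrow> d \<in> set (letters_path g w) \<Longrightarrow> has_group_vertex d"
proof (induction w arbitrary: g)
  case (Cons l w)
  then have l: "l \<in> rel_letters B" "letter_value G l \<in> carrier G" using letter_value_closed[OF B] by auto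
  have "has_group_vertex d" if d: "d \<in> set (letter_path g l)"
  proof -
    consider b x where "l = Gen b x" "x \<in> B" "x \<in> carrier G"
      | i h where "l = Factor i h" "i \<in> I" "h \<in> H i" "h \<in> carrier G"
      by (rule rel_letters_cases[OF B l(1)])
    then show ?thesis
    proof cases
      case (1 b x)
      have "d \<in> set (word_path g (geodesic_word x)) \<or>
          (\<exists>d'\<in>set (word_path (g \<otimes> inv x) (geodesic_word x)). d = prod.swap d')"
        using d unfolding 1(1) by (cases b) auto
      then show ?thesis
        using has_group_vertex_word_path[OF _ geodesic_word(1)[OF 1(3)]] Cons.prems(1) 1(3)
        by (metis has_group_vertex_swap inv_closed m_closed)
    next
      case (2 i h)
      then show ?thesis using d Cons.prems(1) by (auto simp: has_group_vertex_def)
    qed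
  qed
  then show ?case using Cons l by auto
qed simp

lemma ex_rel_word:
  assumes B: "symmetric_subset G B" and gen: "generate G (B \<union> (\<Union>i\<in>I. H i)) = carrier G" and g: "g \<in> carrier G"
  shows "\<exists>w\<in>lists (rel_alphabet G B I H). word_value G w = g"
proof -
  have BG: "B \<subseteq> carrier G" and Binv: "\<And>x. x \<in> B \<Longrightarrow> inv x \<in> B" using B by (auto simp: symmetric_subset_def)
  have sub: "rel_alphabet G B I H \<subseteq> rel_letters B" by (auto simp: rel_alphabet_def fp_letters_def)
  have letter: "\<exists>w\<in>lists (rel_alphabet G B I H). word_value G w = h" if h: "h \<in> B \<union> (\<Union>i\<in>I. H i)" for h
  \<comment> \<open>The alphabet omits the identity, which is the value of the empty word.\<close>
  proof (cases "h = \<one>")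
    case True
    then show ?thesis by (intro bexI[of _ "[]"]) (auto simp: word_value_Nil[OF BG])
  next
    case False
    consider "h \<in> B" | i where "i \<in> I" "h \<in> H i" using h by blast
    then show ?thesis
    proof cases
      case 1
      then show ?thesis using BG
        by (intro bexI[of _ "[Gen True h]"]) (auto simp: word_value_def rel_alphabet_def)
    next
      case 2
      then have "h \<in> carrier G" using H_carrier by blast
      then show ?thesis using 2 False
        by (intro bexI[of _ "[Factor i h]"]) (auto simp: word_value_def rel_alphabet_def)
    qed
  qed
  have "g \<in> generate G (B \<union> (\<Union>i\<in>I. H i))" using g gen by simp
  then show ?thesis
  proof induction
    case one
    then show ?case by (intro bexI[of _ "[]"]) (auto simp: word_value_Nil[OF BG])
  next
    case (incl h)
    then show ?case by (rule letter)
  next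
    case (inv h)
    then have "inv h \<in> B \<union> (\<Union>i\<in>I. H i)" using Binv subgroup.m_inv_closed[OF H_subgroup] by blast
    then show ?case by (rule letter)
  next
    case (eng h1 h2)
    then obtain u v where u: "u \<in> lists (rel_alphabet G B I H)" "word_value G u = h1"
      and v: "v \<in> lists (rel_alphabet G B I H)" "word_value G v = h2" by blast
    have "letter_value G ` set u \<subseteq> carrier G" "letter_value G ` set v \<subseteq> carrier G"
      using u v sub letter_value_closed[OF BG] by (auto simp: in_lists_conv_set)
    then have "word_value G (u @ v) = h1 \<otimes> h2" using word_value_append[OF group_axioms, of u v] u v by simp
    then show ?case using u v by (intro bexI[of _ "u @ v"]) auto
  qed
qed

text \<open>A path in the coned-off graph is turned into a word by reading \<open>g \<rightarrow> gH \<rightarrow> gh\<close> as the letter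
  \<open>h\<close> and replacing each \<open>S\<close>-edge by a relative word; each replacement costs one cell.\<close>

lemma path_to_word:
  assumes B: "B \<subseteq> carrier G"
    and rw_all: "\<forall>s\<in>S. rw s \<in> lists (rel_alphabet G B I H) \<and> word_value G (rw s) = s \<and> length (rw s) \<le> \<kappa>"
    and \<kappa>: "1 \<le> \<kappa>"
    and Z: "\<forall>a\<in>carrier G. \<forall>s\<in>S.
      map (act_dart a) ((Inl \<one>, Inl s) # reverse_walk (letters_path \<one> (rw s))) \<in> Z"
  shows "walk graph_edges (Inl \<one>) p v \<Longrightarrow>
    \<exists>w cs. w \<in> lists (rel_alphabet G B I H) \<and> length w \<le> \<kappa> * length p \<and> set cs \<subseteq> Z \<and> length cs \<le> length p \<and>
      ((v = Inl (word_value G w) \<and>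
        (\<forall>\<phi>. antisymmetric \<phi> \<longrightarrow> cochain_sum \<phi> p = cochain_sum \<phi> (letters_path \<one> w) + (\<Sum>c\<leftarrow>cs. cochain_sum \<phi> c))) \<or>
       (\<exists>i\<in>I. v = Inr (i, word_value G w <# H i) \<and>
        (\<forall>\<phi>. antisymmetric \<phi> \<longrightarrow> cochain_sum \<phi> p = cochain_sum \<phi> (letters_path \<one> w)
           + \<phi> (Inl (word_value G w)) v + (\<Sum>c\<leftarrow>cs. cochain_sum \<phi> c))))"
proof (induction p arbitrary: v rule: rev_induct)
  case Nil
  then show ?case
    by (intro exI[of _ "[]"]) (auto simp: word_value_Nil[OF B])
next
  case (snoc d p)
  note rw = rw_all[rule_format]
  have sub: "lists (rel_alphabet G B I H) \<subseteq> lists (rel_letters B)"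
    by (intro lists_mono) (auto simp: rel_alphabet_def fp_letters_def)
  obtain u where u: "walk graph_edges (Inl \<one>) p u" "d = (u, v)" "(u, v) \<in> graph_edges"
    using snoc.prems by (cases d) (auto simp: walk_append)
  obtain w cs where w: "w \<in> lists (rel_alphabet G B I H)" "length w \<le> \<kappa> * length p" "set cs \<subseteq> Z" "length cs \<le> length p"
    and alt: "(u = Inl (word_value G w) \<and>
        (\<forall>\<phi>. antisymmetric \<phi> \<longrightarrow> cochain_sum \<phi> p = cochain_sum \<phi> (letters_path \<one> w) + (\<Sum>c\<leftarrow>cs. cochain_sum \<phi> c))) \<or>
       (\<exists>i\<in>I. u = Inr (i, word_value G w <# H i) \<and>
        (\<forall>\<phi>. antisymmetric \<phi> \<longrightarrow> cochain_sum \<phi> p = cochain_sum \<phi> (letters_path \<one> w)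
           + \<phi> (Inl (word_value G w)) u + (\<Sum>c\<leftarrow>cs. cochain_sum \<phi> c)))"
    using snoc.IH[OF u(1)] by blast
  define g where "g = word_value G w"
  have wL: "w \<in> lists (rel_letters B)" using w(1) sub by blast
  have g: "g \<in> carrier G" using word_value_closed[OF B wL] by (simp add: g_def)
  have val: "word_value G (w @ w') = g \<otimes> word_value G w'" if "w' \<in> lists (rel_letters B)" for w'
  proof -
    have "letter_value G ` set w \<subseteq> carrier G" "letter_value G ` set w' \<subseteq> carrier G"
      using wL that letter_value_closed[OF B] by (auto simp: in_lists_conv_set)
    then show ?thesis using word_value_append[OF group_axioms, of w w'] by (simp add: g_def)
  qed
  have path: "letters_path \<one> (w @ w') = letters_path \<one> w @ letters_path g w'" if "w' \<in> lists (rel_letters B)" for w'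
    using letters_path_append[OF B _ wL that, of \<one>] g by (simp add: g_def)
  consider (stay) "u = v" | (gen) x s where "u = Inl x" "v = Inl (x \<otimes> s)" "x \<in> carrier G" "s \<in> S"
    | (up) x i where "u = Inl x" "v = Inr (i, x <# H i)" "x \<in> carrier G" "i \<in> I"
    | (down) x i where "v = Inl x" "u = Inr (i, x <# H i)" "x \<in> carrier G" "i \<in> I"
    using u(3) unfolding graph_edges_def by blast
  then show ?case
  proof cases
    case stay
    have "cochain_sum \<phi> (p @ [d]) = cochain_sum \<phi> p" if "antisymmetric \<phi>" for \<phi>
      using antisymmetric_refl[OF that] u(2) stay by simp
    then show ?thesis using w alt stay by (intro exI[of _ w] exI[of _ cs]) (auto simp: le_SucI)
  next
    case gen
    have gx: "x = g" and sum: "\<And>\<phi>. antisymmetric \<phi> \<Longrightarrow>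
        cochain_sum \<phi> p = cochain_sum \<phi> (letters_path \<one> w) + (\<Sum>c\<leftarrow>cs. cochain_sum \<phi> c)"
      using alt gen by (auto simp: g_def)
    have rws: "rw s \<in> lists (rel_letters B)" using rw[OF gen(4)] sub by blast
    define c where "c = map (act_dart g) ((Inl \<one>, Inl s) # reverse_walk (letters_path \<one> (rw s)))"
    have s: "s \<in> carrier G" using gen S_carrier by blast
    have rev: "map (act_dart g) (reverse_walk ds) = reverse_walk (map (act_dart g) ds)" for ds
      by (simp add: reverse_walk_def rev_map act_dart_def)
    have c: "c = (Inl g, Inl (g \<otimes> s)) # reverse_walk (letters_path g (rw s))"
      using letters_path_act[OF B g _ rws, of \<one>] g s by (simp add: c_def rev act_dart_def)
    have "cochain_sum \<phi> (p @ [d]) = cochain_sum \<phi> (letters_path \<one> (w @ rw s)) + (\<Sum>c\<leftarrow>c # cs. cochain_sum \<phi> c)"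
      if "antisymmetric \<phi>" for \<phi>
      using sum[OF that] path[OF rws] u(2) gen gx c cochain_sum_reverse[OF that] by simp
    moreover have "v = Inl (word_value G (w @ rw s))" using val[OF rws] rw[OF gen(4)] gen gx by simp
    moreover have "c \<in> Z" unfolding c_def by (rule Z[rule_format, OF g gen(4)])
    moreover have "length (w @ rw s) \<le> \<kappa> * length (p @ [d])" using w(2) rw[OF gen(4)] by simp
    ultimately show ?thesis
      using w rw[OF gen(4)] by (intro exI[of _ "w @ rw s"] exI[of _ "c # cs"]) auto
  next
    case up
    have gx: "x = g" and sum: "\<And>\<phi>. antisymmetric \<phi> \<Longrightarrow>
        cochain_sum \<phi> p = cochain_sum \<phi> (letters_path \<one> w) + (\<Sum>c\<leftarrow>cs. cochain_sum \<phi> c)"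
      using alt up by (auto simp: g_def)
    show ?thesis
      by (rule exI[of _ w], rule exI[of _ cs])
        (use w up gx sum u(2) in \<open>auto simp: g_def intro!: bexI[of _ i]\<close>)
  next
    case down
    obtain i' where i': "i' \<in> I" "u = Inr (i', g <# H i')" and sum: "\<And>\<phi>. antisymmetric \<phi> \<Longrightarrow>
        cochain_sum \<phi> p = cochain_sum \<phi> (letters_path \<one> w) + \<phi> (Inl g) u + (\<Sum>c\<leftarrow>cs. cochain_sum \<phi> c)"
      using alt down by (auto simp: g_def)
    then have ii: "i' = i" "g <# H i = x <# H i" using down by auto
    define h where "h = inv g \<otimes> x"
    have h: "h \<in> H i" "h \<in> carrier G" "g \<otimes> h = x"
      using coset_eqD[OF g down(3,4) ii(2)] g down by (auto simp: h_def m_assoc[symmetric])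
    show ?thesis
    \<comment> \<open>The path may return from the cone point to the element that it left. The
      identity is not a letter, and the two edges cancel.\<close>
    proof (cases "h = \<one>")
      case True
      then have "x = g" using h g by simp
      then have "cochain_sum \<phi> (p @ [d]) = cochain_sum \<phi> (letters_path \<one> w) + (\<Sum>c\<leftarrow>cs. cochain_sum \<phi> c)"
        if "antisymmetric \<phi>" for \<phi>
        using sum[OF that] u(2) down antisymmetricD[OF that, of u "Inl g"] by simp
      then show ?thesis using w down \<open>x = g\<close> by (intro exI[of _ w] exI[of _ cs]) (auto simp: g_def)
    next
      case False
      have fL: "[Factor i h] \<in> lists (rel_letters B)" using down h by (simp add: fp_letters_def)
      have "v = Inl (word_value G (w @ [Factor i h]))" using val[OF fL] h down by (simp add: word_value_def)
      moreover have "cochain_sum \<phi> (p @ [d]) = cochain_sum \<phi> (letters_path \<one> (w @ [Factor i h])) + (\<Sum>c\<leftarrow>cs. cochain_sum \<phi> c)"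
        if "antisymmetric \<phi>" for \<phi>
        using sum[OF that] path[OF fL] u(2) down ii h i' by simp
      moreover have "w @ [Factor i h] \<in> lists (rel_alphabet G B I H)"
        using w down h False by (simp add: rel_alphabet_def)
      moreover have "length (w @ [Factor i h]) \<le> \<kappa> * length (p @ [d])" using w(2) \<kappa> by simp
      ultimately show ?thesis
        using w by (intro exI[of _ "w @ [Factor i h]"] exI[of _ cs]) auto
    qed
  qed
qed

section \<open>The coned-off graph as a fine graph\<close>

lemma reachable_vertex:
  assumes "(Inl \<one>, u) \<in> graph_edges\<^sup>*"
  shows "u \<in> graph_vertices"
  using assms
proof (induction rule: rtrancl_induct)
  case base
  show ?case by (simp add: graph_vertices_def)
next
  case (step u v)
  then show ?case using edge_vertices by blast
qed

text \<open>The cells are the translates of the relator paths and of one closed path for every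
  \<open>s\<close> in \<open>S\<close>, which compares the edge of \<open>s\<close> with a relative
  word for \<open>s\<close>. The second kind is there because the word metric and the relative
  presentation come with different generators.\<close>

lemma coned_off_fine_graph:
  assumes "relatively_hyperbolic G I H"
  obtains Z M N C \<omega> where "fine_graph graph_edges Z (Inl \<one>) M N C"
    "\<And>e e' x y. (e, e') \<in> cell_adjacent Z \<Longrightarrow> fst e = Inl x \<Longrightarrow> fst e' = Inl y \<Longrightarrow> wdist x y \<le> \<omega>"
proof -
  obtain B R where finB: "finite B" and symB: "symmetric_subset G B"
    and gen: "generate G (B \<union> (\<Union>i\<in>I. H i)) = carrier G"
    and finR: "finite R" and RF: "R \<subseteq> carrier (rel_free_product G B I H)"
    and ker: "kernel (rel_free_product G B I H) G (natural_map G) = normal_closure (rel_free_product G B I H) R"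
    and iso: "linear_rel_isoperimetric G B I H R"
    using assms unfolding relatively_hyperbolic_def by blast
  have B: "B \<subseteq> carrier G" using symB by (simp add: symmetric_subset_def)
  let ?F = "FP B"
  interpret F: group ?F by (rule FP_group[OF B])
  obtain C0 :: real where C0: "0 < C0" and isoC: "\<And>w. w \<in> lists (rel_alphabet G B I H) \<Longrightarrow> word_value G w = \<one> \<Longrightarrow>
      \<exists>ps. set ps \<subseteq> carrier ?F \<times> (R \<union> m_inv ?F ` R) \<and> real (length ps) \<le> C0 * real (length w) \<and>
        rel_class G B I H w = conj_product ?F ps"
    using iso unfolding linear_rel_isoperimetric_def by blast
  define R' where "R' = R \<union> m_inv ?F ` R"
  have R': "finite R'" "R' \<subseteq> carrier ?F" using finR RF by (auto simp: R'_def)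
  have R1: "natural_map G r = \<one>" if "r \<in> R" for r
  proof -
    have r: "r \<in> carrier ?F" using RF that by blast
    have "\<one>\<^bsub>?F\<^esub> \<otimes>\<^bsub>?F\<^esub> r \<otimes>\<^bsub>?F\<^esub> inv\<^bsub>?F\<^esub> \<one>\<^bsub>?F\<^esub> \<in> normal_closure ?F R"
      unfolding normal_closure_def by (rule generate.incl) (use that in blast)
    then have "r \<in> kernel ?F G (natural_map G)" using r by (simp add: ker)
    then show ?thesis by (simp add: kernel_def)
  qed
  have R'1: "natural_map G r = \<one>" if r: "r \<in> R'" for r
  proof (cases "r \<in> R")
    case False
    then obtain q where q: "q \<in> R" "r = inv\<^bsub>?F\<^esub> q" using r by (auto simp: R'_def)
    have qF: "q \<in> carrier ?F" using q RF by blast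
    have "natural_map G (q \<otimes>\<^bsub>?F\<^esub> r) = natural_map G q \<otimes> natural_map G r"
      using natural_map_mult[OF B qF, of r] qF q by simp
    moreover have "natural_map G (q \<otimes>\<^bsub>?F\<^esub> r) = \<one>"
      using qF q natural_map_rel_class[OF B, of "[]"] by (simp add: FP_one[OF B] word_value_Nil[OF B])
    moreover have "natural_map G r \<in> carrier G" using natural_map_closed[OF B] qF q by simp
    ultimately show ?thesis using R1[OF q(1)] by simp
  qed (use R1 in blast)
  have "\<exists>w\<in>lists (rel_letters B). rel_class G B I H w = r" if "r \<in> R'" for r
    using R'(2) that by (auto simp: FP_carrier[OF B])
  then obtain rep where rep: "\<And>r. r \<in> R' \<Longrightarrow> rep r \<in> lists (rel_letters B)" "\<And>r. r \<in> R' \<Longrightarrow> rel_class G B I H (rep r) = r"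
    by metis
  have "\<exists>w\<in>lists (rel_alphabet G B I H). word_value G w = s" if "s \<in> S" for s
    using ex_rel_word[OF symB gen] that S_carrier by blast
  then obtain rw where rw: "\<And>s. s \<in> S \<Longrightarrow> rw s \<in> lists (rel_alphabet G B I H)" "\<And>s. s \<in> S \<Longrightarrow> word_value G (rw s) = s"
    by metis
  have sub: "lists (rel_alphabet G B I H) \<subseteq> lists (rel_letters B)"
    by (intro lists_mono) (auto simp: rel_alphabet_def fp_letters_def)
  define \<kappa> where "\<kappa> = Max (insert 1 ((\<lambda>s. length (rw s)) ` S))"
  have \<kappa>: "1 \<le> \<kappa>" "\<And>s. s \<in> S \<Longrightarrow> length (rw s) \<le> \<kappa>" using finite_S by (auto simp: \<kappa>_def)
  define \<P> where "\<P> = (\<lambda>r. letters_path \<one> (rep r)) ` R' \<union>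
      (\<lambda>s. (Inl \<one>, Inl s) # reverse_walk (letters_path \<one> (rw s))) ` S"
  have finP: "finite \<P>" using R' finite_S by (simp add: \<P>_def)
  have walkP: "walk graph_edges (Inl \<one>) c (Inl \<one>)" if "c \<in> \<P>" for c
  proof -
    consider r where "r \<in> R'" "c = letters_path \<one> (rep r)"
      | s where "s \<in> S" "c = (Inl \<one>, Inl s) # reverse_walk (letters_path \<one> (rw s))"
      using \<open>c \<in> \<P>\<close> by (auto simp: \<P>_def)
    then show ?thesis
    proof cases
      case 1
      have "word_value G (rep r) = \<one>" using R'1[OF 1(1)] rep[OF 1(1)] natural_map_rel_class[OF B, of "rep r"] by simp
      then show ?thesis using 1 walk_letters_path[OF B _ rep(1)[OF 1(1)], of \<one>] by simp
    next
      case 2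
      have "s \<in> carrier G" using 2 S_carrier by blast
      then have "walk graph_edges (Inl \<one>) (letters_path \<one> (rw s)) (Inl s)"
        using walk_letters_path[OF B, of \<one> "rw s"] rw[OF 2(1)] sub by auto
      moreover have "(Inl \<one>, Inl s) \<in> graph_edges"
      proof -
        have "(Inl \<one>, Inl (\<one> \<otimes> s)) \<in> graph_edges" using 2 unfolding graph_edges_def by blast
        then show ?thesis using \<open>s \<in> carrier G\<close> by simp
      qed
      ultimately show ?thesis using 2 walk_reverse[OF sym_graph_edges] by simp
    qed
  qed
  have gvP: "has_group_vertex d" if "c \<in> \<P>" "d \<in> set c" for c d
  proof -
    have lp: "has_group_vertex d" if "d \<in> set (letters_path \<one> w)" "w \<in> lists (rel_letters B)" for d w
      using has_group_vertex_letters_path[OF B _ that(2,1)] by simp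
    consider r where "r \<in> R'" "c = letters_path \<one> (rep r)"
      | s where "s \<in> S" "c = (Inl \<one>, Inl s) # reverse_walk (letters_path \<one> (rw s))"
      using \<open>c \<in> \<P>\<close> unfolding \<P>_def by blast
    then show ?thesis
    proof cases
      case 1
      then show ?thesis using lp[OF _ rep(1)] that(2) by blast
    next
      case 2
      have "rw s \<in> lists (rel_letters B)" using rw(1)[OF 2(1)] sub by blast
      moreover have "d = (Inl \<one>, Inl s) \<or> (\<exists>d'\<in>set (letters_path \<one> (rw s)). d = prod.swap d')"
        using that(2) unfolding 2(2) by auto
      moreover have "has_group_vertex (Inl \<one>, x)" for x by (auto simp: has_group_vertex_def)
      ultimately show ?thesis using lp has_group_vertex_swap by blast
    qed
  qed
  define Z where "Z = translates \<P>"
  have "\<exists>N. \<forall>e. finite (cell_adjacent Z `` {e}) \<and> card (cell_adjacent Z `` {e}) \<le> N"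
    unfolding Z_def by (rule cell_adjacent_translates[OF finP]) (rule gvP)
  then obtain N where N: "\<And>e. finite (cell_adjacent Z `` {e})" "\<And>e. card (cell_adjacent Z `` {e}) \<le> N"
    by blast
  have "\<exists>\<omega>. \<forall>e e' x y. (e, e') \<in> cell_adjacent Z \<longrightarrow> fst e = Inl x \<longrightarrow> fst e' = Inl y \<longrightarrow> wdist x y \<le> \<omega>"
    unfolding Z_def by (rule wdist_translates[OF finP]) (rule walkP)
  then obtain \<omega> where \<omega>: "\<And>e e' x y. (e, e') \<in> cell_adjacent Z \<Longrightarrow> fst e = Inl x \<Longrightarrow> fst e' = Inl y \<Longrightarrow> wdist x y \<le> \<omega>"
    by blast
  define M where "M = Max (insert 0 (length ` \<P>))"
  have M: "length c \<le> M" if "c \<in> \<P>" for c using that finP by (auto simp: M_def)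
  define C1 where "C1 = nat \<lceil>C0\<rceil>"
  \<comment> \<open>A path of length \<open>l\<close> becomes a word of at most
    \<open>\<kappa> * l\<close> letters, filled with at most \<open>C1\<close> relators per letter,
    at the cost of at most \<open>l\<close> cells for its \<open>S\<close>-edges.\<close>
  define C where "C = C1 * \<kappa> + 1"
  have Zact: "map (act_dart a) c \<in> Z" if "a \<in> carrier G" "c \<in> Z" for a c
  proof -
    obtain b c' where c: "b \<in> carrier G" "c' \<in> \<P>" "c = map (act_dart b) c'"
      using \<open>c \<in> Z\<close> by (auto simp: Z_def translates_def)
    have "act_dart a (act_dart b d) = act_dart (a \<otimes> b) d" if "d \<in> set c'" for d
    proof -
      have "fst d \<in> graph_vertices \<and> snd d \<in> graph_vertices"
        by (rule walk_vertices[OF walkP[OF c(2)] _ \<open>d \<in> set c'\<close>]) (simp add: graph_vertices_def)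
      then show ?thesis using \<open>a \<in> carrier G\<close> c(1) by (simp add: act_dart_def act_act)
    qed
    then have "map (act_dart a) c = map (act_dart (a \<otimes> b)) c'" using c(3) by simp
    moreover have "a \<otimes> b \<in> carrier G" using \<open>a \<in> carrier G\<close> c(1) by simp
    ultimately show ?thesis using c(2) unfolding Z_def translates_def by blast
  qed
  have fill1: "\<exists>cs. set cs \<subseteq> Z \<and> length cs \<le> C * length p \<and>
      (\<forall>\<phi>. antisymmetric \<phi> \<longrightarrow> cochain_sum \<phi> p = (\<Sum>c\<leftarrow>cs. cochain_sum \<phi> c))"
    if p: "walk graph_edges (Inl \<one>) p (Inl \<one>)" for p
  proof -
    have sZ: "map (act_dart a) ((Inl \<one>, Inl s) # reverse_walk (letters_path \<one> (rw s))) \<in> Z"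
      if "a \<in> carrier G" "s \<in> S" for a s using that unfolding Z_def translates_def \<P>_def by blast
    then have sZ: "\<forall>a\<in>carrier G. \<forall>s\<in>S.
      map (act_dart a) ((Inl \<one>, Inl s) # reverse_walk (letters_path \<one> (rw s))) \<in> Z" by blast
    obtain w cs where w: "w \<in> lists (rel_alphabet G B I H)" "length w \<le> \<kappa> * length p" "set cs \<subseteq> Z" "length cs \<le> length p"
      and w1: "word_value G w = \<one>"
      and sum: "\<And>\<phi>. antisymmetric \<phi> \<Longrightarrow> cochain_sum \<phi> p = cochain_sum \<phi> (letters_path \<one> w) + (\<Sum>c\<leftarrow>cs. cochain_sum \<phi> c)"
    proof -
      have rw': "\<forall>s\<in>S. rw s \<in> lists (rel_alphabet G B I H) \<and> word_value G (rw s) = s \<and> length (rw s) \<le> \<kappa>"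
        using rw \<kappa>(2) by blast
      from path_to_word[OF B rw' \<kappa>(1) sZ p] show ?thesis
      proof (elim exE conjE disjE bexE)
        fix w cs assume "w \<in> lists (rel_alphabet G B I H)" "length w \<le> \<kappa> * length p" "set cs \<subseteq> Z" "length cs \<le> length p"
          and "Inl \<one> = Inl (word_value G w)"
          and "\<forall>\<phi>. antisymmetric \<phi> \<longrightarrow> cochain_sum \<phi> p = cochain_sum \<phi> (letters_path \<one> w) + (\<Sum>c\<leftarrow>cs. cochain_sum \<phi> c)"
        then show ?thesis by (intro that[of w cs]) auto
      qed simp
    qed
    obtain ps where ps: "set ps \<subseteq> carrier ?F \<times> R'" "real (length ps) \<le> C0 * real (length w)"
      "rel_class G B I H w = conj_product ?F ps"
      using isoC[OF w(1) w1] unfolding R'_def by blast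
    define cell where "cell = (\<lambda>(f :: ('g, 'i, 'g) letter list set, r). map (act_dart (natural_map G f)) (letters_path \<one> (rep r)))"
    have cellZ: "cell q \<in> Z" if "q \<in> set ps" for q
    proof -
      have "fst q \<in> carrier ?F" "snd q \<in> R'" using that ps(1) by auto
      then show ?thesis
        using natural_map_closed[OF B, of "fst q"] unfolding cell_def Z_def translates_def \<P>_def case_prod_beta by blast
    qed
    have wL: "w \<in> lists (rel_letters B)" using w(1) sub by blast
    have "cochain_sum \<phi> (letters_path \<one> w) = (\<Sum>c\<leftarrow>map cell ps. cochain_sum \<phi> c)" if \<phi>: "antisymmetric \<phi>" for \<phi>
    proof -
      have "cochain_sum \<phi> (letters_path \<one> w) = class_sum \<phi> \<one> (conj_product ?F ps)"
        using class_sum_class[OF B \<phi> _ wL, of \<one>] ps(3) by simp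
      also have "\<dots> = (\<Sum>(f, r)\<leftarrow>ps. class_sum \<phi> (\<one> \<otimes> natural_map G f) r)"
        using class_sum_conj_product[OF B \<phi>, of ps \<one>] ps(1) R'(2) R'1 by (simp add: subset_iff)
      also have "\<dots> = (\<Sum>q\<leftarrow>ps. cochain_sum \<phi> (cell q))"
      proof (rule arg_cong[where f = sum_list], rule map_cong[OF HOL.refl])
        fix q assume "q \<in> set ps"
        then have q: "fst q \<in> carrier ?F" "snd q \<in> R'" using ps(1) by auto
        have nf: "natural_map G (fst q) \<in> carrier G" by (rule natural_map_closed[OF B q(1)])
        have "class_sum \<phi> (natural_map G (fst q)) (snd q) = cochain_sum \<phi> (letters_path (natural_map G (fst q)) (rep (snd q)))"
          using class_sum_class[OF B \<phi> nf rep(1)[OF q(2)]] rep(2)[OF q(2)] by simp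
        also have "\<dots> = cochain_sum \<phi> (cell q)"
          using letters_path_act[OF B nf _ rep(1)[OF q(2)], of \<one>] nf by (simp add: cell_def case_prod_beta)
        finally show "(case q of (f, r) \<Rightarrow> class_sum \<phi> (\<one> \<otimes> natural_map G f) r) = cochain_sum \<phi> (cell q)"
          using nf by (simp add: case_prod_beta)
      qed
      finally show ?thesis by (simp add: o_def)
    qed
    then have "cochain_sum \<phi> p = (\<Sum>c\<leftarrow>map cell ps @ cs. cochain_sum \<phi> c)" if "antisymmetric \<phi>" for \<phi>
      using sum that by simp
    moreover have "set (map cell ps @ cs) \<subseteq> Z" using cellZ w(3) by auto
    moreover have "length (map cell ps @ cs) \<le> C * length p"
    proof -
      have "C0 \<le> real C1" using C0 by (simp add: C1_def)
      then have "C0 * real (length w) \<le> real C1 * real (length w)" by (intro mult_right_mono) auto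
      then have "real (length ps) \<le> real (C1 * length w)" using ps(2) by simp
      then have "length ps \<le> C1 * length w" by (simp only: of_nat_le_iff)
      also have "\<dots> \<le> C1 * (\<kappa> * length p)" by (intro mult_le_mono2 w)
      finally show ?thesis using w(4) by (simp add: C_def algebra_simps)
    qed
    ultimately show ?thesis by blast
  qed
  have fill2: "\<exists>cs. set cs \<subseteq> Z \<and> length cs \<le> C * length p \<and>
      (\<forall>\<phi>. antisymmetric \<phi> \<longrightarrow> cochain_sum \<phi> p = (\<Sum>c\<leftarrow>cs. cochain_sum \<phi> c))"
    if g: "g \<in> carrier G" and p: "walk graph_edges (Inl g) p (Inl g)" for g p
  proof -
    \<comment> \<open>The set of cells is invariant under translation, so the base point may be
      moved to the identity.\<close>
    have "walk graph_edges (Inl \<one>) (map (act_dart (inv g)) p) (Inl \<one>)"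
      using act_walk[OF _ p, of "inv g"] g by simp
    from fill1[OF this] obtain cs where cs: "set cs \<subseteq> Z" "length cs \<le> C * length p"
      and sum: "\<And>\<phi>. antisymmetric \<phi> \<Longrightarrow> cochain_sum \<phi> (map (act_dart (inv g)) p) = (\<Sum>c\<leftarrow>cs. cochain_sum \<phi> c)"
      by auto
    have "cochain_sum \<phi> p = (\<Sum>c\<leftarrow>map (map (act_dart g)) cs. cochain_sum \<phi> c)" if \<phi>: "antisymmetric \<phi>" for \<phi>
    proof -
      have "cochain_sum \<phi> p = cochain_sum \<phi> (map (act_dart g) (map (act_dart (inv g)) p))"
        using act_inverse_walk[OF g _ p] g by (simp add: graph_vertices_def)
      also have "\<dots> = (\<Sum>c\<leftarrow>cs. cochain_sum \<phi> (map (act_dart g) c))"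
        using sum[OF antisymmetric_act[OF \<phi>, of g]] by (simp only: cochain_sum_act)
      finally show ?thesis by (simp add: o_def)
    qed
    moreover have "set (map (map (act_dart g)) cs) \<subseteq> Z" using Zact[OF g] cs(1) by auto
    ultimately show ?thesis using cs(2) by (intro exI[of _ "map (map (act_dart g)) cs"]) auto
  qed
  have "fine_graph graph_edges Z (Inl \<one>) M N C"
  proof
    fix v show "(v, v) \<in> graph_edges" by (simp add: graph_edges_def)
  next
    show "sym graph_edges" by (rule sym_graph_edges)
  next
    fix c assume "c \<in> Z"
    then obtain a c' where a: "a \<in> carrier G" "c' \<in> \<P>" "c = map (act_dart a) c'" by (auto simp: Z_def translates_def)
    show "\<exists>u. walk graph_edges u c u" using act_walk[OF a(1) walkP[OF a(2)]] a(3) by blast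
    show "length c \<le> M" using M a by simp
  next
    fix u w assume u: "(Inl \<one>, u) \<in> graph_edges\<^sup>*" and w: "walk graph_edges u w u"
    have "u \<in> graph_vertices" by (rule reachable_vertex[OF u])
    then consider g where "g \<in> carrier G" "u = Inl g" | g i where "g \<in> carrier G" "i \<in> I" "u = Inr (i, g <# H i)"
      by (auto simp: graph_vertices_def)
    then show "\<exists>cs. set cs \<subseteq> Z \<and> length cs \<le> C * (length w + 2) \<and>
      (\<forall>\<phi>. antisymmetric \<phi> \<longrightarrow> cochain_sum \<phi> w = (\<Sum>c\<leftarrow>cs. cochain_sum \<phi> c))"
    proof cases
      case 1
      then obtain cs where "set cs \<subseteq> Z" "length cs \<le> C * length w"
        "\<forall>\<phi>. antisymmetric \<phi> \<longrightarrow> cochain_sum \<phi> w = (\<Sum>c\<leftarrow>cs. cochain_sum \<phi> c)" using fill2 w by blast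
      then show ?thesis by (intro exI[of _ cs]) auto
    next
      case 2
      \<comment> \<open>A closed walk at a cone point is based at a group element by an added edge
        and its reverse, which cancel in the chain. They account for the summand \<open>2\<close> in
        \<open>fill\<close>.\<close>
      have e: "(Inl g, u) \<in> graph_edges" "(u, Inl g) \<in> graph_edges" using 2 by (auto simp: graph_edges_def)
      have "walk graph_edges (Inl g) ((Inl g, u) # w @ [(u, Inl g)]) (Inl g)"
        using e walk_appendI[OF w, of "[(u, Inl g)]" "Inl g"] by simp
      from fill2[OF 2(1) this] obtain cs where cs: "set cs \<subseteq> Z" "length cs \<le> C * (length w + 2)"
        and sum: "\<And>\<phi>. antisymmetric \<phi> \<Longrightarrow> cochain_sum \<phi> ((Inl g, u) # w @ [(u, Inl g)]) = (\<Sum>c\<leftarrow>cs. cochain_sum \<phi> c)"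
        by auto
      have "cochain_sum \<phi> w = (\<Sum>c\<leftarrow>cs. cochain_sum \<phi> c)" if "antisymmetric \<phi>" for \<phi>
        using sum[OF that] antisymmetricD[OF that, of "Inl g" u] by simp
      then show ?thesis using cs by blast
    qed
  next
    fix e show "finite (cell_adjacent Z `` {e})" "card (cell_adjacent Z `` {e}) \<le> N" using N by auto
  qed
  then show ?thesis using that \<omega> by blast
qed

end

section \<open>Relative balls\<close>

context peripheral_group
begin

primrec rel_ball :: "nat \<Rightarrow> 'g set" where
  "rel_ball 0 = {\<one>}"
| "rel_ball (Suc n) = rel_ball n \<union> {g \<otimes> s | g s. g \<in> rel_ball n \<and> s \<in> S} \<union>
     {g \<otimes> h | g h i. g \<in> rel_ball n \<and> i \<in> I \<and> h \<in> H i}"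

lemma rel_ball_carrier: "rel_ball n \<subseteq> carrier G"
  using S_carrier H_carrier by (induction n) (auto, blast+)

text \<open>The path is built letter by letter, so its group vertices stay in the ball;
  \<open>coset_separation\<close> relies on this when it looks for the end of a linked edge. A
  letter of \<open>H i\<close> costs two edges.\<close>

lemma rel_ball_path:
  "g \<in> rel_ball n \<Longrightarrow> \<exists>ds. walk graph_edges (Inl \<one>) ds (Inl g) \<and> length ds \<le> 2 * n \<and>
     (\<forall>d\<in>set ds. \<forall>x. fst d = Inl x \<or> snd d = Inl x \<longrightarrow> x \<in> rel_ball n)"
proof (induction n arbitrary: g)
  case 0
  then show ?case by (intro exI[of _ "[]"]) simp
next
  case (Suc n)
  have ext: ?case if f: "f \<in> rel_ball n" and es: "walk graph_edges (Inl f) es (Inl g)" "length es \<le> 2"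
    "\<forall>d\<in>set es. \<forall>x. fst d = Inl x \<or> snd d = Inl x \<longrightarrow> x \<in> rel_ball (Suc n)" for f es
  proof -
    obtain ds where ds: "walk graph_edges (Inl \<one>) ds (Inl f)" "length ds \<le> 2 * n"
      "\<forall>d\<in>set ds. \<forall>x. fst d = Inl x \<or> snd d = Inl x \<longrightarrow> x \<in> rel_ball n"
      using Suc.IH[OF f] by blast
    have "\<forall>d\<in>set (ds @ es). \<forall>x. fst d = Inl x \<or> snd d = Inl x \<longrightarrow> x \<in> rel_ball (Suc n)"
      using ds(3) es(3) by auto
    then show ?thesis
      using walk_appendI[OF ds(1) es(1)] ds(2) es(2) by (intro exI[of _ "ds @ es"]) auto
  qed
  consider "g \<in> rel_ball n" | f s where "g = f \<otimes> s" "f \<in> rel_ball n" "s \<in> S"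
    | f h i where "g = f \<otimes> h" "f \<in> rel_ball n" "i \<in> I" "h \<in> H i"
    using Suc.prems by auto
  then show ?case
  proof cases
    case 1
    then show ?thesis by (intro ext[of g "[]"]) auto
  next
    case 2
    then have "f \<in> carrier G" using rel_ball_carrier by blast
    then have "(Inl f, Inl g) \<in> graph_edges" using 2 unfolding graph_edges_def by blast
    then show ?thesis using 2 Suc.prems by (intro ext[of f "[(Inl f, Inl g)]"]) auto
  next
    case 3
    have f: "f \<in> carrier G" using rel_ball_carrier 3 by blast
    have g: "g \<in> carrier G" using rel_ball_carrier Suc.prems by blast
    let ?v = "Inr (i, f <# H i)"
    have "f <# H i = g <# H i" using coset_absorb[OF f 3(3,4)] 3(1) by simp
    then have "(?v, Inl g) \<in> graph_edges" "(Inl f, ?v) \<in> graph_edges"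
      using f g 3(3) unfolding graph_edges_def by auto
    then show ?thesis using 3 Suc.prems by (intro ext[of f "[(Inl f, ?v), (?v, Inl g)]"]) auto
  qed
qed

lemma rel_ball_relpow:
  "(Inl \<one>, v) \<in> graph_edges ^^ n \<Longrightarrow> (\<forall>g. v = Inl g \<longrightarrow> g \<in> rel_ball n) \<and>
     (\<forall>i P. v = Inr (i, P) \<longrightarrow> i \<in> I \<and> (\<exists>g\<in>rel_ball n. P = g <# H i))"
proof (induction n arbitrary: v)
  case (Suc n)
  then obtain u where u: "(Inl \<one>, u) \<in> graph_edges ^^ n" "(u, v) \<in> graph_edges" by auto
  note IH = Suc.IH[OF u(1)]
  consider (stay) "u = v" | (gen) x s where "u = Inl x" "v = Inl (x \<otimes> s)" "x \<in> carrier G" "s \<in> S"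
    | (up) x i where "u = Inl x" "v = Inr (i, x <# H i)" "x \<in> carrier G" "i \<in> I"
    | (down) x i where "v = Inl x" "u = Inr (i, x <# H i)" "x \<in> carrier G" "i \<in> I"
    using u(2) unfolding graph_edges_def by blast
  then show ?case
  proof cases
    case down
    then obtain g where g: "g \<in> rel_ball n" "x <# H i = g <# H i" using IH by blast
    have gG: "g \<in> carrier G" using rel_ball_carrier g by blast
    have "inv g \<otimes> x \<in> H i" using coset_eqD[OF gG down(3,4)] g by simp
    moreover have "x = g \<otimes> (inv g \<otimes> x)" using gG down by (simp add: m_assoc[symmetric])
    ultimately show ?thesis using g down by auto
  qed (use IH in auto)
qed simp

section \<open>Separation of peripheral cosets\<close>

abbreviation wd :: "'g \<Rightarrow> 'g \<Rightarrow> real" where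
  "wd \<equiv> word_metric G S"

lemma edge_to_cone_point:
  assumes "(u, Inr (i, P)) \<in> graph_edges" "u \<noteq> Inr (i, P)"
  shows "\<exists>z\<in>carrier G. u = Inl z"
  using assms by (auto simp: graph_edges_def)

lemma word_path_Inl: "d \<in> set (word_path g ws) \<Longrightarrow> (\<exists>x. fst d = Inl x) \<and> (\<exists>x. snd d = Inl x)"
  by (induction ws arbitrary: g) auto

text \<open>Distinct peripheral cosets through points of a relative ball come close to each other only
  near the ball: a closed path through the cone point of the first coset enters the coset at \<open>x\<close>,
  and the linked edges through which it leaves again end in the ball.\<close>

lemma coset_separation:
  assumes FG: "fine_graph graph_edges Z (Inl \<one>) M N C"
    and \<omega>: "\<forall>e e' x y. (e, e') \<in> cell_adjacent Z \<longrightarrow> fst e = Inl x \<longrightarrow> fst e' = Inl y \<longrightarrow> wdist x y \<le> \<omega>"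
    and x: "x \<in> carrier G" and y: "y \<in> carrier G" and i: "i \<in> I" and i': "i' \<in> I"
    and g: "g \<in> rel_ball n" "x <# H i = g <# H i" and g': "g' \<in> rel_ball n" "y <# H i' = g' <# H i'"
    and ne: "(i, x <# H i) \<noteq> (i', y <# H i')" and R: "wdist x y \<le> R"
  shows "\<exists>a\<in>rel_ball n. wdist x a \<le> \<omega> * (M * M * (C * (4 * n + R + 6)))"
proof -
  interpret fine_graph graph_edges Z "Inl \<one>" M N C by (rule FG)
  define v :: "('g, 'i) vertex" where "v = Inr (i, x <# H i)"
  define v' :: "('g, 'i) vertex" where "v' = Inr (i', y <# H i')"
  have vv: "v \<noteq> v'" using ne by (simp add: v_def v'_def)
  have gG: "g \<in> carrier G" "g' \<in> carrier G" using g g' rel_ball_carrier by blast+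
  obtain p where p: "walk graph_edges (Inl \<one>) p (Inl g)" "length p \<le> 2 * n"
    "\<And>d x. d \<in> set p \<Longrightarrow> fst d = Inl x \<or> snd d = Inl x \<Longrightarrow> x \<in> rel_ball n"
    using rel_ball_path[OF g(1)] by blast
  obtain p' where p': "walk graph_edges (Inl \<one>) p' (Inl g')" "length p' \<le> 2 * n"
    "\<And>d x. d \<in> set p' \<Longrightarrow> fst d = Inl x \<or> snd d = Inl x \<Longrightarrow> x \<in> rel_ball n"
    using rel_ball_path[OF g'(1)] by blast
  define q where "q = word_path y (geodesic_word (inv y \<otimes> x))"
  have q: "walk graph_edges (Inl y) q (Inl x)" "length q \<le> R"
    using wdist_walk[OF y x] R wdist_commute[OF x y] by (simp_all add: q_def)
  \<comment> \<open>From \<open>x\<close> over the first cone point to \<open>g\<close>, inside the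
    ball over the identity to \<open>g'\<close>, over the second cone point to \<open>y\<close>, and
    back to \<open>x\<close> along a word of length at most \<open>R\<close>.\<close>
  define w where "w = [(Inl x, v), (v, Inl g)] @ reverse_walk p @ p' @ [(Inl g', v'), (v', Inl y)] @ q"
  have xe: "(Inl x, v) \<in> graph_edges" "(v, Inl g) \<in> graph_edges" "(Inl g', v') \<in> graph_edges" "(v', Inl y) \<in> graph_edges"
    using x y gG i i' g(2) g'(2) unfolding graph_edges_def v_def v'_def by auto
  have w: "walk graph_edges (Inl x) w (Inl x)"
    unfolding w_def
    using walk_appendI[OF _ walk_appendI[OF walk_reverse[OF sym_graph_edges p(1)] walk_appendI[OF p'(1)
      walk_appendI[OF _ q(1)]]], of "Inl x" "[(Inl x, v), (v, Inl g)]" "[(Inl g', v'), (v', Inl y)]"] xe by simp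
  have "(Inl \<one>, Inl g) \<in> graph_edges\<^sup>*" using p(1) relpow_iff_walk relpow_imp_rtrancl by fast
  then have "(Inl \<one>, Inl x) \<in> graph_edges\<^sup>*"
    using xe(1,2) symD[OF sym_graph_edges] by (meson rtrancl_into_rtrancl)
  from fill[OF this w] obtain cs where cs: "set cs \<subseteq> Z" "length cs \<le> C * (length w + 2)"
    and sum: "\<And>\<phi>. antisymmetric \<phi> \<Longrightarrow> cochain_sum \<phi> w = (\<Sum>c\<leftarrow>cs. cochain_sum \<phi> c)" by blast
  \<comment> \<open>The cut isolates the cone point \<open>v\<close>, so its edges are the edges at
    \<open>v\<close> other than the loop.\<close>
  let ?\<tau> = "\<lambda>u. u = v"
  let ?Q = "(linkage ?\<tau> cs)\<^sup>* `` {(Inl x, v)}"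
  have "\<exists>a\<in>rel_ball n. (Inl a, v) \<in> ?Q"
  proof (rule ccontr)
    assume no: "\<not> ?thesis"
    let ?\<phi> = "cut_flow ?\<tau> ?Q"
    \<comment> \<open>An edge at \<open>v\<close> on such a path has its other end in the ball, so
      by assumption it is not linked to the first edge of \<open>w\<close>.\<close>
    have zero: "cochain_sum ?\<phi> ds = 0"
      if ds: "walk graph_edges a ds b" and dsb: "\<And>d x. d \<in> set ds \<Longrightarrow> fst d = Inl x \<or> snd d = Inl x \<Longrightarrow> x \<in> rel_ball n" for ds a b
    proof (rule cochain_sum_eq_0)
      fix a' b' assume d: "(a', b') \<in> set ds"
      have e: "(a', b') \<in> graph_edges" "(b', a') \<in> graph_edges"
        using walk_edges[OF ds] d symD[OF sym_graph_edges] by blast+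
      have "(b', v) \<notin> ?Q" if v: "a' = v" "b' \<noteq> v"
      proof -
        obtain z where "b' = Inl z" using edge_to_cone_point[of b' i "x <# H i"] e(2) v unfolding v_def by blast
        then show ?thesis using no dsb[OF d, of z] by auto
      qed
      moreover have "(a', v) \<notin> ?Q" if v: "b' = v" "a' \<noteq> v"
      proof -
        obtain z where "a' = Inl z" using edge_to_cone_point[of a' i "x <# H i"] e(1) v unfolding v_def by blast
        then show ?thesis using no dsb[OF d, of z] by auto
      qed
      ultimately show "?\<phi> a' b' = 0" by (auto simp: cut_flow_def)
    qed
    have 1: "?\<phi> (Inl x) v = 1" by (simp add: cut_flow_def v_def)
    have 2: "?\<phi> v (Inl g) = 0" using no g(1) by (auto simp: cut_flow_def v_def)
    have 3: "cochain_sum ?\<phi> p = 0" by (rule zero[OF p(1)]) (rule p(3))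
    have 4: "cochain_sum ?\<phi> p' = 0" by (rule zero[OF p'(1)]) (rule p'(3))
    have 5: "?\<phi> (Inl g') v' = 0" "?\<phi> v' (Inl y) = 0" using vv by (auto simp: cut_flow_def v_def)
    have 6: "cochain_sum ?\<phi> q = 0"
    proof (rule cochain_sum_eq_0)
      fix a b assume "(a, b) \<in> set q"
      then have "a \<noteq> v" "b \<noteq> v" using word_path_Inl[of "(a, b)"] by (auto simp: q_def v_def)
      then show "?\<phi> a b = 0" by (simp add: cut_flow_def)
    qed
    have "cochain_sum ?\<phi> w = 1"
      unfolding w_def cochain_sum_simps cochain_sum_reverse[OF antisymmetric_cut_flow] fst_conv snd_conv 1 2 3 4 5 6
      by simp
    moreover have "cochain_sum ?\<phi> w = 0" by (rule linked_cut_flow_eq_0[OF cs(1) sum])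
    ultimately show False by simp
  qed
  then obtain a where a: "a \<in> rel_ball n" "((Inl x, v), (Inl a, v)) \<in> (linkage ?\<tau> cs)\<^sup>*" by blast
  obtain k where k: "k \<le> card (linkage ?\<tau> cs)" "((Inl x, v), (Inl a, v)) \<in> linkage ?\<tau> cs ^^ k"
    using a(2) rtrancl_finite_eq_relpow[OF linkage_bound(1)[OF cs(1)]] by auto
  \<comment> \<open>Linked edges end in \<open>v\<close> and are not loops, so they start at group
    elements, and \<open>\<omega>\<close> bounds the word distance of each step.\<close>
  have steps: "((Inl x, v), e) \<in> linkage ?\<tau> cs ^^ k \<Longrightarrow> \<exists>z\<in>carrier G. e = (Inl z, v) \<and> wdist x z \<le> \<omega> * k" for e k
  proof (induction k arbitrary: e)
    case 0
    then show ?case using x by (intro bexI[of _ x]) (auto simp: wdist_self)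
  next
    case (Suc k)
    then obtain e1 where e1: "((Inl x, v), e1) \<in> linkage ?\<tau> cs ^^ k" "(e1, e) \<in> linkage ?\<tau> cs" by auto
    obtain z1 where z1: "z1 \<in> carrier G" "e1 = (Inl z1, v)" "wdist x z1 \<le> \<omega> * k" using Suc.IH[OF e1(1)] by blast
    obtain c where c: "c \<in> set cs" "e1 \<in> up_edges ?\<tau> c" "e \<in> up_edges ?\<tau> c" using e1(2) by (auto simp: linkage_def)
    then have cZ: "c \<in> Z" "e1 \<in> sup_edges c" "e \<in> sup_edges c" using cs(1) by (auto simp: up_edges_def)
    have "e = (fst e, v)" "fst e \<noteq> v" using c(3) by (auto simp: up_edges_def)
    moreover have "e \<in> graph_edges" using cell_edges cZ by blast
    ultimately obtain z where z: "z \<in> carrier G" "e = (Inl z, v)"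
      using edge_to_cone_point[of "fst e" i "x <# H i"] unfolding v_def by metis
    have "wdist z1 z \<le> \<omega>" using \<omega>[rule_format, of e1 e z1 z] cZ z1 z by (auto simp: cell_adjacent_def)
    then show ?case using wdist_triangle[OF x z1(1) z(1)] z1(3) z by auto
  qed
  have "wdist x a \<le> \<omega> * k" using steps[OF k(2)] by auto
  \<comment> \<open>\<open>w\<close> has length at most \<open>4 * n + R + 4\<close>, and
    \<open>fill\<close> adds \<open>2\<close>.\<close>
  also have "\<dots> \<le> \<omega> * (M * M * (C * (4 * n + R + 6)))"
  proof (rule mult_le_mono2)
    have "k \<le> M * M * crossing_count ?\<tau> cs" using k(1) linkage_bound(2)[OF cs(1), of ?\<tau>] by simp
    also have "\<dots> \<le> M * M * length cs" by (simp add: crossing_count_def)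
    also have "\<dots> \<le> M * M * (C * (length w + 2))" by (intro mult_le_mono2 cs)
    also have "\<dots> \<le> M * M * (C * (4 * n + R + 6))"
      using p(2) p'(2) q(2) by (intro mult_le_mono2) (simp add: w_def)
    finally show "k \<le> M * M * (C * (4 * n + R + 6))" .
  qed
  finally show ?thesis using a(1) by blast
qed

section \<open>Kernels on relative balls and on the group\<close>

lemma coset_isometry:
  assumes "g \<in> carrier G" "i \<in> I" "x \<in> g <# H i" "y \<in> g <# H i"
  shows "inv g \<otimes> x \<in> H i" "wd (inv g \<otimes> x) (inv g \<otimes> y) = wd x y"
proof -
  obtain h k where h: "h \<in> H i" "x = g \<otimes> h" "k \<in> H i" "y = g \<otimes> k" using assms by (auto simp: l_coset_def)
  then have hk: "h \<in> carrier G" "k \<in> carrier G" using H_carrier assms by blast+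
  then show "inv g \<otimes> x \<in> H i" using h assms by (simp add: m_assoc[symmetric])
  show "wd (inv g \<otimes> x) (inv g \<otimes> y) = wd x y"
    using wdist_left_mult[of "inv g" x y] h hk assms by (simp add: word_metric_eq)
qed

text \<open>A point of the next ball is near the previous ball or lies in a peripheral coset through
  it. A slowly varying cutoff \<open>\<phi>\<close> shifts the weight from the index
  \<open>None\<close> to that of the coset; close points at which it is below \<open>1\<close> share
  their coset by separation.\<close>

lemma kernel_embeddable_rel_ball:
  assumes FG: "fine_graph graph_edges Z (Inl \<one>) M N C"
    and \<omega>: "\<forall>e e' x y. (e, e') \<in> cell_adjacent Z \<longrightarrow> fst e = Inl x \<longrightarrow> fst e' = Inl y \<longrightarrow> wdist x y \<le> \<omega>"
    and I: "finite I" and HE: "\<And>i. i \<in> I \<Longrightarrow> kernel_embeddable (H i) wd"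
  shows "kernel_embeddable (rel_ball n) wd"
proof (induction n)
  case 0
  have "normalized_kernel {\<one>} wd R \<epsilon> (\<lambda>_ _. 1)" if "0 < \<epsilon>" for R \<epsilon>
    using that by (simp add: normalized_kernel_def psd_on_one)
  moreover have "\<exists>T. \<forall>x\<in>{\<one>}. \<forall>y\<in>{\<one>}. T \<le> wd x y \<longrightarrow> 1 \<le> \<delta>" for \<delta> :: real
    by (intro exI[of _ 1]) (simp add: word_metric_eq wdist_self)
  ultimately show ?case unfolding kernel_embeddable_iff rel_ball.simps by blast
next
  case (Suc n)
  show ?case
  proof (rule kernel_embeddable_glue[where 'e = "('i \<times> 'g set) option"])
    fix R \<epsilon> :: real assume \<epsilon>: "0 < \<epsilon>"
    define r where "r = nat \<lfloor>R\<rfloor>"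
    have r: "wdist x y \<le> r" if "wd x y \<le> R" for x y
      using that by (simp add: r_def word_metric_eq) linarith
    \<comment> \<open>Beyond the bound of \<open>coset_separation\<close>, points at distance at
      most \<open>r\<close> share their coset. The \<open>Suc\<close> makes \<open>\<kappa>\<close>
      at least \<open>1\<close>, which covers the points \<open>g \<otimes> s\<close> with
      \<open>s\<close> in \<open>S\<close>.\<close>
    define \<kappa> where "\<kappa> = Suc (\<omega> * (M * M * (C * (4 * n + r + 6))))"
    \<comment> \<open>The cutoff has slope \<open>1 / K\<close>, and the distance to the ball
      changes by at most \<open>r\<close> between close points.\<close>
    define K where "K = Suc (nat \<lceil>real r / \<epsilon>\<rceil>)"
    have K: "real r / real K \<le> \<epsilon>"
    proof -
      have "real r / \<epsilon> \<le> real K" by (simp add: K_def) linarith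
      then have "real r \<le> real K * \<epsilon>" using \<epsilon> by (simp only: pos_divide_le_eq)
      moreover have "0 < real K" by (simp add: K_def)
      ultimately show ?thesis by (simp only: pos_divide_le_eq mult.commute)
    qed
    define dA where "dA x = (LEAST m. \<exists>a\<in>rel_ball n. wdist x a = m)" for x
    have one: "\<one> \<in> rel_ball n" for n by (induction n) auto
    then have dA: "\<exists>a\<in>rel_ball n. wdist x a = dA x" for x
    proof -
      have "\<exists>m. \<exists>a\<in>rel_ball n. wdist x a = m" using one by blast
      from LeastI_ex[OF this] show ?thesis unfolding dA_def .
    qed
    have dA_le: "dA x \<le> wdist x a" if "a \<in> rel_ball n" for x a
      unfolding dA_def by (rule Least_le) (use that in blast)
    have dA_lip: "dA x \<le> wdist x y + dA y" if xy: "x \<in> carrier G" "y \<in> carrier G" for x y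
    proof -
      obtain a where a: "a \<in> rel_ball n" "wdist y a = dA y" using dA by blast
      then show ?thesis using dA_le[OF a(1), of x] wdist_triangle[OF xy, of a] rel_ball_carrier by fastforce
    qed
    define \<phi> where "\<phi> x = max 0 (min 1 (1 - (real (dA x) - real \<kappa>) / real K))" for x
    have \<phi>01: "0 \<le> \<phi> x" "\<phi> x \<le> 1" for x by (auto simp: \<phi>_def)
    have \<phi>1: "\<phi> x = 1" if "dA x \<le> \<kappa>" for x
    proof -
      have "(real (dA x) - real \<kappa>) / real K \<le> 0" using that by (intro divide_nonpos_nonneg) auto
      then show ?thesis by (simp add: \<phi>_def)
    qed
    have \<phi>0: "\<phi> x = 0" if "\<kappa> + K < dA x" for x
    proof -
      have "1 \<le> (real (dA x) - real \<kappa>) / real K" using that by (simp add: K_def field_simps)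
      then show ?thesis by (simp add: \<phi>_def)
    qed
    have \<phi>_lip: "\<bar>\<phi> x - \<phi> y\<bar> \<le> \<epsilon>" if xy: "x \<in> carrier G" "y \<in> carrier G" "wd x y \<le> R" for x y
    proof -
      have "dA x \<le> r + dA y" "dA y \<le> r + dA x"
        using dA_lip[OF xy(1,2)] dA_lip[OF xy(2,1)] r[OF xy(3)] wdist_commute[OF xy(1,2)] by auto
      then have "\<bar>real (dA x) - real (dA y)\<bar> \<le> real r" by linarith
      then have "\<bar>real (dA x) - real (dA y)\<bar> / real K \<le> real r / real K" by (intro divide_right_mono) auto
      then have "\<bar>(real (dA x) - real \<kappa>) / real K - (real (dA y) - real \<kappa>) / real K\<bar> \<le> \<epsilon>"
        using K by (simp add: diff_divide_distrib[symmetric] abs_divide)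
      then show ?thesis unfolding \<phi>_def by (auto simp: max_def min_def abs_if split: if_splits)
    qed
    define good where "good x p \<longleftrightarrow> fst p \<in> I \<and> snd p = x <# H (fst p) \<and> (\<exists>g\<in>rel_ball n. snd p = g <# H (fst p))" for x p
    \<comment> \<open>A point determines its coset only together with the index, so one of the
      suitable pairs is chosen.\<close>
    define cs where "cs x = (SOME p. good x p)" for x
    have cs: "good x (cs x)" if x: "x \<in> rel_ball (Suc n)" "\<kappa> < dA x" for x
    proof -
      consider "x \<in> rel_ball n" | g s where "x = g \<otimes> s" "g \<in> rel_ball n" "s \<in> S"
        | g h i where "x = g \<otimes> h" "g \<in> rel_ball n" "i \<in> I" "h \<in> H i"
        using x by auto
      then have "\<exists>p. good x p"
      proof cases
        case 1
        then show ?thesis using x(2) dA_le[OF 1, of x] rel_ball_carrier wdist_self[of x] by (auto simp: subset_iff)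
      next
        case 2
        have G: "g \<in> carrier G" "s \<in> carrier G" using 2 rel_ball_carrier S_carrier by blast+
        have "wdist g x = wlen s" using G 2 by (simp add: wdist_def m_assoc[symmetric])
        also have "\<dots> \<le> 1" using wlen_le[of "[s]"] 2 G by simp
        finally have "wdist x g \<le> 1" using wdist_commute[of g x] G 2 by simp
        then have "dA x \<le> 1" using dA_le[OF 2(2), of x] by simp
        then show ?thesis using x(2) by (simp add: \<kappa>_def)
      next
        case 3
        then have "g \<in> carrier G" using rel_ball_carrier by blast
        then show ?thesis using 3 coset_absorb[of g i h] by (intro exI[of _ "(i, g <# H i)"]) (auto simp: good_def)
      qed
      then show ?thesis unfolding cs_def by (rule someI_ex)
    qed
    define U where "U e = (case e of None \<Rightarrow> {x \<in> carrier G. dA x \<le> \<kappa> + K} | Some (i, P) \<Rightarrow> P)" for e :: "('i \<times> 'g set) option"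
    define J where "J = insert None (Some ` {(i, P). i \<in> I \<and> (\<exists>g\<in>rel_ball n. P = g <# H i)})"
    define \<zeta> where "\<zeta> x e = (case e of None \<Rightarrow> sqrt (\<phi> x) | Some p \<Rightarrow> if p = cs x then sqrt (1 - \<phi> x) else 0)" for x e
    have equi: "equi_embeddable J U wd"
    \<comment> \<open>The neighbourhood is modelled on the ball by nearest points, which moves its
      points by at most \<open>\<kappa> + K\<close>; the cosets are translates of the
      \<open>H i\<close>.\<close>
    proof (rule equi_embeddable_coarse[where J = "insert None (Some ` I)" and N = "case_option (rel_ball n) H" and C = "2 * real (\<kappa> + K)"])
      show "finite (insert None (Some ` I))" using I by simp
      show "kernel_embeddable (case_option (rel_ball n) H j) wd" if "j \<in> insert None (Some ` I)" for j
        using that Suc.IH HE by auto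
      fix e assume e: "e \<in> J"
      show "\<exists>j\<in>insert None (Some ` I). \<exists>f\<in>U e \<rightarrow> case_option (rel_ball n) H j. \<forall>x\<in>U e. \<forall>y\<in>U e.
          wd (f x) (f y) \<le> wd x y + 2 * real (\<kappa> + K) \<and> wd x y \<le> wd (f x) (f y) + 2 * real (\<kappa> + K)"
      proof (cases e)
        case None
        obtain f where f: "\<And>x. f x \<in> rel_ball n" "\<And>x. wdist x (f x) = dA x" using dA by metis
        have fG: "f x \<in> carrier G" for x using f(1) rel_ball_carrier by blast
        have "wdist (f x) (f y) \<le> wdist x y + 2 * (\<kappa> + K) \<and> wdist x y \<le> wdist (f x) (f y) + 2 * (\<kappa> + K)"
          if xy: "x \<in> U e" "y \<in> U e" for x y
        proof -
          have x: "x \<in> carrier G" "wdist x (f x) \<le> \<kappa> + K" and y: "y \<in> carrier G" "wdist y (f y) \<le> \<kappa> + K"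
            using xy f(2) by (auto simp: U_def None)
          show ?thesis
            using wdist_triangle[OF fG x(1) fG, of x y] wdist_triangle[OF x(1) y(1) fG, of y]
              wdist_triangle[OF x(1) fG y(1), of x] wdist_triangle[OF fG fG y(1), of x y]
              wdist_commute[OF x(1) fG, of x] wdist_commute[OF y(1) fG, of y] x(2) y(2) by auto
        qed
        then have "\<forall>x\<in>U e. \<forall>y\<in>U e. wd (f x) (f y) \<le> wd x y + 2 * real (\<kappa> + K) \<and> wd x y \<le> wd (f x) (f y) + 2 * real (\<kappa> + K)"
          unfolding word_metric_eq by (metis of_nat_add of_nat_le_iff of_nat_mult of_nat_numeral)
        then show ?thesis using f(1) by (intro bexI[of _ None] bexI[of _ f]) auto
      next
        case (Some p)
        then obtain i g where p: "e = Some (i, g <# H i)" "i \<in> I" "g \<in> rel_ball n" using e by (auto simp: J_def)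
        have g: "g \<in> carrier G" using p rel_ball_carrier by blast
        show ?thesis
          using coset_isometry[OF g p(2)] p(2)
          by (intro bexI[of _ "Some i"] bexI[of _ "\<lambda>x. inv g \<otimes> x"]) (auto simp: U_def p)
      qed
    qed
    have supp: "{e. \<zeta> x e \<noteq> 0} \<subseteq> {None, Some (cs x)}" for x by (auto simp: \<zeta>_def split: option.splits if_splits)
    have ov: "overlap \<zeta> x y = \<zeta> x None * \<zeta> y None + \<zeta> x (Some (cs x)) * \<zeta> y (Some (cs x))" for x y
    proof -
      have "overlap \<zeta> x y = (\<Sum>e\<in>{None, Some (cs x)}. \<zeta> x e * \<zeta> y e)"
        unfolding overlap_def using supp by (intro sum.mono_neutral_left) auto
      then show ?thesis by simp
    qed
    have ballG: "x \<in> carrier G" if "x \<in> rel_ball (Suc n)" for x using rel_ball_carrier that by blast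
    have inU: "e \<in> J \<and> x \<in> U e" if x: "x \<in> rel_ball (Suc n)" and e: "\<zeta> x e \<noteq> 0" for x e
    proof (cases e)
      case None
      then have "\<phi> x \<noteq> 0" using e by (simp add: \<zeta>_def)
      then have "dA x \<le> \<kappa> + K" using \<phi>0 by (meson not_le)
      then show ?thesis using None ballG[OF x] by (auto simp: J_def U_def)
    next
      case (Some p)
      then have p: "p = cs x" "\<phi> x \<noteq> 1" using e by (auto simp: \<zeta>_def split: if_splits)
      then have "\<kappa> < dA x" using \<phi>1 by (meson not_le)
      then have "good x p" using cs[OF x] p by simp
      moreover have "x \<in> x <# H i" if "i \<in> I" for i
        using subgroup.one_closed[OF H_subgroup[OF that]] ballG[OF x] by (force simp: l_coset_def)
      ultimately show ?thesis using Some by (cases p) (auto simp: good_def J_def U_def)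
    qed
    have unit: "overlap \<zeta> x x = 1" for x using \<phi>01 by (simp add: ov) (simp add: \<zeta>_def)
    have over: "1 - \<epsilon> \<le> overlap \<zeta> x y"
      if xy: "x \<in> rel_ball (Suc n)" "y \<in> rel_ball (Suc n)" "wd x y \<le> R" for x y
    proof -
      have xyG: "x \<in> carrier G" "y \<in> carrier G" using xy rel_ball_carrier by blast+
      have smin: "min a b \<le> sqrt a * sqrt b" if "0 \<le> a" "0 \<le> b" for a b :: real
      proof -
        have "sqrt (min a b) * sqrt (min a b) \<le> sqrt a * sqrt b" by (intro mult_mono) (auto simp: that)
        then show ?thesis using that by simp
      qed
      have lip: "\<bar>\<phi> x - \<phi> y\<bar> \<le> \<epsilon>" by (rule \<phi>_lip[OF xyG xy(3)])
      have s: "overlap \<zeta> x y = sqrt (\<phi> x) * sqrt (\<phi> y)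
          + (if cs x = cs y then sqrt (1 - \<phi> x) * sqrt (1 - \<phi> y) else 0)"
        by (simp add: ov \<zeta>_def)
      have m: "min (\<phi> x) (\<phi> y) \<le> sqrt (\<phi> x) * sqrt (\<phi> y)" using \<phi>01 by (intro smin) auto
      have m': "min (1 - \<phi> x) (1 - \<phi> y) \<le> sqrt (1 - \<phi> x) * sqrt (1 - \<phi> y)" using \<phi>01 by (intro smin) auto
      have "\<phi> x = 1 \<or> \<phi> y = 1 \<or> cs x = cs y"
      proof (rule ccontr)
        assume no: "\<not> ?thesis"
        then have far: "\<kappa> < dA x" "\<kappa> < dA y" using \<phi>1 by (meson not_le)+
        obtain i P where p: "cs x = (i, P)" by fastforce
        obtain i' P' where p': "cs y = (i', P')" by fastforce
        obtain g where g: "i \<in> I" "P = x <# H i" "g \<in> rel_ball n" "x <# H i = g <# H i"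
          using cs[OF xy(1) far(1)] by (auto simp: good_def p)
        obtain g' where g': "i' \<in> I" "P' = y <# H i'" "g' \<in> rel_ball n" "y <# H i' = g' <# H i'"
          using cs[OF xy(2) far(2)] by (auto simp: good_def p')
        have "(i, x <# H i) \<noteq> (i', y <# H i')" using no p p' g(2) g'(2) by simp
        then obtain a where "a \<in> rel_ball n" "wdist x a \<le> \<omega> * (M * M * (C * (4 * n + r + 6)))"
          using coset_separation[OF FG \<omega> xyG g(1) g'(1) g(3,4) g'(3,4) _ r[OF xy(3)]] by blast
        then show False using dA_le[of a x] far(1) by (simp add: \<kappa>_def)
      qed
      moreover have "0 \<le> sqrt (1 - \<phi> x) * sqrt (1 - \<phi> y)" using \<phi>01 by simp
      \<comment> \<open>If the cosets agree, the two minima add up to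
        \<open>1 - \<bar>\<phi> x - \<phi> y\<bar>\<close>; if one of the cutoffs is
        \<open>1\<close>, the first minimum alone is large enough.\<close>
      ultimately show ?thesis
        unfolding s using m m' lip \<phi>01[of x] \<phi>01[of y] by (auto simp: min_def split: if_splits)
    qed
    have nn: "0 \<le> \<zeta> x e" for x e using \<phi>01 by (simp add: \<zeta>_def split: option.splits)
    have fin: "finite {e. \<zeta> x e \<noteq> 0}" for x by (rule finite_subset[OF supp]) simp
    show "\<exists>I U (\<zeta> :: 'g \<Rightarrow> ('i \<times> 'g set) option \<Rightarrow> real). equi_embeddable I U wd \<and>
      almost_invariant (rel_ball (Suc n)) (\<lambda>x y. wd x y \<le> R) \<epsilon> \<zeta> \<and>
      (\<forall>x\<in>rel_ball (Suc n). \<forall>e. \<zeta> x e \<noteq> 0 \<longrightarrow> e \<in> I \<and> x \<in> U e)"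
      using equi fin inU nn unit over unfolding almost_invariant_def
      by (intro exI[of _ J] exI[of _ U] exI[of _ \<zeta>] conjI ballI impI allI) auto
  qed
qed

text \<open>\<open>U e\<close> collects the group elements within \<open>r\<close> of the vertex in
  \<open>e\<close>. That vertex may be a cone point, so a group element at distance at most
  \<open>1\<close> from it is translated to the identity; hence all pieces embed isometrically into
  one relative ball of radius \<open>r + 1\<close>.\<close>

lemma kernel_embeddable_group:
  assumes "relatively_hyperbolic G I H"
    and I: "finite I" and HE: "\<And>i. i \<in> I \<Longrightarrow> kernel_embeddable (H i) wd"
  shows "kernel_embeddable (carrier G) wd"
proof -
  obtain Z M N C \<omega> where FG: "fine_graph graph_edges Z (Inl \<one>) M N C"
    and \<omega>: "\<forall>e e' x y. (e, e') \<in> cell_adjacent Z \<longrightarrow> fst e = Inl x \<longrightarrow> fst e' = Inl y \<longrightarrow> wdist x y \<le> \<omega>"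
    by (rule coned_off_fine_graph[OF assms(1)]) blast
  interpret fine_graph graph_edges Z "Inl \<one>" M N C by (rule FG)
  have reach: "Inl x \<in> reachable" if "x \<in> carrier G" for x
    using wdist_walk(1)[OF one_closed that] relpow_iff_walk relpow_imp_rtrancl by fast
  show ?thesis
  proof (rule kernel_embeddable_glue[where 'e = "nat \<times> ('g, 'i) vertex"])
    fix R \<epsilon> :: real assume \<epsilon>: "0 < \<epsilon>"
    define R' where "R' = nat \<lfloor>R\<rfloor>"
    have R': "(Inl x, Inl y) \<in> graph_edges ^^ R'" if xy: "x \<in> carrier G" "y \<in> carrier G" "wd x y \<le> R" for x y
    proof (rule relpow_E_mono)
      show "wdist x y \<le> R'" using xy(3) by (simp add: R'_def word_metric_eq) linarith
      show "(Inl x, Inl y) \<in> graph_edges ^^ wdist x y" unfolding relpow_iff_walk using wdist_walk[OF xy(1,2)] by blast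
    qed
    obtain r and \<zeta> :: "('g, 'i) vertex \<Rightarrow> nat \<times> ('g, 'i) vertex \<Rightarrow> real" where
      \<zeta>: "almost_invariant reachable (\<lambda>x y. (x, y) \<in> graph_edges ^^ R') \<epsilon> \<zeta>"
        "\<forall>x\<in>reachable. \<forall>e. \<zeta> x e \<noteq> 0 \<longrightarrow> (x, snd e) \<in> graph_edges ^^ r"
      using almost_invariant_vectors[OF \<epsilon>, of R'] by blast
    define U where "U e = {x \<in> carrier G. (Inl x, snd e) \<in> graph_edges ^^ r}" for e :: "nat \<times> ('g, 'i) vertex"
    have "equi_embeddable UNIV U wd"
    proof (rule equi_embeddable_coarse[where J = "{()}" and N = "\<lambda>_. rel_ball (Suc r)" and C = 0])
      fix e :: "nat \<times> ('g, 'i) vertex"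
      have near: "\<exists>a\<in>carrier G. \<forall>x\<in>U e. (Inl x, Inl a) \<in> graph_edges ^^ Suc r" if u: "u \<in> U e" for u
      proof -
        have "snd e \<in> reachable" using reachable_relpow[OF reach] u by (auto simp: U_def)
        then have "snd e \<in> graph_vertices" using reachable_vertex by blast
        then obtain a where a: "a \<in> carrier G" "(snd e, Inl a) \<in> graph_edges"
          by (auto simp: graph_vertices_def graph_edges_def)
        then show ?thesis by (intro bexI[of _ a]) (auto simp: U_def)
      qed
      show "\<exists>j\<in>{()}. \<exists>f\<in>U e \<rightarrow> rel_ball (Suc r). \<forall>x\<in>U e. \<forall>y\<in>U e.
          wd (f x) (f y) \<le> wd x y + 0 \<and> wd x y \<le> wd (f x) (f y) + 0"
      proof (cases "U e = {}")
        case False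
        then obtain a where a: "a \<in> carrier G" "\<And>x. x \<in> U e \<Longrightarrow> (Inl x, Inl a) \<in> graph_edges ^^ Suc r"
          using near by blast
        have "inv a \<otimes> x \<in> rel_ball (Suc r)" if x: "x \<in> U e" for x
        proof -
          have "(Inl a, Inl x) \<in> graph_edges ^^ Suc r" using relpow_E_sym[OF a(2)[OF x]] .
          then obtain ds where ds: "walk graph_edges (Inl a) ds (Inl x)" "length ds = Suc r"
            unfolding relpow_iff_walk by blast
          have "walk graph_edges (Inl \<one>) (map (act_dart (inv a)) ds) (Inl (inv a \<otimes> x))"
            using act_walk[OF _ ds(1), of "inv a"] a(1) by simp
          then have "(Inl \<one>, Inl (inv a \<otimes> x)) \<in> graph_edges ^^ Suc r"
            unfolding relpow_iff_walk using ds(2) by (intro exI[of _ "map (act_dart (inv a)) ds"]) simp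
          then show ?thesis using rel_ball_relpow by blast
        qed
        moreover have "wd (inv a \<otimes> x) (inv a \<otimes> y) = wd x y" if "x \<in> U e" "y \<in> U e" for x y
          using that a(1) by (simp add: U_def word_metric_eq wdist_left_mult)
        ultimately show ?thesis by (intro bexI[of _ "()"] bexI[of _ "\<lambda>x. inv a \<otimes> x"]) auto
      qed auto
    next
      show "kernel_embeddable (rel_ball (Suc r)) wd"
        by (rule kernel_embeddable_rel_ball[OF FG \<omega> I HE])
    qed simp
    then show "\<exists>I U (\<zeta> :: 'g \<Rightarrow> nat \<times> ('g, 'i) vertex \<Rightarrow> real). equi_embeddable I U wd \<and>
      almost_invariant (carrier G) (\<lambda>x y. wd x y \<le> R) \<epsilon> \<zeta> \<and>
      (\<forall>x\<in>carrier G. \<forall>e. \<zeta> x e \<noteq> 0 \<longrightarrow> e \<in> I \<and> x \<in> U e)"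
      using \<zeta> reach R' unfolding almost_invariant_def overlap_def
      by (intro exI[of _ UNIV] exI[of _ U] exI[of _ "\<lambda>x. \<zeta> (Inl x)"] conjI ballI impI allI) (auto simp: U_def)
  qed
qed

end

lemma uniformly_embeddable_subset:
  assumes "uniformly_embeddable M d" "N \<subseteq> M"
  shows "uniformly_embeddable N d"
proof -
  obtain V :: "(real, 'a \<Rightarrow> real) module" and ip F where
    H: "real_hilbert_space V ip" and UE: "uniform_embedding M d V ip F"
    using assms(1) unfolding uniformly_embeddable_def by blast
  have sub: "\<And>x. x \<in> N \<Longrightarrow> x \<in> M" using assms(2) by blast
  have "F \<in> N \<rightarrow> carrier V" using UE sub by (simp add: uniform_embedding_def Pi_iff)
  moreover obtain \<rho>m \<rho>p :: "real \<Rightarrow> real" where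
    "mono_on {0..} \<rho>m" "mono_on {0..} \<rho>p" "\<rho>m \<in> {0..} \<rightarrow> {0..}" "\<rho>p \<in> {0..} \<rightarrow> {0..}"
    "filterlim \<rho>m at_top at_top" "filterlim \<rho>p at_top at_top"
    "\<forall>x\<in>M. \<forall>y\<in>M. \<rho>m (d x y) \<le> ip_norm ip (F x \<ominus>\<^bsub>V\<^esub> F y) \<and> ip_norm ip (F x \<ominus>\<^bsub>V\<^esub> F y) \<le> \<rho>p (d x y)"
    using UE unfolding uniform_embedding_def by (elim conjE exE)
  ultimately have "uniform_embedding N d V ip F"
    unfolding uniform_embedding_def using sub
    by - (rule conjI, simp, rule exI[of _ \<rho>m], rule exI[of _ \<rho>p], simp)
  then show ?thesis using H unfolding uniformly_embeddable_def by blast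
qed

theorem theorem5p4:
  fixes \<Gamma> :: "('g, 'b) monoid_scheme" and S :: "'g set" and n :: nat and H :: "nat \<Rightarrow> 'g set"
  assumes "group \<Gamma>"
    and "finite S" and "symmetric_subset \<Gamma> S" and "generate \<Gamma> S = carrier \<Gamma>"
    and "\<And>i. i \<in> {1..n} \<Longrightarrow> subgroup (H i) \<Gamma>"
    and "relatively_hyperbolic \<Gamma> {1..n} H"
  shows "uniformly_embeddable (carrier \<Gamma>) (word_metric \<Gamma> S) \<longleftrightarrow>
    (\<forall>i\<in>{1..n}. uniformly_embeddable (H i) (word_metric \<Gamma> S))"
proof
  interpret peripheral_group \<Gamma> S "{1..n}" H
    using assms(1-5) by (intro peripheral_group.intro marked_group.intro
        marked_group_axioms.intro peripheral_group_axioms.intro)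
  assume "uniformly_embeddable (carrier \<Gamma>) (word_metric \<Gamma> S)"
  then show "\<forall>i\<in>{1..n}. uniformly_embeddable (H i) (word_metric \<Gamma> S)"
    using uniformly_embeddable_subset H_carrier by blast
next
  interpret peripheral_group \<Gamma> S "{1..n}" H
    using assms(1-5) by (intro peripheral_group.intro marked_group.intro
        marked_group_axioms.intro peripheral_group_axioms.intro)
  assume HE: "\<forall>i\<in>{1..n}. uniformly_embeddable (H i) (word_metric \<Gamma> S)"
  have nonneg: "0 \<le> word_metric \<Gamma> S x y" for x y by (simp add: word_metric_eq)
  have "kernel_embeddable (carrier \<Gamma>) (word_metric \<Gamma> S)"
    using HE nonneg
    by (intro kernel_embeddable_group[OF assms(6)] kernel_embeddable_if_uniformly_embeddable) auto
  then show "uniformly_embeddable (carrier \<Gamma>) (word_metric \<Gamma> S)"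
    by (rule uniformly_embeddable_if_kernel_embeddable[OF nonneg countable_carrier one_closed])
qed

end
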